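(* Let $\mathcal{C}\in\{NC',NC_b'\}$ and $t\in\mathbb{C}\setminus\{0\}$, and let $\beta=\{\{1\},\{1'\}\}\in P(1,1)$. Then the map $$\phi:\mathbb{N}_0\times\{1,-1\}\to\{\text{isomorphism classes of non-zero indecomposable objects in }\underline{\mathrm{Rep}}(\mathcal{C},t)\}$$ with $\phi(k,1)=\mathcal{L}_{\mathrm{id}_k}(V_{\mathrm{triv}})$ and $\phi(k,-1)=\mathcal{L}_{\mathrm{id}_k\otimes\beta}(V_{\mathrm{triv}})$ is a bijection.
   Context: For $k,l\in\mathbb{N}_0$ let $P(k,l)$ be the set of set partitions of $\{1,\dots,k,1',\dots,l'\}$ ($k$ upper points, $l$ lower points). Operations: the tensor product $p\otimes q$ is horizontal concatenation; the involution $p^*\in P(l,k)$ swaps upper and lower points; for $p\in P(k,l)$, $q\in P(l,m)$, stack $p$ above $q$, identifying the lower points of $p$ with the upper points of $q$; $q\cdot p\in P(k,m)$ is the induced partition of the outer points by connected components, and $\ell(q,p)$ is the number of connected components containing only middle points. A category of partitions $\mathcal{C}$ is a collection of subsets $\mathcal{C}(k,l)\subseteq P(k,l)$ containing $\{\{1,2\}\}\in P(2,0)$ and $\{\{1,1'\}\}\in P(1,1)$ and closed under $\otimes$, $*$ and $\cdot$. Write $\mathrm{id}_k=\{\{i,i'\}:1\le i\le k\}\in P(k,k)$. A partition is non-crossing if, with its points ordered $1,\dots,k,l',\dots,1'$, there are no points $a<b<c<d$ with $a,c$ in one block and $b,d$ in a different block. The categories of partitions considered: $NC'$ = all non-crossing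 partitions with an even number of blocks of odd size; $NC'_b$ = all non-crossing partitions with blocks of size one or two only and an even number of blocks of size one. For $t\in\mathbb{C}$, $\underline{\mathrm{Rep}}_0(\mathcal{C},t)$ is the $\mathbb{C}$-linear category with objects $[k]$, $k\in\mathbb{N}_0$, $\mathrm{Hom}([k],[l])=\mathbb{C}\,\mathcal{C}(k,l)$, and composition extending $qp:=t^{\ell(q,p)}\,q\cdot p$; $\underline{\mathrm{Rep}}(\mathcal{C},t)$ is its Karoubi envelope (idempotent completion of the additive completion). For an idempotent $e\in\mathrm{End}([k])$, $([k],e)$ denotes its image. A through-block is a block containing both upper and lower points; $t(p)$ is the number of through-blocks of $p$. A partition $p\in P(k,k)$ is projective if $p=p_0^*\cdot p_0$ for some $p_0\in P(k,t(p))$. For a projective $p\in\mathcal{C}(k,k)$ with $T=t(p)$ and such a $p_0$, the group $S(p):=\{\sigma\in S_T:p_0^*\cdot\sigma\cdot p_0\in\mathcal{C}(k,k)\}$ (with $\sigma$ regarded as the partition $\{\{i,\sigma(i)'\}\}\in P(T,T)$) is trivial for the two categories considered here. Objects $\mathcal{L}_p(V_{\mathrm{triv}})$: $V_{\mathrm{triv}}=\mathbb{C}$ is the trivial representation of the trivial group. With $E=\mathrm{End}([k])$, let $I_p\subseteq pEp$ be the ideal of elements that are linear combinations of partitions with fewer than $t(p)$ through-blocks. Then $pEp/I_p\cong\mathbb{C}$ with unit the class of $t^{-\ell(p,p)}p$. Let $\mathcal{L}_p\in pEp$ be a primitive idempotent lifting this unit (unique up to conjugation); $\mathcal{L}_p(V_{\mathrm{triv}})$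 is the isomorphism class of $([k],\mathcal{L}_p)$. *)

theory Defs
  imports Complex_Main "HOL-Library.Disjoint_Sets" "HOL-Library.Poly_Mapping"
    "HOL-Library.Function_Algebras"
begin

section \<open>Set partitions of two rows of points\<close>

text \<open>\<open>Up i\<close> is the upper point $i$ and \<open>Low j\<close> the lower point $j'$; both are counted from 1.\<close>

datatype pt = Up nat | Low nat

type_synonym ptn = "pt set set"

definition points :: "nat \<Rightarrow> nat \<Rightarrow> pt set" where
  "points k l = Up ` {1..k} \<union> Low ` {1..l}"

definition partitions :: "nat \<Rightarrow> nat \<Rightarrow> ptn set" where
  "partitions k l = {p. partition_on (points k l) p}"

definition id_ptn :: "nat \<Rightarrow> ptn" where
  "id_ptn k = (\<lambda>i. {Up i, Low i}) ` {1..k}"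

definition beta :: ptn where
  "beta = {{Up 1}, {Low 1}}"

text \<open>Horizontal concatenation; the first two arguments are the numbers of upper and of lower
  points of the left factor.\<close>

fun shift_pt :: "nat \<Rightarrow> nat \<Rightarrow> pt \<Rightarrow> pt" where
  "shift_pt k l (Up i) = Up (k + i)"
| "shift_pt k l (Low j) = Low (l + j)"

definition tensor :: "nat \<Rightarrow> nat \<Rightarrow> ptn \<Rightarrow> ptn \<Rightarrow> ptn" where
  "tensor k l p q = p \<union> (\<lambda>B. shift_pt k l ` B) ` q"

text \<open>Vertical composition. For \<open>p\<close> with lower row and \<open>q\<close> with upper row of the same length,
  \<open>stack q p\<close> collects the blocks of both, placed in a diagram with three rows, the
  middle row being shared.\<close>

datatype pt3 = Top nat | Mid nat | Bot nat

fun in_upper :: "pt \<Rightarrow> pt3" where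
  "in_upper (Up i) = Top i"
| "in_upper (Low j) = Mid j"

fun in_lower :: "pt \<Rightarrow> pt3" where
  "in_lower (Up i) = Mid i"
| "in_lower (Low j) = Bot j"

fun in_outer :: "pt \<Rightarrow> pt3" where
  "in_outer (Up i) = Top i"
| "in_outer (Low j) = Bot j"

definition stack :: "ptn \<Rightarrow> ptn \<Rightarrow> pt3 set set" where
  "stack q p = (\<lambda>B. in_upper ` B) ` p \<union> (\<lambda>B. in_lower ` B) ` q"

definition components :: "ptn \<Rightarrow> ptn \<Rightarrow> pt3 set set" where
  "components q p =
     \<Union> (stack q p) // {(x, y). \<exists>B \<in> stack q p. x \<in> B \<and> y \<in> B}\<^sup>+"

text \<open>\<open>pcomp q p\<close> is $q \cdot p$ and \<open>loops q p\<close> is $\ell(q,p)$: first \<open>p\<close>, then \<open>q\<close> below it.\<close>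

definition pcomp :: "ptn \<Rightarrow> ptn \<Rightarrow> ptn" where
  "pcomp q p = (\<lambda>K. in_outer -` K) ` components q p - {{}}"

definition loops :: "ptn \<Rightarrow> ptn \<Rightarrow> nat" where
  "loops q p = card {K \<in> components q p. K \<subseteq> range Mid}"

definition through_blocks :: "ptn \<Rightarrow> nat" where
  "through_blocks p = card {B \<in> p. (\<exists>i. Up i \<in> B) \<and> (\<exists>j. Low j \<in> B)}"

text \<open>Position in the cyclic reading $1,\dots,k,l',\dots,1'$.\<close>

fun pos :: "nat \<Rightarrow> nat \<Rightarrow> pt \<Rightarrow> nat" where
  "pos k l (Up i) = i"
| "pos k l (Low j) = k + (l + 1 - j)"

definition noncrossing :: "nat \<Rightarrow> nat \<Rightarrow> ptn \<Rightarrow> bool" where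
  "noncrossing k l p \<longleftrightarrow>
     \<not> (\<exists>B \<in> p. \<exists>B' \<in> p. B \<noteq> B' \<and>
          (\<exists>a \<in> B. \<exists>c \<in> B. \<exists>b \<in> B'. \<exists>d \<in> B'.
             pos k l a < pos k l b \<and> pos k l b < pos k l c \<and> pos k l c < pos k l d))"

definition NC' :: "nat \<Rightarrow> nat \<Rightarrow> ptn set" where
  "NC' k l = {p \<in> partitions k l. noncrossing k l p \<and> even (card {B \<in> p. odd (card B)})}"

definition NC'_b :: "nat \<Rightarrow> nat \<Rightarrow> ptn set" where
  "NC'_b k l = {p \<in> partitions k l. noncrossing k l p \<and>
     (\<forall>B \<in> p. card B = 1 \<or> card B = 2) \<and> even (card {B \<in> p. card B = 1})}"


section \<open>Preadditive categories, additive and idempotent completion\<close>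

text \<open>The abelian group structure on the morphism sets is that of the ambient type \<open>'m\<close>, so every
  \<open>Hom X Y\<close> is meant to be an additive subgroup of \<open>'m\<close>. \<open>Comp X Y Z g f\<close> is the composite
  $g \circ f$ of \<open>f \<in> Hom X Y\<close> and \<open>g \<in> Hom Y Z\<close>. Scalar multiplication plays no role in
  the completions, in isomorphism, or in indecomposability, hence is not recorded.\<close>

record ('o, 'm) preadd_cat =
  Obj :: "'o set"
  Hom :: "'o \<Rightarrow> 'o \<Rightarrow> 'm set"
  Comp :: "'o \<Rightarrow> 'o \<Rightarrow> 'o \<Rightarrow> 'm \<Rightarrow> 'm \<Rightarrow> 'm"
  Ident :: "'o \<Rightarrow> 'm"

text \<open>Objects of the additive completion are finite formal direct sums, i.e. lists of objects;
  a morphism is a matrix whose entry \<open>M i j\<close> goes from the \<open>j\<close>-th summand of the source to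
  the \<open>i\<close>-th summand of the target, padded by 0 outside its range.\<close>

definition additive_completion ::
  "('o, 'm::ab_group_add) preadd_cat \<Rightarrow> ('o list, nat \<Rightarrow> nat \<Rightarrow> 'm) preadd_cat" where
  "additive_completion A = \<lparr>
     Obj = lists (Obj A),
     Hom = (\<lambda>xs ys. {M. \<forall>i j.
        (i < length ys \<and> j < length xs \<longrightarrow> M i j \<in> Hom A (xs ! j) (ys ! i)) \<and>
        (\<not> (i < length ys \<and> j < length xs) \<longrightarrow> M i j = 0)}),
     Comp = (\<lambda>xs ys zs N M i j.
        if i < length zs \<and> j < length xs
        then \<Sum>r<length ys. Comp A (xs ! j) (ys ! r) (zs ! i) (N i r) (M r j)
        else 0),
     Ident = (\<lambda>xs i j. if i = j \<and> i < length xs then Ident A (xs ! i) else 0) \<rparr>"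

definition idempotent_completion ::
  "('o, 'm::ab_group_add) preadd_cat \<Rightarrow> ('o \<times> 'm, 'm) preadd_cat" where
  "idempotent_completion A = \<lparr>
     Obj = {(X, e). X \<in> Obj A \<and> e \<in> Hom A X X \<and> Comp A X X X e e = e},
     Hom = (\<lambda>(X, e) (Y, f). {m \<in> Hom A X Y. Comp A X X Y m e = m \<and> Comp A X Y Y f m = m}),
     Comp = (\<lambda>(X, _) (Y, _) (Z, _). Comp A X Y Z),
     Ident = (\<lambda>(X, e). e) \<rparr>"

definition isomorphic :: "('o, 'm) preadd_cat \<Rightarrow> 'o \<Rightarrow> 'o \<Rightarrow> bool" where
  "isomorphic A X Y \<longleftrightarrow> (\<exists>f \<in> Hom A X Y. \<exists>g \<in> Hom A Y X.
     Comp A X Y X g f = Ident A X \<and> Comp A Y X Y f g = Ident A Y)"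

definition iso_class :: "('o, 'm) preadd_cat \<Rightarrow> 'o \<Rightarrow> 'o set" where
  "iso_class A X = {Y \<in> Obj A. isomorphic A X Y}"

definition zero_object :: "('o, 'm) preadd_cat \<Rightarrow> 'o \<Rightarrow> bool" where
  "zero_object A X \<longleftrightarrow> X \<in> Obj A \<and>
     (\<forall>Y \<in> Obj A. (\<exists>!f. f \<in> Hom A X Y) \<and> (\<exists>!f. f \<in> Hom A Y X))"

definition is_biproduct :: "('o, 'm::ab_group_add) preadd_cat \<Rightarrow> 'o \<Rightarrow> 'o \<Rightarrow> 'o \<Rightarrow> bool" where
  "is_biproduct A X Y Z \<longleftrightarrow>
     (\<exists>\<iota>\<^sub>1 \<in> Hom A Y X. \<exists>\<iota>\<^sub>2 \<in> Hom A Z X. \<exists>\<pi>\<^sub>1 \<in> Hom A X Y. \<exists>\<pi>\<^sub>2 \<in> Hom A X Z.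
        Comp A Y X Y \<pi>\<^sub>1 \<iota>\<^sub>1 = Ident A Y \<and> Comp A Z X Z \<pi>\<^sub>2 \<iota>\<^sub>2 = Ident A Z \<and>
        Comp A Z X Y \<pi>\<^sub>1 \<iota>\<^sub>2 = 0 \<and> Comp A Y X Z \<pi>\<^sub>2 \<iota>\<^sub>1 = 0 \<and>
        Comp A X Y X \<iota>\<^sub>1 \<pi>\<^sub>1 + Comp A X Z X \<iota>\<^sub>2 \<pi>\<^sub>2 = Ident A X)"

definition indecomposable :: "('o, 'm::ab_group_add) preadd_cat \<Rightarrow> 'o \<Rightarrow> bool" where
  "indecomposable A X \<longleftrightarrow> X \<in> Obj A \<and> \<not> zero_object A X \<and>
     (\<forall>Y \<in> Obj A. \<forall>Z \<in> Obj A. is_biproduct A X Y Z \<longrightarrow> zero_object A Y \<or> zero_object A Z)"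

definition indecomposable_classes :: "('o, 'm::ab_group_add) preadd_cat \<Rightarrow> 'o set set" where
  "indecomposable_classes A = iso_class A ` {X. indecomposable A X}"


section \<open>The categories of a family of partitions\<close>

type_synonym lin = "ptn \<Rightarrow>\<^sub>0 complex"

definition lin_hom :: "(nat \<Rightarrow> nat \<Rightarrow> ptn set) \<Rightarrow> nat \<Rightarrow> nat \<Rightarrow> lin set" where
  "lin_hom C k l = {f. Poly_Mapping.keys f \<subseteq> C k l}"

definition lin_comp :: "complex \<Rightarrow> lin \<Rightarrow> lin \<Rightarrow> lin" where
  "lin_comp t g f = (\<Sum>q \<in> Poly_Mapping.keys g. \<Sum>p \<in> Poly_Mapping.keys f.
     Poly_Mapping.single (pcomp q p)
       (Poly_Mapping.lookup g q * Poly_Mapping.lookup f p * t ^ loops q p))"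

text \<open>The object $[k]$ is the natural number \<open>k\<close>.\<close>

definition Rep0 :: "(nat \<Rightarrow> nat \<Rightarrow> ptn set) \<Rightarrow> complex \<Rightarrow> (nat, lin) preadd_cat" where
  "Rep0 C t = \<lparr>
     Obj = UNIV,
     Hom = lin_hom C,
     Comp = (\<lambda>_ _ _. lin_comp t),
     Ident = (\<lambda>k. Poly_Mapping.single (id_ptn k) 1) \<rparr>"

type_synonym rep_obj = "nat list \<times> (nat \<Rightarrow> nat \<Rightarrow> lin)"

definition Rep ::
  "(nat \<Rightarrow> nat \<Rightarrow> ptn set) \<Rightarrow> complex \<Rightarrow> (rep_obj, nat \<Rightarrow> nat \<Rightarrow> lin) preadd_cat" where
  "Rep C t = idempotent_completion (additive_completion (Rep0 C t))"

text \<open>The object $([k], e)$: a one-term formal sum with a $1 \times 1$ matrix.\<close>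

definition image_obj :: "nat \<Rightarrow> lin \<Rightarrow> rep_obj" where
  "image_obj k e = ([k], \<lambda>i j. if i = 0 \<and> j = 0 then e else 0)"


section \<open>The objects attached to projective partitions\<close>

text \<open>$pEp$ for $E = \mathrm{End}([k])$, and its ideal $I_p$.\<close>

definition corner :: "(nat \<Rightarrow> nat \<Rightarrow> ptn set) \<Rightarrow> complex \<Rightarrow> nat \<Rightarrow> ptn \<Rightarrow> lin set" where
  "corner C t k p =
     (\<lambda>x. lin_comp t (Poly_Mapping.single p 1) (lin_comp t x (Poly_Mapping.single p 1)))
       ` lin_hom C k k"

definition corner_ideal :: "(nat \<Rightarrow> nat \<Rightarrow> ptn set) \<Rightarrow> complex \<Rightarrow> nat \<Rightarrow> ptn \<Rightarrow> lin set" where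
  "corner_ideal C t k p =
     {x \<in> corner C t k p. \<forall>q \<in> Poly_Mapping.keys x. through_blocks q < through_blocks p}"

definition primitive_idempotent :: "complex \<Rightarrow> lin set \<Rightarrow> lin \<Rightarrow> bool" where
  "primitive_idempotent t R e \<longleftrightarrow>
     e \<in> R \<and> e \<noteq> 0 \<and> lin_comp t e e = e \<and>
     (\<forall>f \<in> R. \<forall>g \<in> R. lin_comp t f f = f \<and> lin_comp t g g = g \<and>
        lin_comp t f g = 0 \<and> lin_comp t g f = 0 \<and> e = f + g \<longrightarrow> f = 0 \<or> g = 0)"

definition primitive_lift ::
  "(nat \<Rightarrow> nat \<Rightarrow> ptn set) \<Rightarrow> complex \<Rightarrow> nat \<Rightarrow> ptn \<Rightarrow> lin \<Rightarrow> bool" where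
  "primitive_lift C t k p e \<longleftrightarrow>
     primitive_idempotent t (corner C t k p) e \<and>
     e - Poly_Mapping.single p (inverse (t ^ loops p p)) \<in> corner_ideal C t k p"

text \<open>The isomorphism class $\mathcal{L}_p(V_{\mathrm{triv}})$ for projective \<open>p\<close> in $\mathcal{C}(k,k)$.
  All primitive lifts are conjugate, so they have isomorphic images.\<close>

definition L_triv ::
  "(nat \<Rightarrow> nat \<Rightarrow> ptn set) \<Rightarrow> complex \<Rightarrow> nat \<Rightarrow> ptn \<Rightarrow> rep_obj set" where
  "L_triv C t k p =
     (THE X. \<exists>e. primitive_lift C t k p e \<and> X = iso_class (Rep C t) (image_obj k e))"

end

(*
  A partition in C(k, l) with T through-blocks factors through the object [T], or, when the parity
  forces it, through the image of id_T (x) beta inside [T+1]: planarity puts the through-blocks in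
  order, so that no permutation is left in the middle. Endomorphism algebras are finite-dimensional,
  hence in the endomorphism ring of an indecomposable object one summand of any decomposition of the
  identity has a left inverse. Applied to the identity written in the partition basis, this
  exhibits an indecomposable X as a retract of the image U(T, s) of id_T or id_T (x) beta with T
  minimal; by minimality the idempotent cutting out X from U(T, s) is not spanned by partitions with
  fewer than T through-blocks, so it is a primitive lift of the unit. T is an invariant of X since
  the number of through-blocks cannot increase under composition, and s is one since C(k, l) is empty
  for odd k + l.
*)
theory Submission
  imports Defs "HOL-Library.Infinite_Set"
begin

section \<open>Connected components of set systems\<close>

text \<open>Since \<open>t\<close> is only assumed non-zero, the endomorphism algebras need not be
  semisimple. Idempotents are therefore compared modulo partitions with fewer through-blocks, and
  the left inverses come from Fitting's lemma for the powers of a single element; finite dimension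
  enters as linear dependence of long sequences. The condition \<open>t \<noteq> 0\<close> allows
  \<open>proj T s\<close> to be rescaled to an idempotent: stacking \<open>beta\<close> on
  \<open>beta\<close> leaves a closed middle point and hence a factor \<open>t\<close>. The tensor
  factor \<open>beta\<close> repairs parity. Cutting a partition in \<open>C k l\<close> across its
  \<open>T\<close> through-blocks leaves halves with \<open>k + T\<close> and \<open>T + l\<close>
  points, which can lie in \<open>C\<close> only if these numbers are even; one extra isolated point
  on each half corrects this. Both families run through the same argument because membership amounts
  to planarity of the block relation, evenness of \<open>k + l\<close> and, for
  \<open>NC'_b\<close>, at most two points per block, all of which survive stacking. Planarity of a
  composite is the topological core: it is reduced to identifying two neighbouring points of a line
  at a time.\<close>

definition link :: "'a set set \<Rightarrow> ('a \<times> 'a) set" where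
  "link \<B> = {(x, y). \<exists>B \<in> \<B>. x \<in> B \<and> y \<in> B}"

text \<open>The transitive closure, not the reflexive one: \<open>conn \<B> x x\<close> then holds
  exactly for the points covered by \<open>\<B>\<close>.\<close>

definition conn :: "'a set set \<Rightarrow> 'a \<Rightarrow> 'a \<Rightarrow> bool" where
  "conn \<B> x y \<longleftrightarrow> (x, y) \<in> (link \<B>)\<^sup>+"

definition comps :: "'a set set \<Rightarrow> 'a set set" where
  "comps \<B> = (\<lambda>x. {y. conn \<B> x y}) ` \<Union>\<B>"

lemma components_eq_comps: "components q p = comps (stack q p)"
  by (auto simp: components_def comps_def quotient_def conn_def link_def)

lemma conn_link: "B \<in> \<B> \<Longrightarrow> x \<in> B \<Longrightarrow> y \<in> B \<Longrightarrow> conn \<B> x y"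
  unfolding conn_def link_def by blast

lemma conn_refl: "x \<in> \<Union>\<B> \<Longrightarrow> conn \<B> x x"
  by (auto intro: conn_link)

lemma conn_sym: "conn \<B> x y \<Longrightarrow> conn \<B> y x"
proof -
  have "sym ((link \<B>)\<^sup>+)"
    by (rule sym_trancl) (auto simp: sym_def link_def)
  then show "conn \<B> x y \<Longrightarrow> conn \<B> y x" by (simp add: conn_def sym_def)
qed

lemma conn_trans: "conn \<B> x y \<Longrightarrow> conn \<B> y z \<Longrightarrow> conn \<B> x z"
  unfolding conn_def by (rule trancl_trans)

lemma conn_induct [consumes 1, case_names start step]:
  assumes "conn \<B> x y" and "P x"
    and "\<And>y z B. conn \<B> x y \<Longrightarrow> P y \<Longrightarrow> B \<in> \<B> \<Longrightarrow> y \<in> B \<Longrightarrow> z \<in> B \<Longrightarrow> P z"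
  shows "P y"
proof -
  have "(x, y) \<in> (link \<B>)\<^sup>+" using assms(1) by (simp add: conn_def)
  moreover have xU: "x \<in> \<Union>\<B>" 
    using assms(1) unfolding conn_def by (induction rule: trancl.induct) (auto simp: link_def)
  ultimately show ?thesis
  proof (induction rule: trancl_induct)
    case (base y)
    then show ?case using assms(2,3) conn_refl[OF xU] by (auto simp: link_def)
  next
    case (step y z)
    then show ?case using assms(3) by (auto simp: link_def conn_def)
  qed
qed

lemma conn_in1: "conn \<B> x y \<Longrightarrow> x \<in> \<Union>\<B>"
  unfolding conn_def by (induction rule: trancl.induct) (auto simp: link_def)

lemma conn_in2: "conn \<B> x y \<Longrightarrow> y \<in> \<Union>\<B>"
  using conn_in1 conn_sym by metis

lemma conn_mono: "conn \<A> x y \<Longrightarrow> \<A> \<subseteq> \<B> \<Longrightarrow> conn \<B> x y"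
  unfolding conn_def by (rule trancl_mono) (auto simp: link_def)

lemma conn_bind:
  assumes "conn \<A> x y" and "\<And>B u v. B \<in> \<A> \<Longrightarrow> u \<in> B \<Longrightarrow> v \<in> B \<Longrightarrow> conn \<B> u v"
  shows "conn \<B> x y"
  using assms(1)
proof (induction rule: conn_induct)
  case start
  show ?case using conn_in1[OF assms(1)] assms(2) by blast
next
  case (step y z B)
  then show ?case using assms(2) conn_trans by metis
qed

lemma mem_comps: "K \<in> comps \<B> \<Longrightarrow> x \<in> K \<Longrightarrow> K = {y. conn \<B> x y}"
proof -
  assume "K \<in> comps \<B>" "x \<in> K"
  then obtain z where K: "K = {y. conn \<B> z y}" and zx: "conn \<B> z x" unfolding comps_def by auto
  have "conn \<B> z y \<longleftrightarrow> conn \<B> x y" for y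
    using zx conn_sym[of \<B>] conn_trans[of \<B>] by metis
  then show ?thesis unfolding K by blast
qed

lemma comps_conn: "x \<in> K \<Longrightarrow> y \<in> K \<Longrightarrow> K \<in> comps \<B> \<Longrightarrow> conn \<B> x y"
  using mem_comps[of K \<B> x] by auto

lemma comps_nonempty: "K \<in> comps \<B> \<Longrightarrow> K \<noteq> {}"
  unfolding comps_def by (auto intro: conn_refl)

lemma comps_subset: "K \<in> comps \<B> \<Longrightarrow> K \<subseteq> \<Union>\<B>"
  unfolding comps_def by (auto dest: conn_in2)

lemma comps_I: "x \<in> \<Union>\<B> \<Longrightarrow> {y. conn \<B> x y} \<in> comps \<B>"
  unfolding comps_def by blast

lemma comps_disjoint: "K \<in> comps \<B> \<Longrightarrow> L \<in> comps \<B> \<Longrightarrow> x \<in> K \<Longrightarrow> x \<in> L \<Longrightarrow> K = L"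
  using mem_comps[of K \<B> x] mem_comps[of L \<B> x] by simp

lemma finite_comps: "finite (\<Union>\<B>) \<Longrightarrow> finite (comps \<B>)"
  unfolding comps_def by blast

lemma comps_image:
  assumes "inj f"
  shows "comps ((`) f ` \<B>) = (`) f ` comps \<B>"
proof -
  have 1: "conn ((`) f ` \<B>) (f x) (f y)" if "conn \<B> x y" for x y
    using that
  proof (induction rule: conn_induct)
    case start
    then show ?case using conn_in1[OF that] by (auto intro!: conn_refl)
  next
    case (step y z B)
    then show ?case using conn_trans[OF _ conn_link[of "f ` B"]] by blast
  qed
  have 2: "\<exists>y. v = f y \<and> conn \<B> x y" if "conn ((`) f ` \<B>) (f x) v" for x v
    using that
  proof (induction rule: conn_induct)
    case start
    have "x \<in> \<Union>\<B>" using conn_in1[OF that] assms by (auto simp: inj_def)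
    then show ?case using conn_refl[of x \<B>] by auto
  next
    case (step y z B)
    then obtain B' y' where "B = f ` B'" "B' \<in> \<B>" "y = f y'" "conn \<B> x y'" by auto
    moreover then have "y' \<in> B'" using step assms by (auto simp: inj_def)
    moreover obtain z' where "z = f z'" "z' \<in> B'" using step \<open>B = f ` B'\<close> by auto
    ultimately show ?case using conn_trans[OF _ conn_link] by metis
  qed
  have 3: "{v. conn ((`) f ` \<B>) (f x) v} = f ` {y. conn \<B> x y}" for x
    using 1 2 by blast
  show ?thesis unfolding comps_def image_Union[symmetric] by (simp add: image_image 3)
qed

section \<open>Contracting part of a block system\<close>

text \<open>When \<open>W\<close> consists of the outer points of a stacked diagram,
  \<open>trace\<close> yields the blocks of the composite and \<open>missed\<close> the components
  counted by \<open>loops\<close>.\<close>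

definition trace :: "'a set \<Rightarrow> 'a set set \<Rightarrow> 'a set set" where
  "trace W \<B> = (\<lambda>K. K \<inter> W) ` comps \<B> - {{}}"

definition missed :: "'a set \<Rightarrow> 'a set set \<Rightarrow> 'a set set" where
  "missed W \<B> = {K \<in> comps \<B>. K \<inter> W = {}}"

lemma trace_conn: "T \<in> trace W \<B> \<Longrightarrow> x \<in> T \<Longrightarrow> y \<in> T \<Longrightarrow> conn \<B> x y"
  unfolding trace_def by (auto intro: comps_conn)

lemma trace_I: "conn \<B> x y \<Longrightarrow> x \<in> W \<Longrightarrow> y \<in> W \<Longrightarrow> \<exists>T \<in> trace W \<B>. x \<in> T \<and> y \<in> T"
proof -
  assume c: "conn \<B> x y" and W: "x \<in> W" "y \<in> W"
  then have "conn \<B> x x" by (intro conn_refl conn_in1)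
  then have "x \<in> {y. conn \<B> x y} \<inter> W" "y \<in> {y. conn \<B> x y} \<inter> W" using c W by auto
  moreover from this have "{y. conn \<B> x y} \<inter> W \<in> trace W \<B>"
    unfolding trace_def using comps_I[OF conn_in1[OF c]] by auto
  ultimately show ?thesis by (intro bexI conjI)
qed

lemma Union_trace: "\<Union>(trace W \<B>) = \<Union>\<B> \<inter> W"
proof
  show "\<Union>(trace W \<B>) \<subseteq> \<Union>\<B> \<inter> W" unfolding trace_def using comps_subset[of _ \<B>] by auto
  show "\<Union>\<B> \<inter> W \<subseteq> \<Union>(trace W \<B>)" 
  proof
    fix x assume "x \<in> \<Union>\<B> \<inter> W"
    then show "x \<in> \<Union>(trace W \<B>)" using trace_I[OF conn_refl, of x \<B> W] by auto
  qed
qed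

lemma trace_cong:
  assumes "\<And>x y. x \<in> W \<Longrightarrow> y \<in> W \<Longrightarrow> conn \<A> x y \<longleftrightarrow> conn \<B> x y"
  shows "trace W \<A> = trace W \<B>"
proof -
  have "trace W \<A> \<subseteq> trace W \<B>" if eq: "\<And>x y. x \<in> W \<Longrightarrow> y \<in> W \<Longrightarrow> conn \<A> x y \<longleftrightarrow> conn \<B> x y"
    for \<A> \<B> :: "'a set set"
  proof
    fix T assume "T \<in> trace W \<A>"
    then obtain K where K: "K \<in> comps \<A>" "T = K \<inter> W" "T \<noteq> {}" unfolding trace_def by auto
    then obtain x where x: "x \<in> K" "x \<in> W" by auto
    have "T = {y. conn \<A> x y} \<inter> W" using mem_comps[OF K(1) x(1)] K by simp
    also have "\<dots> = {y. conn \<B> x y} \<inter> W" using eq x by auto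
    finally have T: "T = {y. conn \<B> x y} \<inter> W" .
    have "conn \<B> x x" using eq x K by (metis comps_conn)
    then have "{y. conn \<B> x y} \<in> comps \<B>" using conn_in1 comps_I by metis
    then show "T \<in> trace W \<B>" unfolding trace_def using T K(3) by blast
  qed
  then show ?thesis using assms by blast
qed

text \<open>Abstract form of composing two adjacent layers inside a larger diagram. All contact of
  \<open>\<A>\<close> with \<open>\<B>\<close> and with the outer points \<open>O'\<close> happens
  in \<open>W\<close>, so replacing \<open>\<A>\<close> by its trace on \<open>W\<close> forgets
  only what is interior to \<open>\<A>\<close>.\<close>

locale contraction =
  fixes \<A> \<B> :: "'a set set" and W O' :: "'a set"
  assumes meet: "\<Union>\<A> \<inter> \<Union>\<B> \<subseteq> W" and outer: "\<Union>\<A> \<inter> O' \<subseteq> W"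
begin

definition "V = (W \<inter> \<Union>\<A>) \<union> \<Union>\<B>"

lemma conn_contract_imp: "conn (trace W \<A> \<union> \<B>) x y \<Longrightarrow> conn (\<A> \<union> \<B>) x y"
  by (erule conn_bind) (metis Un_iff Un_upper1 conn_link conn_mono trace_conn)

text \<open>The induction follows a path and remembers the last point \<open>z\<close> of
  \<open>V\<close> reached by contracted links; the stretch from \<open>z\<close> to the current
  point runs inside \<open>\<A>\<close> and is turned into one block of the trace as soon as the
  path returns to \<open>W\<close>.\<close>

lemma conn_contract_aux:
  assumes "conn (\<A> \<union> \<B>) x y" "x \<in> V"
  shows "\<exists>z \<in> V. conn (trace W \<A> \<union> \<B>) x z \<and> (z = y \<or> z \<in> W \<and> conn \<A> z y)"
  using assms(1)
proof (induction rule: conn_induct)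
  case start
  have "x \<in> \<Union>(trace W \<A> \<union> \<B>)" using assms(2) by (auto simp: V_def Union_trace)
  then show ?case using assms(2) conn_refl by metis
next
  case (step y z B)
  then obtain w where w: "w \<in> V" "conn (trace W \<A> \<union> \<B>) x w" 
    "w = y \<or> w \<in> W \<and> conn \<A> w y" by blast
  show ?case
  proof (cases "B \<in> \<B>")
    case True
    then have yz: "conn (trace W \<A> \<union> \<B>) y z" using step by (auto intro: conn_link)
    have zV: "z \<in> V" using True step by (auto simp: V_def)
    have "conn (trace W \<A> \<union> \<B>) w y"
    proof (cases "w = y")
      case True
      then show ?thesis using w conn_refl conn_in2 by metis
    next
      case False
      then have c: "conn \<A> w y" and "w \<in> W" using w by auto
      have "y \<in> W" using conn_in2[OF c] step True meet by auto
      then obtain T where "T \<in> trace W \<A>" "w \<in> T" "y \<in> T"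
        using trace_I[OF c \<open>w \<in> W\<close>] by blast
      then show ?thesis by (auto intro: conn_link)
    qed
    then show ?thesis using zV yz w(2) conn_trans by metis
  next
    case False
    then have B: "B \<in> \<A>" using step by auto
    have yz: "conn \<A> y z" using B step by (auto intro: conn_link)
    have "w \<in> W"
      using w(3)
    proof
      assume "w = y"
      then show ?thesis using w(1) B step meet by (auto simp: V_def)
    qed auto
    moreover have "conn \<A> w z" using w(3) yz conn_trans by metis
    ultimately show ?thesis using w by blast
  qed
qed

lemma conn_contract:
  "conn (trace W \<A> \<union> \<B>) x y \<longleftrightarrow> conn (\<A> \<union> \<B>) x y \<and> x \<in> V \<and> y \<in> V"
proof
  assume c: "conn (trace W \<A> \<union> \<B>) x y"
  then show "conn (\<A> \<union> \<B>) x y \<and> x \<in> V \<and> y \<in> V"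
    using conn_contract_imp[OF c] conn_in1[OF c] conn_in2[OF c] by (auto simp: V_def Union_trace)
next
  assume a: "conn (\<A> \<union> \<B>) x y \<and> x \<in> V \<and> y \<in> V"
  then obtain z where z: "z \<in> V" "conn (trace W \<A> \<union> \<B>) x z" "z = y \<or> z \<in> W \<and> conn \<A> z y"
    using conn_contract_aux by metis
  show "conn (trace W \<A> \<union> \<B>) x y"
  proof (cases "z = y")
    case False
    then have c: "conn \<A> z y" and "z \<in> W" using z by auto
    have "y \<in> W" using conn_in2[OF c] a meet by (auto simp: V_def)
    then obtain T where "T \<in> trace W \<A>" "z \<in> T" "y \<in> T" using trace_I[OF c \<open>z \<in> W\<close>] by blast
    then have "conn (trace W \<A> \<union> \<B>) z y" by (auto intro: conn_link)
    then show ?thesis using z conn_trans by metis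
  qed (use z in simp)
qed

lemma trace_contract: "trace O' (trace W \<A> \<union> \<B>) = trace O' (\<A> \<union> \<B>)"
proof (rule trace_cong)
  fix x y assume "x \<in> O'" "y \<in> O'"
  then show "conn (trace W \<A> \<union> \<B>) x y \<longleftrightarrow> conn (\<A> \<union> \<B>) x y"
    unfolding conn_contract using outer conn_in1[of "\<A> \<union> \<B>" x y] conn_in2[of "\<A> \<union> \<B>" x y] by (auto simp: V_def)
qed

text \<open>A component of \<open>\<A>\<close> that avoids \<open>W\<close> touches no block of
  \<open>\<B>\<close>, so adding \<open>\<B>\<close> does not enlarge it; conversely a component
  avoiding \<open>V\<close> is built from blocks of \<open>\<A>\<close> alone.\<close>

lemma missed_inner: "{K \<in> comps (\<A> \<union> \<B>). K \<inter> V = {}} = missed W \<A>"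
proof -
  have eq: "conn (\<A> \<union> \<B>) x y \<longleftrightarrow> conn \<A> x y"
    if "{y. conn \<A> x y} \<inter> W = {}" "x \<in> \<Union>\<A>" for x y
  proof
    assume "conn (\<A> \<union> \<B>) x y"
    then show "conn \<A> x y"
    proof (induction rule: conn_induct)
      case start
      then show ?case using that conn_refl by metis
    next
      case (step y z B)
      have "y \<notin> W" "y \<in> \<Union>\<A>" using that step conn_in2 by (auto)
      then have "B \<in> \<A>" using step meet by auto
      then show ?case using step conn_trans conn_link by metis
    qed
  next
    show "conn \<A> x y \<Longrightarrow> conn (\<A> \<union> \<B>) x y" by (rule conn_mono) auto
  qed
  show ?thesis
  proof (intro equalityI subsetI)
    fix K assume "K \<in> {K \<in> comps (\<A> \<union> \<B>). K \<inter> V = {}}"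
    then have K: "K \<in> comps (\<A> \<union> \<B>)" "K \<inter> V = {}" by auto
    obtain x where x: "x \<in> K" using comps_nonempty K by blast
    have Keq: "K = {y. conn (\<A> \<union> \<B>) x y}" using mem_comps K x by metis
    have xA: "x \<in> \<Union>\<A>" using x K(2) comps_subset[OF K(1)] unfolding V_def by blast
    have "{y. conn \<A> x y} \<subseteq> K" unfolding Keq using conn_mono[of \<A> x _ "\<A> \<union> \<B>"] by auto
    moreover have "{y. conn \<A> x y} \<subseteq> \<Union>\<A>" by (auto dest: conn_in2)
    ultimately have d: "{y. conn \<A> x y} \<inter> W = {}" using K(2) by (auto simp: V_def)
    then have "K = {y. conn \<A> x y}" using eq[OF d xA] Keq by simp
    then show "K \<in> missed W \<A>" using d comps_I[OF xA] unfolding missed_def by simp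
  next
    fix K assume "K \<in> missed W \<A>"
    then have K: "K \<in> comps \<A>" "K \<inter> W = {}" unfolding missed_def by auto
    obtain x where x: "x \<in> K" using comps_nonempty K by blast
    have Keq: "K = {y. conn \<A> x y}" using mem_comps K x by metis
    have xA: "x \<in> \<Union>\<A>" using x K comps_subset by blast
    have Keq': "K = {y. conn (\<A> \<union> \<B>) x y}" using eq xA K(2) Keq by blast
    have "K \<subseteq> \<Union>\<A>" using K comps_subset by blast
    then have "K \<inter> V = {}" using K(2) meet by (auto simp: V_def)
    moreover have "K \<in> comps (\<A> \<union> \<B>)" unfolding Keq' using xA by (intro comps_I) auto
    ultimately show "K \<in> {K \<in> comps (\<A> \<union> \<B>). K \<inter> V = {}}" by auto
  qed
qed

lemma comps_contract: "comps (trace W \<A> \<union> \<B>) = (\<lambda>K. K \<inter> V) ` {K \<in> comps (\<A> \<union> \<B>). K \<inter> V \<noteq> {}}"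
proof (intro equalityI subsetI)
  fix L assume L: "L \<in> comps (trace W \<A> \<union> \<B>)"
  obtain x where x: "x \<in> L" using comps_nonempty L by blast
  have Leq: "L = {y. conn (trace W \<A> \<union> \<B>) x y}" using mem_comps L x by metis
  have xV: "x \<in> V" "conn (\<A> \<union> \<B>) x x" using x unfolding Leq conn_contract by auto
  show "L \<in> (\<lambda>K. K \<inter> V) ` {K \<in> comps (\<A> \<union> \<B>). K \<inter> V \<noteq> {}}"
    unfolding Leq conn_contract using xV comps_I[OF conn_in1[OF xV(2)]]
    by (intro image_eqI[where x="{y. conn (\<A> \<union> \<B>) x y}"]) auto
next
  fix L assume "L \<in> (\<lambda>K. K \<inter> V) ` {K \<in> comps (\<A> \<union> \<B>). K \<inter> V \<noteq> {}}"
  then obtain K x where K: "K \<in> comps (\<A> \<union> \<B>)" "L = K \<inter> V" "x \<in> K" "x \<in> V" by blast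
  have Keq: "K = {y. conn (\<A> \<union> \<B>) x y}" using mem_comps K by metis
  have "L = {y. conn (trace W \<A> \<union> \<B>) x y}"
    unfolding conn_contract K(2) using K(4) by (subst Keq) auto
  moreover have "conn (trace W \<A> \<union> \<B>) x x"
    unfolding conn_contract using K comps_conn by metis
  ultimately show "L \<in> comps (trace W \<A> \<union> \<B>)" using comps_I conn_in1 by metis
qed

text \<open>The components without outer points split into those meeting \<open>V\<close>, which
  survive the contraction, and those avoiding \<open>V\<close>, which were already closed inside
  \<open>\<A>\<close>. This is the additivity of loop numbers behind associativity of the linear
  composition.\<close>

lemma card_missed_contract:
  assumes fin: "finite (\<Union>\<A>)" "finite (\<Union>\<B>)"
  shows "card (missed O' (\<A> \<union> \<B>)) = card (missed O' (trace W \<A> \<union> \<B>)) + card (missed W \<A>)"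
proof -
  let ?M = "{K \<in> comps (\<A> \<union> \<B>). K \<inter> V \<noteq> {} \<and> K \<inter> O' = {}}"
  have sub: "K \<subseteq> \<Union>(\<A> \<union> \<B>)" if "K \<in> comps (\<A> \<union> \<B>)" for K using comps_subset[OF that] .
  have OV: "K \<inter> O' = K \<inter> V \<inter> O'" if "K \<in> comps (\<A> \<union> \<B>)" for K
    using sub[OF that] outer by (auto simp: V_def)
  have m: "missed O' (\<A> \<union> \<B>) = ?M \<union> missed W \<A>"
    unfolding missed_inner[symmetric] unfolding missed_def using OV by auto
  have disj: "?M \<inter> missed W \<A> = {}" unfolding missed_inner[symmetric] by blast
  have fc: "finite (comps (\<A> \<union> \<B>))" using fin by (intro finite_comps) auto
  have inj: "inj_on (\<lambda>K. K \<inter> V) ?M"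
  proof (rule inj_onI)
    fix K L assume *: "K \<in> ?M" "L \<in> ?M" "K \<inter> V = L \<inter> V"
    then obtain x where "x \<in> K \<inter> V" by blast
    then have "x \<in> K" "x \<in> L" using *(3) by auto
    then show "K = L" using * comps_disjoint[of K "\<A> \<union> \<B>" L x] by simp
  qed
  have "missed O' (trace W \<A> \<union> \<B>) = (\<lambda>K. K \<inter> V) ` ?M"
    unfolding missed_def comps_contract using OV by blast
  then have "card (missed O' (trace W \<A> \<union> \<B>)) = card ?M" using card_image[OF inj] by simp
  moreover have "card (missed O' (\<A> \<union> \<B>)) = card ?M + card (missed W \<A>)"
    unfolding m using fc disj by (intro card_Un_disjoint) (auto simp: missed_def finite_comps fin)
  ultimately show ?thesis by simp
qed

end

section \<open>Diagrams placed in numbered rows\<close>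

text \<open>Rows become first coordinates, so that arbitrarily many stacked diagrams share one point
  type; \<open>pt3\<close> only has room for two diagrams.\<close>

fun emb :: "nat \<Rightarrow> nat \<Rightarrow> pt \<Rightarrow> nat \<times> nat" where
  "emb r s (Up i) = (r, i)"
| "emb r s (Low j) = (s, j)"

lemma range_emb: "range (emb r s) = {r, s} \<times> UNIV"
proof (intro equalityI subsetI)
  fix x :: "nat \<times> nat" assume "x \<in> {r, s} \<times> UNIV"
  then have "x = emb r s (Up (snd x)) \<or> x = emb r s (Low (snd x))" by (cases x) auto
  then show "x \<in> range (emb r s)" by blast
next
  fix x assume "x \<in> range (emb r s)"
  then obtain y where "x = emb r s y" by auto
  then show "x \<in> {r, s} \<times> UNIV" by (cases y) auto
qed

fun emb3 :: "nat \<Rightarrow> nat \<Rightarrow> nat \<Rightarrow> pt3 \<Rightarrow> nat \<times> nat" where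
  "emb3 r s v (Top i) = (r, i)"
| "emb3 r s v (Mid i) = (s, i)"
| "emb3 r s v (Bot i) = (v, i)"

lemma inj_emb3: "r \<noteq> s \<Longrightarrow> s \<noteq> v \<Longrightarrow> r \<noteq> v \<Longrightarrow> inj (emb3 r s v)"
proof (rule injI)
  fix x y assume "r \<noteq> s" "s \<noteq> v" "r \<noteq> v" "emb3 r s v x = emb3 r s v y"
  then show "x = y" by (cases x; cases y) auto
qed

lemma emb3_in: "emb3 r s v (in_upper x) = emb r s x" "emb3 r s v (in_lower x) = emb s v x"
  "emb3 r s v (in_outer x) = emb r v x"
  by (cases x; simp)+

lemma image_emb_stack:
  "(`) (emb3 r s v) ` stack q p = (`) (emb r s) ` p \<union> (`) (emb s v) ` q"
  by (simp add: stack_def image_Un image_image emb3_in)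

lemma inj_in_outer: "inj in_outer"
proof (rule injI)
  fix x y assume "in_outer x = in_outer y"
  then show "x = y" by (cases x; cases y) auto
qed

lemma pcomp_trace: "(`) in_outer ` pcomp q p = trace (range in_outer) (stack q p)"
proof -
  have "in_outer ` (in_outer -` K) = K \<inter> range in_outer" for K by auto
  then show ?thesis unfolding pcomp_def trace_def components_eq_comps by (auto simp: image_iff)
qed

lemma trace_image:
  assumes "inj f"
  shows "trace (f ` W) ((`) f ` \<B>) = (`) f ` trace W \<B>"
proof -
  have "f ` K \<inter> f ` W = f ` (K \<inter> W)" for K using assms by (simp add: image_Int)
  then have "(\<lambda>K. K \<inter> f ` W) ` (`) f ` comps \<B> = (`) f ` (\<lambda>K. K \<inter> W) ` comps \<B>"
    by (simp add: image_image)
  moreover have "(`) f ` (S - {{}}) = (`) f ` S - {{}}" for S by auto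
  ultimately show ?thesis unfolding trace_def comps_image[OF assms] by simp
qed

lemma missed_image:
  assumes "inj f"
  shows "missed (f ` W) ((`) f ` \<B>) = (`) f ` missed W \<B>"
proof -
  have "f ` K \<inter> f ` W = f ` (K \<inter> W)" for K using assms by (simp add: image_Int)
  then show ?thesis unfolding missed_def comps_image[OF assms] by (auto simp: image_iff)
qed

text \<open>The row labels are arbitrary as long as they are distinct, so a composite can be drawn
  at any place of a taller diagram.\<close>

lemma pcomp_emb:
  assumes "r \<noteq> s" "s \<noteq> v" "r \<noteq> v"
  shows "(`) (emb r v) ` pcomp q p = trace ({r, v} \<times> UNIV) ((`) (emb r s) ` p \<union> (`) (emb s v) ` q)"
proof -
  have "(`) (emb r v) ` pcomp q p = (`) (emb3 r s v) ` (`) in_outer ` pcomp q p"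
    by (simp add: image_image emb3_in)
  also have "\<dots> = trace (emb3 r s v ` range in_outer) ((`) (emb3 r s v) ` stack q p)"
    unfolding pcomp_trace trace_image[OF inj_emb3[OF assms]] ..
  also have "emb3 r s v ` range in_outer = {r, v} \<times> UNIV"
    by (simp add: image_image emb3_in range_emb)
  finally show ?thesis by (simp add: image_emb_stack)
qed

lemma not_outer_iff_Mid: "K \<inter> range in_outer = {} \<longleftrightarrow> K \<subseteq> range Mid"
proof
  assume *: "K \<inter> range in_outer = {}"
  show "K \<subseteq> range Mid"
  proof
    fix x assume "x \<in> K"
    then have "x \<notin> range in_outer" using * by blast
    then show "x \<in> range Mid"
      by (cases x) (metis in_outer.simps(1) rangeI, blast, metis in_outer.simps(2) rangeI)
  qed
next
  assume *: "K \<subseteq> range Mid"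
  have "in_outer x \<notin> range Mid" for x by (cases x) auto
  then show "K \<inter> range in_outer = {}" using * by blast
qed

lemma loops_emb:
  assumes "r \<noteq> s" "s \<noteq> v" "r \<noteq> v"
  shows "loops q p = card (missed ({r, v} \<times> UNIV) ((`) (emb r s) ` p \<union> (`) (emb s v) ` q))"
proof -
  have inj: "inj ((`) (emb3 r s v))" using inj_emb3[OF assms] by (simp add: inj_image_eq_iff inj_def)
  have "loops q p = card (missed (range in_outer) (stack q p))"
    unfolding loops_def missed_def components_eq_comps not_outer_iff_Mid ..
  also have "\<dots> = card ((`) (emb3 r s v) ` missed (range in_outer) (stack q p))"
    using inj by (metis card_image inj_on_subset subset_UNIV)
  also have "\<dots> = card (missed (emb3 r s v ` range in_outer) ((`) (emb3 r s v) ` stack q p))"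
    unfolding missed_image[OF inj_emb3[OF assms]] ..
  also have "emb3 r s v ` range in_outer = {r, v} \<times> UNIV"
    by (simp add: image_image emb3_in range_emb)
  finally show ?thesis by (simp add: image_emb_stack)
qed

lemma inj_emb: "r \<noteq> s \<Longrightarrow> inj (emb r s)"
proof (rule injI)
  fix x y assume "r \<noteq> s" "emb r s x = emb r s y"
  then show "x = y" by (cases x; cases y) auto
qed

lemma emb_Union_subset: "\<Union>((`) (emb r s) ` p) \<subseteq> {r, s} \<times> UNIV"
  using range_emb[of r s] by blast

text \<open>Both bracketings contract two adjacent layers of the same three-layer diagram, so both sides
  are computed from its components.\<close>

lemma
  assumes fin: "finite (\<Union>p)" "finite (\<Union>q)" "finite (\<Union>r)"
  shows pcomp_assoc: "pcomp r (pcomp q p) = pcomp (pcomp r q) p"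
    and loops_assoc: "loops r (pcomp q p) + loops q p = loops (pcomp r q) p + loops r q"
proof -
  let ?P = "(`) (emb 2 3) ` p" and ?Q = "(`) (emb 3 4) ` q" and ?R = "(`) (emb 4 5) ` r"
  let ?O = "{2::nat, 5} \<times> (UNIV :: nat set)"
  have finU: "finite (\<Union>?P)" "finite (\<Union>?Q)" "finite (\<Union>?R)"
    using fin by (simp_all add: image_Union[symmetric])
  have U: "\<Union>?P \<subseteq> {2, 3} \<times> UNIV" "\<Union>?Q \<subseteq> {3, 4} \<times> UNIV" "\<Union>?R \<subseteq> {4, 5} \<times> UNIV"
    by (rule emb_Union_subset)+
  interpret L: contraction "?P \<union> ?Q" ?R "{2, 4} \<times> UNIV" ?O
  proof
    have "\<Union>(?P \<union> ?Q) = \<Union>?P \<union> \<Union>?Q" by simp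
    also have "\<dots> \<subseteq> {2, 3, 4} \<times> UNIV"
      by (intro Un_least order_trans[OF U(1)] order_trans[OF U(2)]) auto
    finally have U': "\<Union>(?P \<union> ?Q) \<subseteq> {2, 3, 4} \<times> UNIV" .
    show "\<Union>(?P \<union> ?Q) \<inter> \<Union>?R \<subseteq> {2, 4} \<times> UNIV"
      by (rule order_trans[OF Int_mono[OF U' U(3)]]) auto
    show "\<Union>(?P \<union> ?Q) \<inter> ?O \<subseteq> {2, 4} \<times> UNIV"
      by (rule order_trans[OF Int_mono[OF U' order_refl]]) auto
  qed
  \<comment> \<open>The other bracketing: row 4 is contracted instead of row 3.\<close>
  interpret R: contraction "?Q \<union> ?R" ?P "{3, 5} \<times> UNIV" ?O
  proof
    have "\<Union>(?Q \<union> ?R) = \<Union>?Q \<union> \<Union>?R" by simp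
    also have "\<dots> \<subseteq> {3, 4, 5} \<times> UNIV"
      by (intro Un_least order_trans[OF U(2)] order_trans[OF U(3)]) auto
    finally have U': "\<Union>(?Q \<union> ?R) \<subseteq> {3, 4, 5} \<times> UNIV" .
    show "\<Union>(?Q \<union> ?R) \<inter> \<Union>?P \<subseteq> {3, 5} \<times> UNIV"
      by (rule order_trans[OF Int_mono[OF U' U(1)]]) auto
    show "\<Union>(?Q \<union> ?R) \<inter> ?O \<subseteq> {3, 5} \<times> UNIV"
      by (rule order_trans[OF Int_mono[OF U' order_refl]]) auto
  qed
  have comm: "?Q \<union> ?R \<union> ?P = ?P \<union> ?Q \<union> ?R" by blast
  have c: "(`) (emb 2 4) ` pcomp q p = trace ({2, 4} \<times> UNIV) (?P \<union> ?Q)"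
    "(`) (emb 3 5) ` pcomp r q = trace ({3, 5} \<times> UNIV) (?Q \<union> ?R)"
    by (simp_all add: pcomp_emb)
  have "(`) (emb 2 5) ` pcomp r (pcomp q p) = trace ?O (trace ({2, 4} \<times> UNIV) (?P \<union> ?Q) \<union> ?R)"
    by (simp add: pcomp_emb[of 2 4 5] c)
  also have "\<dots> = trace ?O (?P \<union> ?Q \<union> ?R)" by (rule L.trace_contract)
  also have "\<dots> = trace ?O (?Q \<union> ?R \<union> ?P)" by (simp only: comm)
  also have "\<dots> = trace ?O (trace ({3, 5} \<times> UNIV) (?Q \<union> ?R) \<union> ?P)" by (rule R.trace_contract[symmetric])
  also have "\<dots> = (`) (emb 2 5) ` pcomp (pcomp r q) p"
    by (simp add: pcomp_emb[of 2 3 5] c Un_commute)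
  finally have "(`) (emb 2 5) ` pcomp r (pcomp q p) = (`) (emb 2 5) ` pcomp (pcomp r q) p" .
  moreover have "inj ((`) (emb 2 5))" using inj_emb[of 2 5] by (simp add: inj_image_eq_iff inj_def)
  ultimately show "pcomp r (pcomp q p) = pcomp (pcomp r q) p" by (simp add: inj_image_eq_iff)
  have "loops r (pcomp q p) + loops q p = card (missed ?O (trace ({2, 4} \<times> UNIV) (?P \<union> ?Q) \<union> ?R))
      + card (missed ({2, 4} \<times> UNIV) (?P \<union> ?Q))"
    by (simp add: loops_emb[of 2 4 5 r] loops_emb[of 2 3 4 q] c)
  also have "\<dots> = card (missed ?O (?P \<union> ?Q \<union> ?R))"
    by (subst L.card_missed_contract) (use finU in auto)
  also have "\<dots> = card (missed ?O (?Q \<union> ?R \<union> ?P))" by (simp only: comm)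
  also have "\<dots> = card (missed ?O (trace ({3, 5} \<times> UNIV) (?Q \<union> ?R) \<union> ?P))
      + card (missed ({3, 5} \<times> UNIV) (?Q \<union> ?R))"
    by (subst R.card_missed_contract) (use finU in auto)
  also have "\<dots> = loops (pcomp r q) p + loops r q"
    by (simp add: loops_emb[of 2 3 5 _ p] loops_emb[of 3 4 5 r] c Un_commute)
  finally show "loops r (pcomp q p) + loops q p = loops (pcomp r q) p + loops r q" .
qed

section \<open>Partitions as equivalence relations\<close>

definition same :: "'a set set \<Rightarrow> 'a \<Rightarrow> 'a \<Rightarrow> bool" where
  "same p x y \<longleftrightarrow> (\<exists>B \<in> p. x \<in> B \<and> y \<in> B)"

lemma same_sym: "same p x y \<Longrightarrow> same p y x"
  by (auto simp: same_def)

lemma partition_same_trans: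
  assumes "partition_on A p" "same p x y" "same p y z"
  shows "same p x z"
proof -
  obtain B B' where B: "B \<in> p" "x \<in> B" "y \<in> B" "B' \<in> p" "y \<in> B'" "z \<in> B'"
    using assms(2,3) by (auto simp: same_def)
  then have "B = B'" using partition_onD2[OF assms(1)] unfolding disjoint_def by blast
  then show ?thesis using B by (auto simp: same_def)
qed

lemma partition_same_in:
  assumes "partition_on A p" "same p x y"
  shows "x \<in> A" "y \<in> A"
  using assms partition_onD1[OF assms(1)] by (auto simp: same_def)

lemma partition_same_refl:
  assumes "partition_on A p" "x \<in> A"
  shows "same p x x"
  using assms(2) partition_onD1[OF assms(1)] by (auto simp: same_def)

lemma partition_class:
  assumes "partition_on A p" "B \<in> p" "x \<in> B"
  shows "B = {y. same p x y}"
proof -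
  have "B' = B" if "B' \<in> p" "x \<in> B'" for B'
    using that assms partition_onD2[OF assms(1)] unfolding disjoint_def by blast
  then have "y \<in> B \<longleftrightarrow> same p x y" for y
    unfolding same_def using assms(2,3) by metis
  then show ?thesis by blast
qed

lemma partition_subset_if_same:
  assumes "partition_on A p" "partition_on A q"
    and "\<And>x y. x \<in> A \<Longrightarrow> y \<in> A \<Longrightarrow> same p x y \<longleftrightarrow> same q x y"
  shows "p \<subseteq> q"
proof
  fix B assume B: "B \<in> p"
  then obtain x where x: "x \<in> B" using partition_onD3[OF assms(1)] by fastforce
  then have xA: "x \<in> A" using B partition_onD1[OF assms(1)] by blast
  have "{y. same p x y} = {y. same q x y}"
    using assms(3)[OF xA] partition_same_in(2)[OF assms(1)] partition_same_in(2)[OF assms(2)] by auto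
  moreover obtain B' where "B' \<in> q" "x \<in> B'" using xA partition_onD1[OF assms(2)] by blast
  ultimately show "B \<in> q" using partition_class assms B x by metis
qed

lemma partition_eqI:
  assumes "partition_on A p" "partition_on A q"
    and "\<And>x y. x \<in> A \<Longrightarrow> y \<in> A \<Longrightarrow> same p x y \<longleftrightarrow> same q x y"
  shows "p = q"
  using partition_subset_if_same[of A p q] partition_subset_if_same[of A q p] assms by auto

lemma Up_in_points [simp]: "Up i \<in> points k l \<longleftrightarrow> 1 \<le> i \<and> i \<le> k"
  and Low_in_points [simp]: "Low j \<in> points k l \<longleftrightarrow> 1 \<le> j \<and> j \<le> l"
  by (auto simp: points_def)

lemma points_cases:
  assumes "x \<in> points k l"
  obtains i where "x = Up i" "1 \<le> i" "i \<le> k" | j where "x = Low j" "1 \<le> j" "j \<le> l"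
  using assms by (auto simp: points_def)

lemma finite_points [simp]: "finite (points k l)"
  by (simp add: points_def)

lemma card_points: "card (points k l) = k + l"
proof -
  have "inj_on Up {1..k}" "inj_on Low {1..l}" by (auto simp: inj_on_def)
  moreover have "Up ` {1..k} \<inter> Low ` {1..l} = {}" by auto
  ultimately show ?thesis unfolding points_def by (simp add: card_Un_disjoint card_image)
qed

lemma partitions_on: "p \<in> partitions k l \<Longrightarrow> partition_on (points k l) p"
  by (simp add: partitions_def)

lemma partitions_Union: "p \<in> partitions k l \<Longrightarrow> \<Union>p = points k l"
  using partition_onD1[OF partitions_on, of p k l] by simp

lemma finite_partitions: "finite (partitions k l)"
proof -
  have "partitions k l \<subseteq> Pow (Pow (points k l))"
    by (auto simp: partitions_def partition_on_def)
  then show ?thesis by (rule finite_subset) simp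
qed

lemma same_pcomp: "same (pcomp q p) x y \<longleftrightarrow> conn (stack q p) (in_outer x) (in_outer y)"
proof
  assume "same (pcomp q p) x y"
  then obtain K where "K \<in> comps (stack q p)" "in_outer x \<in> K" "in_outer y \<in> K"
    by (auto simp: same_def pcomp_def components_eq_comps)
  then show "conn (stack q p) (in_outer x) (in_outer y)" by (metis comps_conn)
next
  assume c: "conn (stack q p) (in_outer x) (in_outer y)"
  let ?K = "{z. conn (stack q p) (in_outer x) z}"
  have K: "?K \<in> comps (stack q p)" using comps_I[OF conn_in1[OF c]] .
  have x: "conn (stack q p) (in_outer x) (in_outer x)" using conn_refl[OF conn_in1[OF c]] .
  then have "in_outer -` ?K \<in> pcomp q p"
    unfolding pcomp_def components_eq_comps using imageI[OF K, of "(-`) in_outer"] by (simp only: Diff_iff) auto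
  then show "same (pcomp q p) x y" unfolding same_def using x c by (intro bexI) auto
qed

lemma conn_stack:
  "same p u v \<Longrightarrow> conn (stack q p) (in_upper u) (in_upper v)"
  "same q u v \<Longrightarrow> conn (stack q p) (in_lower u) (in_lower v)"
  unfolding same_def stack_def by (blast intro: conn_link)+

lemma Union_stack:
  assumes "p \<in> partitions k l" "q \<in> partitions l m"
  shows "\<Union>(stack q p) = Top ` {1..k} \<union> Mid ` {1..l} \<union> Bot ` {1..m}"
proof -
  have "\<Union>(stack q p) = in_upper ` \<Union>p \<union> in_lower ` \<Union>q" by (auto simp: stack_def)
  also have "\<dots> = in_upper ` points k l \<union> in_lower ` points l m"
    using assms by (simp add: partitions_Union)
  also have "\<dots> = Top ` {1..k} \<union> Mid ` {1..l} \<union> Bot ` {1..m}"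
    by (auto simp: points_def image_Un image_image)
  finally show ?thesis .
qed

lemma Union_comps: "\<Union>(comps \<B>) = \<Union>\<B>"
  by (auto simp: comps_def intro: conn_refl dest: conn_in2)

lemma pcomp_partitions:
  assumes "p \<in> partitions k l" "q \<in> partitions l m"
  shows "pcomp q p \<in> partitions k m"
proof -
  have outer: "in_outer -` (\<Union>(stack q p)) = points k m"
  proof (rule set_eqI)
    fix x show "x \<in> in_outer -` (\<Union>(stack q p)) \<longleftrightarrow> x \<in> points k m"
      unfolding Union_stack[OF assms] by (cases x) auto
  qed
  have "\<Union>(pcomp q p) = in_outer -` \<Union>(comps (stack q p))"
    by (auto simp: pcomp_def components_eq_comps)
  also have "\<Union>(comps (stack q p)) = \<Union>(stack q p)"
    by (rule Union_comps)
  finally have 1: "\<Union>(pcomp q p) = points k m" using outer by simp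
  have 2: "disjoint (pcomp q p)"
  proof (rule disjointI)
    fix A B assume *: "A \<in> pcomp q p" "B \<in> pcomp q p" "A \<noteq> B"
    then obtain K L where "K \<in> comps (stack q p)" "A = in_outer -` K"
        "L \<in> comps (stack q p)" "B = in_outer -` L"
      by (auto simp: pcomp_def components_eq_comps)
    then show "A \<inter> B = {}" using * comps_disjoint[of K "stack q p" L] by blast
  qed
  have 3: "{} \<notin> pcomp q p" by (simp add: pcomp_def)
  show ?thesis using 1 2 3 by (simp add: partitions_def partition_on_def)
qed

section \<open>Planarity of composites\<close>

text \<open>Absence of crossings for an equivalence relation \<open>R\<close> in the linear order
  given by \<open>f\<close>. Concluding \<open>R a b\<close> instead of a contradiction avoids any
  mention of blocks, so the condition can be followed while classes are being merged.\<close>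

definition nesting :: "('a \<Rightarrow> nat) \<Rightarrow> 'a set \<Rightarrow> ('a \<Rightarrow> 'a \<Rightarrow> bool) \<Rightarrow> bool" where
  "nesting f S R \<longleftrightarrow> (\<forall>a \<in> S. \<forall>b \<in> S. \<forall>c \<in> S. \<forall>d \<in> S.
     f a < f b \<longrightarrow> f b < f c \<longrightarrow> f c < f d \<longrightarrow> R a c \<longrightarrow> R b d \<longrightarrow> R a b)"

text \<open>For an equivalence relation: classes have at most two elements in
  \<open>S\<close>.\<close>

definition pairing :: "'a set \<Rightarrow> ('a \<Rightarrow> 'a \<Rightarrow> bool) \<Rightarrow> bool" where
  "pairing S R \<longleftrightarrow> (\<forall>a \<in> S. \<forall>b \<in> S. \<forall>c \<in> S. R a b \<longrightarrow> R b c \<longrightarrow> a = b \<or> b = c \<or> a = c)"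

text \<open>For an equivalence relation \<open>R\<close>, the join of the classes of
  \<open>x\<close> and \<open>y\<close>. A path needs the new link at most once, so no closure has
  to be taken.\<close>

definition merge :: "'a \<Rightarrow> 'a \<Rightarrow> ('a \<Rightarrow> 'a \<Rightarrow> bool) \<Rightarrow> 'a \<Rightarrow> 'a \<Rightarrow> bool" where
  "merge x y R a b \<longleftrightarrow> R a b \<or> R a x \<and> R y b \<or> R a y \<and> R x b"

lemma merge_symp: "symp R \<Longrightarrow> symp (merge x y R)"
  unfolding symp_def merge_def by metis

lemma merge_transp: "symp R \<Longrightarrow> transp R \<Longrightarrow> transp (merge x y R)"
  unfolding symp_def transp_def merge_def by metis

text \<open>Once \<open>x\<close> and \<open>y\<close> are removed, each of their classes retains at
  most one point, so the joined class still has at most two.\<close>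

lemma pairing_merge:
  assumes "pairing S R" "symp R" "transp R" "x \<in> S" "y \<in> S"
  shows "pairing (S - {x, y}) (merge x y R)"
  unfolding pairing_def
proof (intro ballI impI)
  have p: "\<And>a b c. a \<in> S \<Longrightarrow> b \<in> S \<Longrightarrow> c \<in> S \<Longrightarrow> R a b \<Longrightarrow> R b c \<Longrightarrow> a = b \<or> b = c \<or> a = c"
    using assms(1) unfolding pairing_def by blast
  have s: "\<And>a b. R a b \<Longrightarrow> R b a" and t: "\<And>a b c. R a b \<Longrightarrow> R b c \<Longrightarrow> R a c"
    using assms(2,3) unfolding symp_def transp_def by blast+
  fix a b c assume "a \<in> S - {x, y}" "b \<in> S - {x, y}" "c \<in> S - {x, y}"
    and R: "merge x y R a b" "merge x y R b c"
  then have S: "a \<in> S" "b \<in> S" "c \<in> S" "a \<noteq> x" "b \<noteq> x" "c \<noteq> x" "a \<noteq> y" "b \<noteq> y" "c \<noteq> y" by auto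
  have one: "u = v" if "R u z" "R v z" "u \<in> S" "v \<in> S" "u \<noteq> z" "v \<noteq> z" "z \<in> S" for u v z
    using p[of u z v] that s by blast
  from R show "a = b \<or> b = c \<or> a = c"
    unfolding merge_def
    using p[OF S(1-3)] one[of a x b] one[of a y b] one[of b x c] one[of b y c] one[of a x c] one[of a y c]
      S assms(4,5) s[of b c] s[of x c] s[of y c] s[of x b] s[of y b] t[of a b x] t[of a b y]
      t[of c b x] t[of c b y] by argo
qed

text \<open>Adjacency of \<open>x\<close> and \<open>y\<close> is essential: a chord separating them
  could be crossed by the joined class. Removing both points afterwards makes the next pair of
  copies adjacent.\<close>

lemma nesting_merge:
  assumes n: "nesting f S R" and "symp R" "transp R" and xy: "x \<in> S" "y \<in> S" "f x < f y"
    and inj: "inj_on f S" and adj: "\<And>z. z \<in> S \<Longrightarrow> f z \<le> f x \<or> f y \<le> f z"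
  shows "nesting f (S - {x, y}) (merge x y R)"
proof -
  have s: "\<And>a b. R a b \<Longrightarrow> R b a" and t: "\<And>a b c. R a b \<Longrightarrow> R b c \<Longrightarrow> R a c"
    using assms(2,3) unfolding symp_def transp_def by metis+
  have n: "\<And>a b c d. a \<in> S \<Longrightarrow> b \<in> S \<Longrightarrow> c \<in> S \<Longrightarrow> d \<in> S \<Longrightarrow> f a < f b \<Longrightarrow> f b < f c \<Longrightarrow> f c < f d 
      \<Longrightarrow> R a c \<Longrightarrow> R b d \<Longrightarrow> R a b"
    using n unfolding nesting_def by blast
  \<comment> \<open>The nesting condition for a chord with one end inside and the other on either
    side outside.\<close>
  have cross: "R u w"
    if "u \<in> S" "v \<in> S" "w \<in> S" "z \<in> S" "f u < f w" "f w < f v" "f z < f u \<or> f v < f z" "R u v" "R w z"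
    for u v w z
    using that(7)
  proof
    assume "f z < f u"
    then have "R z u" using n[of z u w v] that s by blast
    then show ?thesis using that s t by blast
  next
    assume "f v < f z"
    then show ?thesis using n[of u w v z] that by blast
  qed
  text \<open>By adjacency \<open>x\<close> and \<open>y\<close> lie on the same side of a chord \<open>u\<close>--\<open>v\<close>, so a chord
    through the merged point \<open>x = y\<close> already crosses \<open>u\<close>--\<open>v\<close> with one of its halves.\<close>
  have sep: "R u x \<or> R u y"
    if S: "u \<in> S" "v \<in> S" "w \<in> S" "z \<in> S" and uv: "R u v" "f u < f v"
      and w: "f u < f w" "f w < f v" and z: "f z < f u \<or> f v < f z"
      and ne: "u \<noteq> x" "u \<noteq> y" "v \<noteq> x" "v \<noteq> y"
      and wz: "R w x \<and> R y z \<or> R w y \<and> R x z" for u v w z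
  proof -
    have neq: "f u \<noteq> f x" "f u \<noteq> f y" "f v \<noteq> f x" "f v \<noteq> f y"
      using ne S xy inj by (metis inj_onD)+
    consider (inside) "f u < f x" "f x < f v" "f u < f y" "f y < f v"
      | (outside) "f x < f u \<or> f v < f x" "f y < f u \<or> f v < f y"
      using neq adj[OF S(1)] adj[OF S(2)] xy(3) uv(2) by linarith
    then show ?thesis
    proof cases
      case inside
      then show ?thesis using wz cross[of u v x z] cross[of u v y z] S xy uv z by blast
    next
      case outside
      then have "R u w" using wz cross[of u v w x] cross[of u v w y] S xy uv w by blast
      then show ?thesis using wz t by blast
    qed
  qed
  show ?thesis
    unfolding nesting_def
  proof (intro ballI impI)
    fix a b c d
    assume "a \<in> S - {x, y}" "b \<in> S - {x, y}" "c \<in> S - {x, y}" "d \<in> S - {x, y}"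
      and lt: "f a < f b" "f b < f c" "f c < f d" and R: "merge x y R a c" "merge x y R b d"
    then have S: "a \<in> S" "b \<in> S" "c \<in> S" "d \<in> S"
      and ne: "a \<noteq> x" "b \<noteq> x" "c \<noteq> x" "d \<noteq> x" "a \<noteq> y" "b \<noteq> y" "c \<noteq> y" "d \<noteq> y" by auto
    let ?J = "\<lambda>u v. R u x \<and> R y v \<or> R u y \<and> R x v"
    have Jsym: "?J v u" if "?J u v" for u v using that s by blast
    have a: "R a x \<or> R a y" if "?J a c" using that by blast
    have join: "merge x y R a b" if "R a x \<or> R a y" "R b x \<or> R b y"
      using that s t unfolding merge_def by blast
    consider (1) "R a c" "R b d" | (2) "?J a c" "R b d" | (3) "R a c" "?J b d" | (4) "?J a c" "?J b d"
      using R unfolding merge_def by blast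
    then show "merge x y R a b"
    proof cases
      case 1
      then show ?thesis using n[OF S lt] unfolding merge_def by blast
    next
      case 2
      have "R b x \<or> R b y"
        by (rule sep[of b d c a]) (use S ne lt 2 Jsym[OF 2(1)] in auto)
      then show ?thesis using 2 join by blast
    next
      case 3
      have "R a x \<or> R a y"
        by (rule sep[of a c b d]) (use S ne lt 3 in auto)
      then show ?thesis using 3 join by blast
    next
      case 4
      then show ?thesis using join by blast
    qed
  qed
qed

fun doubled_pos :: "nat \<Rightarrow> nat \<Rightarrow> nat \<Rightarrow> pt + pt \<Rightarrow> nat" where
  "doubled_pos k l m (Inl u) = pos k l u"
| "doubled_pos k l m (Inr u) = k + l + pos l m u"

fun glue :: "pt + pt \<Rightarrow> pt3" where
  "glue (Inl u) = in_upper u"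
| "glue (Inr u) = in_lower u"

fun outer_copy :: "pt \<Rightarrow> pt + pt" where
  "outer_copy (Up i) = Inl (Up i)"
| "outer_copy (Low j) = Inr (Low j)"

fun doubled_same :: "ptn \<Rightarrow> ptn \<Rightarrow> pt + pt \<Rightarrow> pt + pt \<Rightarrow> bool" where
  "doubled_same q p (Inl u) (Inl v) = same p u v"
| "doubled_same q p (Inr u) (Inr v) = same q u v"
| "doubled_same q p _ _ = False"

text \<open>The shared row is doubled and the two diagrams are read one after the other. Then \<open>Low 1\<close> of the
  first is adjacent to \<open>Up 1\<close> of the second, and once \<open>Low j\<close>, \<open>Up j\<close> have been merged and removed
  for \<open>j = 1, \<dots>, i\<close>, the copies with index \<open>i + 1\<close> are adjacent.\<close>

fun merged :: "ptn \<Rightarrow> ptn \<Rightarrow> nat \<Rightarrow> pt + pt \<Rightarrow> pt + pt \<Rightarrow> bool" where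
  "merged q p 0 = doubled_same q p"
| "merged q p (Suc j) = merge (Inl (Low (Suc j))) (Inr (Up (Suc j))) (merged q p j)"

locale composable =
  fixes k l m p q
  assumes p: "p \<in> partitions k l" and q: "q \<in> partitions l m"
begin

definition "D = Inl ` points k l \<union> Inr ` points l m"

definition "rest j = D - (Inl ` Low ` {1..j} \<union> Inr ` Up ` {1..j})"

lemma rest_Suc: "rest (Suc j) = rest j - {Inl (Low (Suc j)), Inr (Up (Suc j))}"
proof -
  have "{1..Suc j} = insert (Suc j) {1..j}" by auto
  then show ?thesis by (auto simp: rest_def)
qed

lemma merged_equiv: "symp (merged q p j)" "transp (merged q p j)"
proof (induction j)
  case 0
  show "symp (merged q p 0)"
  proof (rule sympI)
    fix x y assume "merged q p 0 x y"
    then show "merged q p 0 y x" by (cases x; cases y) (auto intro: same_sym)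
  qed
  show "transp (merged q p 0)"
  proof (rule transpI)
    fix x y z assume "merged q p 0 x y" "merged q p 0 y z"
    then show "merged q p 0 x z"
      by (cases x; cases y; cases z; simp)
        (metis partition_same_trans[OF partitions_on[OF p]],
         metis partition_same_trans[OF partitions_on[OF q]])
  qed
next
  case (Suc j)
  then show "symp (merged q p (Suc j))" "transp (merged q p (Suc j))"
    by (simp_all add: merge_symp merge_transp)
qed

lemma merged_mono: "merged q p i x y \<Longrightarrow> i \<le> j \<Longrightarrow> merged q p j x y"
  by (induction j) (auto simp: le_Suc_eq merge_def)

lemma merged_refl: "x \<in> D \<Longrightarrow> merged q p j x x"
proof (rule merged_mono[of 0])
  assume "x \<in> D"
  then show "merged q p 0 x x"
    using partition_same_refl[OF partitions_on[OF p]] partition_same_refl[OF partitions_on[OF q]]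
    by (cases x) (auto simp: D_def)
qed simp

lemma merged_pair:
  assumes "1 \<le> i" "i \<le> j" "i \<le> l"
  shows "merged q p j (Inl (Low i)) (Inr (Up i))"
proof (rule merged_mono)
  obtain i' where i': "i = Suc i'" using assms by (cases i) auto
  have "Inl (Low i) \<in> D" "Inr (Up i) \<in> D" using assms by (auto simp: D_def)
  then show "merged q p i (Inl (Low i)) (Inr (Up i))"
    using merged_refl[of _ i'] unfolding i' by (simp add: merge_def)
qed (use assms in simp)

lemma conn_if_merged: "merged q p j x y \<Longrightarrow> conn (stack q p) (glue x) (glue y)"
proof (induction j arbitrary: x y)
  case 0
  then show ?case
    by (cases x; cases y) (auto simp: conn_stack)
next
  case (Suc j)
  then have "merged q p j x y \<or> (\<exists>u v. glue u = Mid (Suc j) \<and> glue v = Mid (Suc j) \<and>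
      merged q p j x u \<and> merged q p j v y)"
    by (auto simp: merge_def)
  then show ?case using Suc.IH conn_trans by metis
qed

lemma merged_if_glue_eq:
  assumes "x \<in> D" "y \<in> D" "glue x = glue y"
  shows "merged q p l x y"
proof (cases "x = y")
  case True
  then show ?thesis using merged_refl assms by simp
next
  case False
  have *: "merged q p l (Inr (Up i)) (Inl (Low i))" if "1 \<le> i" "i \<le> l" for i
    using merged_pair[of i l] merged_equiv(1)[of l] that unfolding symp_def by simp
  from False show ?thesis using assms merged_pair[of _ l] *
    unfolding D_def by (auto elim!: points_cases)
qed

text \<open>Every block of the stack lifts to one of the two diagrams, and the two lifts of a shared
  point have been merged, so a path can be lifted link by link. The induction claims the result for
  all lifts of the endpoint, since consecutive links may use different copies.\<close>

lemma merged_if_conn: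
  assumes c: "conn (stack q p) u v" and x: "x \<in> D" "glue x = u" and y: "y \<in> D" "glue y = v"
  shows "merged q p l x y"
proof -
  have t: "merged q p l a c" if "merged q p l a b" "merged q p l b c" for a b c
    using merged_equiv(2)[of l] that unfolding transp_def by blast
  have "\<forall>y \<in> D. glue y = v \<longrightarrow> merged q p l x y"
    using c
  proof (induction rule: conn_induct)
    case start
    then show ?case using merged_if_glue_eq x by metis
  next
    case (step v w B)
    have "\<exists>v' w'. v' \<in> D \<and> w' \<in> D \<and> glue v' = v \<and> glue w' = w \<and> merged q p 0 v' w'"
      using \<open>B \<in> stack q p\<close> unfolding stack_def
    proof (rule UnE)
      assume "B \<in> (`) in_upper ` p"
      then obtain B' v' w' where B: "B' \<in> p" "v' \<in> B'" "w' \<in> B'" "v = in_upper v'" "w = in_upper w'"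
        using step by auto
      then have "v' \<in> points k l" "w' \<in> points k l" using partitions_Union[OF p] by auto
      then show ?thesis using B
        by (intro exI[of _ "Inl v'"] exI[of _ "Inl w'"]) (auto simp: D_def same_def)
    next
      assume "B \<in> (`) in_lower ` q"
      then obtain B' v' w' where B: "B' \<in> q" "v' \<in> B'" "w' \<in> B'" "v = in_lower v'" "w = in_lower w'"
        using step by auto
      then have "v' \<in> points l m" "w' \<in> points l m" using partitions_Union[OF q] by auto
      then show ?thesis using B
        by (intro exI[of _ "Inr v'"] exI[of _ "Inr w'"]) (auto simp: D_def same_def)
    qed
    then obtain v' w' where *: "v' \<in> D" "w' \<in> D" "glue v' = v" "glue w' = w" "merged q p 0 v' w'" by blast
    have "merged q p l x w'" using step * t merged_mono[OF *(5), of l] by blast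
    then show ?case using t merged_if_glue_eq[OF *(2)] *(4) by metis
  qed
  then show ?thesis using y by blast
qed

lemma same_pcomp_merged:
  assumes "x \<in> points k m" "y \<in> points k m"
  shows "same (pcomp q p) x y \<longleftrightarrow> merged q p l (outer_copy x) (outer_copy y)"
proof -
  have g: "glue (outer_copy z) = in_outer z" for z by (cases z) auto
  have "outer_copy z \<in> D" if "z \<in> points k m" for z
    using that by (cases z) (auto simp: D_def)
  then show ?thesis unfolding same_pcomp
    using merged_if_conn conn_if_merged[of l "outer_copy x" "outer_copy y"] assms g by metis
qed

lemma outer_copy_rest: "x \<in> points k m \<Longrightarrow> outer_copy x \<in> rest l"
  by (cases x) (auto simp: rest_def D_def)

lemma inj_outer_copy: "outer_copy x = outer_copy y \<longleftrightarrow> x = y"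
  by (cases x; cases y) auto

lemma inj_doubled_pos: "inj_on (doubled_pos k l m) D"
  unfolding D_def inj_on_def by (auto elim!: points_cases)

lemma pairing_pcomp:
  assumes "pairing (points k l) (same p)" "pairing (points l m) (same q)"
  shows "pairing (points k m) (same (pcomp q p))"
proof -
  have "j \<le> l \<Longrightarrow> pairing (rest j) (merged q p j)" for j
  proof (induction j)
    case 0
    show ?case
      unfolding pairing_def
    proof (intro ballI impI)
      fix a b c assume *: "a \<in> rest 0" "b \<in> rest 0" "c \<in> rest 0" "merged q p 0 a b" "merged q p 0 b c"
      then have D: "a \<in> D" "b \<in> D" "c \<in> D" by (auto simp: rest_def)
      show "a = b \<or> b = c \<or> a = c"
      proof (cases b)
        case (Inl b')
        then obtain a' c' where "a = Inl a'" "c = Inl c'" using * by (cases a; cases c) auto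
        then show ?thesis using Inl D * assms(1) unfolding pairing_def D_def by auto
      next
        case (Inr b')
        then obtain a' c' where "a = Inr a'" "c = Inr c'" using * by (cases a; cases c) auto
        then show ?thesis using Inr D * assms(2) unfolding pairing_def D_def by auto
      qed
    qed
  next
    case (Suc j)
    show ?case unfolding rest_Suc merged.simps
      by (rule pairing_merge) (use Suc merged_equiv in \<open>auto simp: rest_def D_def\<close>)
  qed
  then have *: "pairing (rest l) (merged q p l)" by simp
  show ?thesis
    unfolding pairing_def
  proof (intro ballI impI)
    fix a b c assume "a \<in> points k m" "b \<in> points k m" "c \<in> points k m"
      "same (pcomp q p) a b" "same (pcomp q p) b c"
    then show "a = b \<or> b = c \<or> a = c"
      using * outer_copy_rest unfolding pairing_def by (metis same_pcomp_merged inj_outer_copy)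
  qed
qed

lemma nesting_pcomp:
  assumes "nesting (pos k l) (points k l) (same p)" "nesting (pos l m) (points l m) (same q)"
  shows "nesting (pos k m) (points k m) (same (pcomp q p))"
proof -
  let ?f = "doubled_pos k l m"
  have "j \<le> l \<Longrightarrow> nesting ?f (rest j) (merged q p j)" for j
  proof (induction j)
    case 0
    show ?case
      unfolding nesting_def
    proof (intro ballI impI)
      fix a b c d assume *: "a \<in> rest 0" "b \<in> rest 0" "c \<in> rest 0" "d \<in> rest 0"
        "?f a < ?f b" "?f b < ?f c" "?f c < ?f d" "merged q p 0 a c" "merged q p 0 b d"
      then have D: "a \<in> D" "b \<in> D" "c \<in> D" "d \<in> D" by (auto simp: rest_def)
      \<comment> \<open>All of the first diagram is read before the second, so two chords of
        different diagrams do not interleave.\<close>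
      have lr: "?f (Inl u) \<le> k + l" "k + l < ?f (Inr v)" 
        if "Inl u \<in> D" "Inr v \<in> D" for u v
        using that by (auto simp: D_def elim!: points_cases)
      show "merged q p 0 a b"
      proof (cases a)
        case (Inl a')
        then obtain c' where c: "c = Inl c'" using * by (cases c) auto
        obtain b' where b: "b = Inl b'" using lr(1)[of c'] lr(2)[of c'] c D *(6) by (cases b) fastforce+
        obtain d' where d: "d = Inl d'" using b * by (cases d) auto
        show ?thesis using Inl b c d D * assms(1) unfolding nesting_def D_def by auto
      next
        case (Inr a')
        then obtain c' where c: "c = Inr c'" using * by (cases c) auto
        obtain b' where b: "b = Inr b'" using lr(2)[of _ a'] lr(1)[of _ a'] Inr D *(5) by (cases b) fastforce+
        obtain d' where d: "d = Inr d'" using b * by (cases d) auto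
        show ?thesis using Inr b c d D * assms(2) unfolding nesting_def D_def by auto
      qed
    qed
  next
    case (Suc j)
    let ?x = "Inl (Low (Suc j)) :: pt + pt" and ?y = "Inr (Up (Suc j)) :: pt + pt"
    have fx: "?f ?x = k + l - j" "?f ?y = k + l + j + 1" using Suc by auto
    have adj: "?f z \<le> ?f ?x \<or> ?f ?y \<le> ?f z" if "z \<in> rest j" for z
    proof -
      have z: "z \<in> D" "z \<notin> Inl ` Low ` {1..j}" "z \<notin> Inr ` Up ` {1..j}" using that by (auto simp: rest_def)
      show ?thesis
      proof (cases z)
        case (Inl u)
        then have u: "u \<in> points k l" using z by (auto simp: D_def)
        have "u \<notin> Low ` {1..j}" using z(2) Inl by blast
        then show ?thesis using u Inl fx Suc.prems
          by (cases u) (auto simp: not_le)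
      next
        case (Inr u)
        then have u: "u \<in> points l m" using z by (auto simp: D_def)
        have "u \<notin> Up ` {1..j}" using z(3) Inr by blast
        then show ?thesis using u Inr fx Suc.prems
          by (cases u) (auto simp: not_le)
      qed
    qed
    show ?case unfolding rest_Suc merged.simps
    proof (rule nesting_merge)
      show "nesting ?f (rest j) (merged q p j)" using Suc by simp
      show "?x \<in> rest j" "?y \<in> rest j" using Suc.prems by (auto simp: rest_def D_def)
      show "inj_on ?f (rest j)" using inj_doubled_pos by (rule inj_on_subset) (auto simp: rest_def)
    qed (use fx adj merged_equiv Suc.prems in auto)
  qed
  then have *: "nesting ?f (rest l) (merged q p l)" by simp
  have mono: "?f (outer_copy a) < ?f (outer_copy b)"
    if "a \<in> points k m" "b \<in> points k m" "pos k m a < pos k m b" for a b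
    using that by (cases a; cases b) auto
  show ?thesis
    unfolding nesting_def
  proof (intro ballI impI)
    fix a b c d assume S: "a \<in> points k m" "b \<in> points k m" "c \<in> points k m" "d \<in> points k m"
      and lt: "pos k m a < pos k m b" "pos k m b < pos k m c" "pos k m c < pos k m d"
      and R: "same (pcomp q p) a c" "same (pcomp q p) b d"
    show "same (pcomp q p) a b"
      using * R outer_copy_rest S mono[OF _ _ lt(1)] mono[OF _ _ lt(2)] mono[OF _ _ lt(3)]
      unfolding nesting_def same_pcomp_merged[OF S(1,3)] same_pcomp_merged[OF S(2,4)]
        same_pcomp_merged[OF S(1,2)] by blast
  qed
qed

end

section \<open>The two families described by their block relations\<close>

lemma noncrossing_iff_nesting:
  assumes "p \<in> partitions k l"
  shows "noncrossing k l p \<longleftrightarrow> nesting (pos k l) (points k l) (same p)"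
proof
  assume n: "noncrossing k l p"
  show "nesting (pos k l) (points k l) (same p)"
    unfolding nesting_def
  proof (intro ballI impI)
    fix a b c d assume lt: "pos k l a < pos k l b" "pos k l b < pos k l c" "pos k l c < pos k l d"
      and "same p a c" "same p b d"
    then obtain B B' where B: "B \<in> p" "B' \<in> p" "a \<in> B" "c \<in> B" "b \<in> B'" "d \<in> B'"
      by (auto simp: same_def)
    have "B = B'"
    proof (rule ccontr)
      assume ne: "B \<noteq> B'"
      have "\<exists>B \<in> p. \<exists>B' \<in> p. B \<noteq> B' \<and> (\<exists>a \<in> B. \<exists>c \<in> B. \<exists>b \<in> B'. \<exists>d \<in> B'.
        pos k l a < pos k l b \<and> pos k l b < pos k l c \<and> pos k l c < pos k l d)"
        by (rule bexI[of _ B], rule bexI[of _ B'], rule conjI[OF ne], rule bexI[of _ a],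
          rule bexI[of _ c], rule bexI[of _ b], rule bexI[of _ d]) (use B lt in auto)
      then show False using n unfolding noncrossing_def by contradiction
    qed
    then show "same p a b" using B by (auto simp: same_def)
  qed
next
  assume n: "nesting (pos k l) (points k l) (same p)"
  show "noncrossing k l p"
    unfolding noncrossing_def
  proof (rule notI, elim bexE conjE)
    fix B B' a b c d assume B: "B \<in> p" "B' \<in> p" "B \<noteq> B'" "a \<in> B" "c \<in> B" "b \<in> B'" "d \<in> B'"
      and lt: "pos k l a < pos k l b" "pos k l b < pos k l c" "pos k l c < pos k l d"
    have "same p a c" "same p b d" using B by (auto simp: same_def)
    moreover have "a \<in> points k l" "b \<in> points k l" "c \<in> points k l" "d \<in> points k l"
      using B partitions_Union[OF assms] by auto
    ultimately have "same p a b" using n lt unfolding nesting_def by blast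
    then have "b \<in> B" using B(4) partition_class[OF partitions_on[OF assms] B(1)] by blast
    then have "B = B'" using B(1,2,6) partition_onD2[OF partitions_on[OF assms]]
      unfolding disjoint_def by blast
    then show False using B by simp
  qed
qed

text \<open>The block sizes add up to \<open>k + l\<close>, and modulo two only the odd ones count.
  The parity condition thus depends on the numbers of points alone, which makes its stability under
  composition immediate.\<close>

lemma even_odd_blocks:
  assumes "p \<in> partitions k l"
  shows "even (card {B \<in> p. odd (card B)}) \<longleftrightarrow> even (k + l)"
proof -
  have fin: "finite p" using finite_elements[OF _ partitions_on[OF assms]] by simp
  have finB: "finite B" if "B \<in> p" for B
    using that partitions_Union[OF assms] finite_points by (metis Union_upper finite_subset)
  have "k + l = card (\<Union>p)" using partitions_Union[OF assms] card_points by simp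
  also have "\<dots> = (\<Sum>B\<in>p. card B)"
    using partition_onD2[OF partitions_on[OF assms]] finB
    by (intro card_Union_disjoint) (auto simp: disjoint_def pairwise_def disjnt_def)
  finally have "even (k + l) \<longleftrightarrow> even (\<Sum>B\<in>p. card B)" by simp
  also have "\<dots> \<longleftrightarrow> even (card {B \<in> p. odd (card B)})"
    using fin by (simp add: even_sum_iff)
  finally show ?thesis by simp
qed

lemma NC'_iff:
  "p \<in> NC' k l \<longleftrightarrow> p \<in> partitions k l \<and> nesting (pos k l) (points k l) (same p) \<and> even (k + l)"
  unfolding NC'_def using noncrossing_iff_nesting even_odd_blocks by auto

lemma small_blocks_iff_pairing:
  assumes "p \<in> partitions k l"
  shows "(\<forall>B \<in> p. card B = 1 \<or> card B = 2) \<longleftrightarrow> pairing (points k l) (same p)"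
proof
  assume n: "\<forall>B \<in> p. card B = 1 \<or> card B = 2"
  show "pairing (points k l) (same p)"
    unfolding pairing_def
  proof (intro ballI impI)
    fix a b c assume "same p a b" "same p b c"
    moreover then have "same p a c" using partition_same_trans[OF partitions_on[OF assms]] by blast
    ultimately obtain B where B: "B \<in> p" "a \<in> B" "b \<in> B" "c \<in> B"
      using partition_class[OF partitions_on[OF assms]] unfolding same_def
      by (metis (mono_tags, lifting) mem_Collect_eq same_def)
    show "a = b \<or> b = c \<or> a = c"
    proof (rule ccontr)
      assume "\<not> ?thesis"
      then have "card {a, b, c} = 3" by simp
      moreover have "finite B" using n B by (metis card.infinite zero_neq_numeral zero_neq_one)
      ultimately have "3 \<le> card B" using B card_mono[of B "{a, b, c}"] by simp
      then show False using n B by fastforce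
    qed
  qed
next
  assume n: "pairing (points k l) (same p)"
  show "\<forall>B \<in> p. card B = 1 \<or> card B = 2"
  proof (rule ballI, rule ccontr)
    fix B assume B: "B \<in> p" and c: "\<not> (card B = 1 \<or> card B = 2)"
    have fin: "finite B" using B partitions_Union[OF assms] finite_points by (metis Union_upper finite_subset)
    have "B \<noteq> {}" using B partition_onD3[OF partitions_on[OF assms]] by auto
    then have "card B \<noteq> 0" using fin by simp
    then have "3 \<le> card B" using c by linarith
    then obtain T where "T \<subseteq> B" "card T = 3" by (meson obtain_subset_with_card_n)
    then obtain a b c where abc: "a \<in> B" "b \<in> B" "c \<in> B" "a \<noteq> b" "b \<noteq> c" "a \<noteq> c"
      by (auto simp: card_3_iff)
    then have "a \<in> points k l" "b \<in> points k l" "c \<in> points k l"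
      using B partitions_Union[OF assms] by auto
    moreover have "same p a b" "same p b c" using B abc by (auto simp: same_def)
    ultimately show False using n abc unfolding pairing_def by blast
  qed
qed

text \<open>With blocks of size one or two the singletons are precisely the odd blocks, so the
  parity condition is again the one of \<open>even_odd_blocks\<close>.\<close>

lemma NC'_b_iff:
  "p \<in> NC'_b k l \<longleftrightarrow> p \<in> partitions k l \<and> nesting (pos k l) (points k l) (same p) \<and>
     pairing (points k l) (same p) \<and> even (k + l)"
proof -
  have "{B \<in> p. card B = 1} = {B \<in> p. odd (card B)}" if "\<forall>B \<in> p. card B = 1 \<or> card B = 2"
    using that by auto
  moreover have "p \<in> NC'_b k l \<longleftrightarrow> p \<in> partitions k l \<and> noncrossing k l p \<and>
     (\<forall>B \<in> p. card B = 1 \<or> card B = 2) \<and> even (card {B \<in> p. card B = 1})"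
    by (simp add: NC'_b_def)
  ultimately show ?thesis
    using noncrossing_iff_nesting[of p k l] even_odd_blocks[of p k l] small_blocks_iff_pairing[of p k l]
    by (cases "p \<in> partitions k l"; cases "\<forall>B \<in> p. card B = 1 \<or> card B = 2") simp_all
qed

locale planar_category =
  fixes C :: "nat \<Rightarrow> nat \<Rightarrow> ptn set"
  assumes C_cases: "C \<in> {NC', NC'_b}"
begin

lemma C_partitions: "p \<in> C k l \<Longrightarrow> p \<in> partitions k l"
  and C_nesting: "p \<in> C k l \<Longrightarrow> nesting (pos k l) (points k l) (same p)"
  and C_even: "p \<in> C k l \<Longrightarrow> even (k + l)"
  using C_cases by (auto simp: NC'_iff NC'_b_iff)

lemma pcomp_C: "p \<in> C k l \<Longrightarrow> q \<in> C l m \<Longrightarrow> pcomp q p \<in> C k m"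
proof -
  assume pq: "p \<in> C k l" "q \<in> C l m"
  interpret composable k l m p q by unfold_locales (use pq C_partitions in auto)
  have "even (k + m)" using C_even[OF pq(1)] C_even[OF pq(2)] by simp
  then show ?thesis
    using C_cases pq pcomp_partitions[OF p q] nesting_pcomp pairing_pcomp
    by (auto simp: NC'_iff NC'_b_iff)
qed

end

section \<open>Labels that separate components, and isolated points\<close>

text \<open>Bounds connectivity from above: to show that stacking creates no unwanted links it
  suffices to exhibit a label constant on the blocks of both diagrams.\<close>

lemma conn_stack_invariant:
  assumes "conn (stack q p) u v"
    and "\<And>x y. same p x y \<Longrightarrow> F (in_upper x) = F (in_upper y)"
    and "\<And>x y. same q x y \<Longrightarrow> F (in_lower x) = F (in_lower y)"
  shows "F u = F v"
  using assms(1)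
proof (induction rule: conn_induct)
  case start
  show ?case ..
next
  case (step v w B)
  have "F v = F w"
    using step(2) unfolding stack_def
  proof
    assume "B \<in> (`) in_upper ` p"
    then show ?thesis using step(3,4) assms(2) by (auto simp: same_def)
  next
    assume "B \<in> (`) in_lower ` q"
    then show ?thesis using step(3,4) assms(3) by (auto simp: same_def)
  qed
  then show ?case using step by simp
qed

definition kernel :: "'a set \<Rightarrow> ('a \<Rightarrow> 'b) \<Rightarrow> 'a set set" where
  "kernel A f = (\<lambda>x. {y \<in> A. f y = f x}) ` A"

lemma kernel_partition: "partition_on A (kernel A f)"
  by (rule partition_onI) (auto simp: kernel_def disjnt_def)

lemma same_kernel: "same (kernel A f) x y \<longleftrightarrow> x \<in> A \<and> y \<in> A \<and> f x = f y"
  by (auto simp: same_def kernel_def)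

definition isolated :: "ptn \<Rightarrow> pt \<Rightarrow> bool" where
  "isolated p x \<longleftrightarrow> (\<forall>y. same p x y \<longrightarrow> y = x)"

lemma stack_Top:
  assumes "B \<in> stack q p" "Top i \<in> B" "w \<in> B"
  obtains A y where "A \<in> p" "Up i \<in> A" "y \<in> A" "w = in_upper y"
proof -
  have "Top i \<noteq> in_lower x" for x by (cases x) auto
  then obtain A where A: "A \<in> p" "B = in_upper ` A" using assms by (auto simp: stack_def)
  then obtain x y where "x \<in> A" "Top i = in_upper x" "y \<in> A" "w = in_upper y" using assms by auto
  moreover from this have "x = Up i" by (cases x) auto
  ultimately show ?thesis using that A by blast
qed

text \<open>Only \<open>p\<close> has points in the top row, so nothing below can attach to a
  singleton there. Later this shows that composing with \<open>proj T True\<close> on both sides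
  leaves the surplus points isolated.\<close>

lemma isolated_pcomp_Up: "isolated p (Up i) \<Longrightarrow> isolated (pcomp q p) (Up i)"
proof -
  assume p: "isolated p (Up i)"
  have "v = Top i" if "conn (stack q p) (Top i) v" for v
    using that
  proof (induction rule: conn_induct)
    case (step v w B)
    obtain A y where A: "A \<in> p" "Up i \<in> A" "y \<in> A" "w = in_upper y"
      using stack_Top[of B q p i w] step by metis
    then have "y = Up i" using A p unfolding isolated_def same_def by blast
    then show ?case using A by simp
  qed simp
  then show ?thesis unfolding isolated_def same_pcomp
    by (metis in_outer.simps(1) inj_in_outer injD)
qed

section \<open>Reflection in a horizontal line\<close>

fun flip :: "pt \<Rightarrow> pt" where
  "flip (Up i) = Low i"
| "flip (Low j) = Up j"

fun flip3 :: "pt3 \<Rightarrow> pt3" where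
  "flip3 (Top i) = Bot i"
| "flip3 (Mid i) = Mid i"
| "flip3 (Bot i) = Top i"

text \<open>The involution of the category; it yields the statements about lower rows from those
  about upper rows.\<close>

definition dual :: "ptn \<Rightarrow> ptn" where
  "dual p = (`) flip ` p"

lemma flip_flip [simp]: "flip (flip x) = x"
  by (cases x) auto

lemma flip_eq_iff [simp]: "flip x = flip y \<longleftrightarrow> x = y"
  by (metis flip_flip)

lemma flip_points [simp]: "flip x \<in> points k l \<longleftrightarrow> x \<in> points l k"
  by (cases x) auto

lemma flip_vimage: "flip ` A = flip -` A"
  by (auto simp: image_iff) (metis flip_flip)

lemma flip_image_eq_iff: "flip ` A = flip ` B \<longleftrightarrow> A = B"
  by (simp add: inj_image_eq_iff inj_def)

lemma dual_dual [simp]: "dual (dual p) = p"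
  by (simp add: dual_def image_image)

lemma same_dual: "same (dual p) x y \<longleftrightarrow> same p (flip x) (flip y)"
  by (simp add: same_def dual_def flip_vimage)

lemma dual_partitions: "p \<in> partitions k l \<Longrightarrow> dual p \<in> partitions l k"
proof -
  assume p: "p \<in> partitions k l"
  have "flip ` points k l = points l k" by (auto simp: flip_vimage)
  then have "\<Union>(dual p) = points l k"
    unfolding dual_def image_Union[symmetric] by (simp add: partitions_Union[OF p])
  moreover have "disjoint (dual p)"
    unfolding dual_def
    by (rule disjoint_image[OF _ partition_onD2[OF partitions_on[OF p]]]) (auto simp: inj_on_def)
  moreover have "{} \<notin> dual p"
    using partition_onD3[OF partitions_on[OF p]] by (auto simp: dual_def)
  ultimately show ?thesis by (simp add: partitions_def partition_on_def)
qed

lemma pcomp_dual: "pcomp (dual p) (dual q) = dual (pcomp q p)"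
proof -
  have inj: "inj flip3"
  proof (rule injI)
    fix x y assume "flip3 x = flip3 y"
    then show "x = y" by (cases x; cases y) auto
  qed
  have f: "in_upper (flip x) = flip3 (in_lower x)" "in_lower (flip x) = flip3 (in_upper x)"
    "in_outer (flip x) = flip3 (in_outer x)" for x
    by (cases x; simp)+
  have "stack (dual p) (dual q) = (`) flip3 ` stack q p"
    by (simp add: stack_def dual_def image_Un image_image f Un_commute)
  then have c: "comps (stack (dual p) (dual q)) = (`) flip3 ` comps (stack q p)"
    by (simp add: comps_image[OF inj])
  have "in_outer -` (flip3 ` K) = flip ` (in_outer -` K)" for K
  proof -
    have "in_outer x \<in> flip3 ` K \<longleftrightarrow> in_outer (flip x) \<in> K" for x
      using f(3)[of "flip x"] inj by (auto simp: inj_image_mem_iff)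
    then show ?thesis by (auto simp: flip_vimage)
  qed
  then have "(-`) in_outer ` comps (stack (dual p) (dual q)) = (`) flip ` (-`) in_outer ` comps (stack q p)"
    by (simp add: c image_image)
  moreover have "(`) flip ` (S - {{}}) = (`) flip ` S - {{}}" for S by auto
  ultimately show ?thesis
    unfolding pcomp_def components_eq_comps by (simp add: dual_def)
qed

text \<open>Reflection reverses the reading order, so the nesting condition of \<open>p\<close>
  links the last two points \<open>c\<close> and \<open>d\<close> instead of the first two;
  transitivity along \<open>a\<close>, \<open>c\<close> and \<open>b\<close>, \<open>d\<close>
  transports the link.\<close>

lemma nesting_dual:
  assumes p: "p \<in> partitions k l" and n: "nesting (pos k l) (points k l) (same p)"
  shows "nesting (pos l k) (points l k) (same (dual p))"
  unfolding nesting_def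
proof (intro ballI impI)
  fix a b c d
  assume S: "a \<in> points l k" "b \<in> points l k" "c \<in> points l k" "d \<in> points l k"
    and lt: "pos l k a < pos l k b" "pos l k b < pos l k c" "pos l k c < pos l k d"
    and R: "same (dual p) a c" "same (dual p) b d"
  have rev: "pos k l (flip y) < pos k l (flip x)"
    if "pos l k x < pos l k y" "x \<in> points l k" "y \<in> points l k" for x y
    using that by (cases x; cases y) auto
  have "same p (flip d) (flip c)"
    using n S R rev[OF lt(1)] rev[OF lt(2)] rev[OF lt(3)] same_sym
    unfolding nesting_def same_dual by (metis flip_points)
  then have "same (dual p) d c" by (simp add: same_dual)
  then show "same (dual p) a b"
    using R partition_same_trans[OF partitions_on[OF dual_partitions[OF p]]] same_sym by metis
qed

lemma pairing_dual: "pairing (points k l) (same p) \<Longrightarrow> pairing (points l k) (same (dual p))"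
  unfolding pairing_def same_dual by (metis flip_points flip_eq_iff)

lemma isolated_dual: "isolated (dual p) x \<longleftrightarrow> isolated p (flip x)"
  unfolding isolated_def same_dual by (metis flip_flip)

lemma isolated_pcomp_Low: "isolated q (Low i) \<Longrightarrow> isolated (pcomp q p) (Low i)"
  using isolated_pcomp_Up[of "dual q" i "dual p"] by (simp add: pcomp_dual isolated_dual)

section \<open>Through-blocks\<close>

definition thr :: "ptn \<Rightarrow> ptn" where
  "thr p = {B \<in> p. (\<exists>i. Up i \<in> B) \<and> (\<exists>j. Low j \<in> B)}"

lemma through_blocks_thr: "through_blocks p = card (thr p)"
  by (simp add: through_blocks_def thr_def)

lemma finite_thr: "p \<in> partitions k l \<Longrightarrow> finite (thr p)"
  using finite_elements[OF finite_points partitions_on] by (simp add: thr_def)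

lemma thr_dual: "thr (dual p) = (`) flip ` thr p"
proof -
  have "thr (dual p) = (`) flip ` {B \<in> p. (\<exists>i. Up i \<in> flip ` B) \<and> (\<exists>j. Low j \<in> flip ` B)}"
    by (auto simp: thr_def dual_def)
  then show ?thesis by (simp add: thr_def flip_vimage conj_commute)
qed

lemma through_blocks_dual: "through_blocks (dual p) = through_blocks p"
proof -
  have "inj_on ((`) flip) A" for A
    by (rule inj_onI) (simp add: flip_image_eq_iff)
  then show ?thesis by (simp add: through_blocks_thr thr_dual card_image)
qed

lemma partitions_block_eq:
  assumes "p \<in> partitions k l" "B \<in> p" "B' \<in> p" "x \<in> B" "y \<in> B'" "same p x y"
  shows "B = B'"
proof -
  have "y \<in> B" using partition_class[OF partitions_on[OF assms(1)] assms(2,4)] assms(6) by blast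
  then show ?thesis using assms partition_onD2[OF partitions_on[OF assms(1)]]
    unfolding disjoint_def by blast
qed

text \<open>A path starting in the top row leaves it only by a block of \<open>p\<close> that also
  has lower points; if no such block is reached, the whole path stays in the top row.\<close>

lemma through_connected:
  assumes "conn (stack q p) (Top i) (Bot j)"
  shows "\<exists>A \<in> thr p. \<exists>u \<in> A. conn (stack q p) (Top i) (in_upper u)"
proof (rule ccontr)
  assume no: "\<not> ?thesis"
  have "Bot j \<in> range Top"
    using assms
  proof (induction rule: conn_induct)
    case (step v w B)
    then obtain i' where v: "v = Top i'" by auto
    obtain A y where A: "A \<in> p" "Up i' \<in> A" "y \<in> A" "w = in_upper y"
      using stack_Top[of B q p i' w] step v by metis
    show ?case
    proof (cases y)
      case (Low j')
      then have "A \<in> thr p" using A by (auto simp: thr_def)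
      then show ?thesis using no A(2) v step(1) by (metis in_upper.simps(1))
    qed (use A in auto)
  qed simp
  then show False by auto
qed

text \<open>Each through-block of the composite is assigned a through-block of \<open>p\<close> from
  its component. A block of \<open>p\<close> lies in a single component, so no block of
  \<open>p\<close> is used twice.\<close>

lemma through_blocks_pcomp_upper:
  assumes p: "p \<in> partitions k l" and q: "q \<in> partitions l m"
  shows "through_blocks (pcomp q p) \<le> through_blocks p"
proof -
  have r: "pcomp q p \<in> partitions k m" using pcomp_partitions[OF p q] .
  have thr: "\<exists>i j. Up i \<in> B \<and> conn (stack q p) (Top i) (Bot j) \<and> Low j \<in> B"
    if "B \<in> thr (pcomp q p)" for B
  proof -
    obtain i j where ij: "Up i \<in> B" "Low j \<in> B" "B \<in> pcomp q p" using \<open>B \<in> _\<close> by (auto simp: thr_def)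
    then have "same (pcomp q p) (Up i) (Low j)" by (auto simp: same_def)
    then show ?thesis using ij by (auto simp: same_pcomp)
  qed
  show "through_blocks (pcomp q p) \<le> through_blocks p"
    unfolding through_blocks_thr
  proof (rule card_le_if_inj_on_rel[where r="\<lambda>B A. \<exists>u \<in> A. \<exists>v \<in> B. conn (stack q p) (in_outer v) (in_upper u)"])
    fix B assume "B \<in> thr (pcomp q p)"
    then obtain i j where ij: "Up i \<in> B" "conn (stack q p) (Top i) (Bot j)" using thr by blast
    have "conn (stack q p) (in_outer (Up i)) z" if "conn (stack q p) (Top i) z" for z
      using that by simp
    then show "\<exists>A. A \<in> thr p \<and> (\<exists>u \<in> A. \<exists>v \<in> B. conn (stack q p) (in_outer v) (in_upper u))"
      using ij(1) through_connected[OF ij(2)] by blast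
  next
    fix B B' A assume "B \<in> thr (pcomp q p)" "B' \<in> thr (pcomp q p)" "A \<in> thr p"
      and "\<exists>u \<in> A. \<exists>v \<in> B. conn (stack q p) (in_outer v) (in_upper u)"
        "\<exists>u \<in> A. \<exists>v \<in> B'. conn (stack q p) (in_outer v) (in_upper u)"
    then obtain u u' v v' where *: "u \<in> A" "v \<in> B" "u' \<in> A" "v' \<in> B'" "A \<in> p" "B \<in> pcomp q p" "B' \<in> pcomp q p"
      "conn (stack q p) (in_outer v) (in_upper u)" "conn (stack q p) (in_outer v') (in_upper u')"
      by (auto simp: thr_def)
    then have "conn (stack q p) (in_upper u) (in_upper u')" by (intro conn_stack) (auto simp: same_def)
    then have "conn (stack q p) (in_outer v) (in_outer v')"
      using * conn_trans conn_sym by metis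
    then show "B = B'" using partitions_block_eq[OF r] * by (metis same_pcomp)
  qed (use finite_thr[OF p] in simp)
qed

lemma through_blocks_pcomp_lower:
  "p \<in> partitions k l \<Longrightarrow> q \<in> partitions l m \<Longrightarrow> through_blocks (pcomp q p) \<le> through_blocks q"
  using through_blocks_pcomp_upper[OF dual_partitions dual_partitions, of q l m p k]
  by (simp add: pcomp_dual through_blocks_dual)

section \<open>The projective partitions\<close>

text \<open>Both kinds of projective partitions under one name, so that each later argument is given
  once; \<open>of_bool s\<close> is the surplus of points in a row over through-blocks.\<close>

definition proj :: "nat \<Rightarrow> bool \<Rightarrow> ptn" where
  "proj T s = id_ptn T \<union> (if s then {{Up (T + 1)}, {Low (T + 1)}} else {})"

lemma proj_id: "proj T False = id_ptn T"
  by (simp add: proj_def)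

lemma proj_beta: "proj T True = tensor T T (id_ptn T) beta"
  by (simp add: proj_def tensor_def beta_def)

lemma same_proj:
  "same (proj T s) x y \<longleftrightarrow>
     (\<exists>i \<in> {1..T}. x \<in> {Up i, Low i} \<and> y \<in> {Up i, Low i}) \<or> s \<and> x = y \<and> x \<in> {Up (T + 1), Low (T + 1)}"
  by (auto simp: same_def proj_def id_ptn_def)

lemma proj_partitions: "proj T s \<in> partitions (T + of_bool s) (T + of_bool s)"
  unfolding partitions_def mem_Collect_eq
proof (rule partition_onI)
  show "\<Union>(proj T s) = points (T + of_bool s) (T + of_bool s)"
  proof (rule set_eqI)
    fix x have "x \<in> \<Union>(proj T s) \<longleftrightarrow> same (proj T s) x x" by (auto simp: same_def)
    also have "\<dots> \<longleftrightarrow> x \<in> points (T + of_bool s) (T + of_bool s)"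
      unfolding same_proj by (cases x; cases s) auto
    finally show "x \<in> \<Union>(proj T s) \<longleftrightarrow> x \<in> points (T + of_bool s) (T + of_bool s)" .
  qed
qed (auto simp: proj_def id_ptn_def disjnt_def split: if_splits)

lemma through_blocks_proj: "through_blocks (proj T s) = T"
proof -
  have "thr (proj T s) = (\<lambda>i. {Up i, Low i}) ` {1..T}"
    by (auto simp: thr_def proj_def id_ptn_def)
  moreover have "inj_on (\<lambda>i. {Up i, Low i}) {1..T}"
    by (auto simp: inj_on_def doubleton_eq_iff)
  ultimately show ?thesis by (simp add: through_blocks_thr card_image)
qed

lemma proj_isolated: "s \<Longrightarrow> isolated (proj T s) (Up (T + 1))" "s \<Longrightarrow> isolated (proj T s) (Low (T + 1))"
  by (auto simp: isolated_def same_proj)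

lemma pcomp_proj_left:
  assumes b: "b \<in> partitions k (T + of_bool s)" and s: "s \<Longrightarrow> isolated b (Low (T + 1))"
  shows "pcomp (proj T s) b = b"
proof (rule partition_eqI)
  let ?K = "T + of_bool s"
  show "partition_on (points k ?K) (pcomp (proj T s) b)" "partition_on (points k ?K) b"
    using pcomp_partitions[OF b proj_partitions] b by (simp_all add: partitions_on)
  note trans = partition_same_trans[OF partitions_on[OF b]]
  fix x y assume xy: "x \<in> points k ?K" "y \<in> points k ?K"
  show "same (pcomp (proj T s) b) x y \<longleftrightarrow> same b x y"
  proof
    assume "same (pcomp (proj T s) b) x y"
    then have c: "conn (stack (proj T s) b) (in_outer x) (in_outer y)" by (simp add: same_pcomp)
    \<comment> \<open>Top and middle points carry their class in \<open>b\<close>. The bottom row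
      copies the middle row except for the point \<open>T + 1\<close>, which \<open>proj T s\<close>
      cuts off and which gets the label \<open>Inr ()\<close>.\<close>
    let ?F = "\<lambda>z. case z of Top i \<Rightarrow> Inl {y. same b (Up i) y} | Mid j \<Rightarrow> Inl {y. same b (Low j) y}
       | Bot j \<Rightarrow> if j \<le> T then Inl {y. same b (Low j) y} else Inr ()"
    have cls: "{y. same b u y} = {y. same b v y}" if "same b u v" for u v
      using that trans same_sym by (metis)
    have "?F (in_outer x) = ?F (in_outer y)"
      using c
    proof (rule conn_stack_invariant)
      fix u v assume "same b u v"
      then show "?F (in_upper u) = ?F (in_upper v)" using cls by (cases u; cases v) auto
    next
      fix u v assume "same (proj T s) u v"
      then show "?F (in_lower u) = ?F (in_lower v)" unfolding same_proj by auto
    qed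
    moreover have "x = y" if "?F (in_outer x) = Inr ()" "?F (in_outer y) = Inr ()"
      using that xy by (cases x; cases y; cases s) (auto split: if_splits)
    moreover have "same b x x" "same b y y"
      using xy partition_same_refl[OF partitions_on[OF b]] by auto
    ultimately show "same b x y"
      by (cases x; cases y) (auto split: if_splits simp: set_eq_iff)
  next
    assume xy': "same b x y"
    have *: "conn (stack (proj T s) b) (in_upper z) (in_outer z)"
      if z: "z \<in> points k ?K" "\<not> isolated b z" for z
    proof (cases z)
      case (Up i)
      then show ?thesis
        using conn_stack(1)[OF partition_same_refl[OF partitions_on[OF b] z(1)]] by simp
    next
      case (Low j)
      \<comment> \<open>The only other possibility \<open>j = T + 1\<close> is isolated in
        \<open>b\<close>, contrary to the choice of \<open>z\<close>.\<close>
      then have "j \<in> {1..T}" using z s by (cases s; cases "j \<le> T") (auto simp: le_Suc_eq)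
      then have "same (proj T s) (Up j) (Low j)" by (auto simp: same_proj)
      then show ?thesis using conn_stack(2) Low by fastforce
    qed
    show "same (pcomp (proj T s) b) x y"
    proof (cases "isolated b x")
      case True
      then have "x = y" using xy' by (auto simp: isolated_def)
      then show ?thesis
        using partition_same_refl[OF partitions_on[OF pcomp_partitions[OF b proj_partitions]]] xy by blast
    next
      case False
      moreover from this have "\<not> isolated b y"
        using xy' trans same_sym unfolding isolated_def by metis
      ultimately show ?thesis unfolding same_pcomp
        using * xy conn_stack(1)[OF xy'] conn_trans conn_sym by metis
    qed
  qed
qed

lemma dual_proj: "dual (proj T s) = proj T s"
  by (auto simp: dual_def proj_def id_ptn_def image_Un image_image insert_commute)

lemma pcomp_proj_right:
  assumes "a \<in> partitions (T + of_bool s) l" and "s \<Longrightarrow> isolated a (Up (T + 1))"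
  shows "pcomp a (proj T s) = a"
proof -
  have "dual (pcomp a (proj T s)) = pcomp (proj T s) (dual a)"
    using pcomp_dual[of "proj T s" a] by (simp add: dual_proj)
  also have "\<dots> = dual a"
    using assms by (intro pcomp_proj_left[OF dual_partitions]) (simp_all add: isolated_dual)
  finally show ?thesis by (metis dual_dual)
qed

section \<open>Factorization through the through-blocks\<close>

text \<open>Used with \<open>c\<close> equal to \<open>Up\<close> and to \<open>Low\<close>. Having
  both for one enumeration of the through-blocks is what excludes a non-trivial permutation in the
  middle.\<close>

definition ordered_along :: "(nat \<Rightarrow> pt) \<Rightarrow> nat \<Rightarrow> (nat \<Rightarrow> pt set) \<Rightarrow> bool" where
  "ordered_along c T g \<longleftrightarrow> (\<forall>i i' u u'. 1 \<le> i \<longrightarrow> i < i' \<longrightarrow> i' \<le> T \<longrightarrow> c u \<in> g i \<longrightarrow> c u' \<in> g i' \<longrightarrow> u < u')"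

lemma ordered_alongD:
  "ordered_along c T g \<Longrightarrow> 1 \<le> i \<Longrightarrow> i < i' \<Longrightarrow> i' \<le> T \<Longrightarrow> c u \<in> g i \<Longrightarrow> c u' \<in> g i' \<Longrightarrow> u < u'"
  unfolding ordered_along_def by blast

text \<open>The kernel of this label is the upper half of \<open>p\<close>: lower point
  \<open>j\<close> joins the \<open>j\<close>-th through-block, and the surplus lower point, if
  there is one, gets a label of its own.\<close>

definition upper_label :: "ptn \<Rightarrow> nat \<Rightarrow> (nat \<Rightarrow> pt set) \<Rightarrow> pt \<Rightarrow> pt set + unit" where
  "upper_label p T g x = (case x of Up i \<Rightarrow> Inl {y. same p (Up i) y}
     | Low j \<Rightarrow> if j \<le> T then Inl (g j) else Inr ())"

locale nested_partition =
  fixes k l p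
  assumes p: "p \<in> partitions k l" and nest: "nesting (pos k l) (points k l) (same p)"
begin

lemma thr_in: "B \<in> thr p \<Longrightarrow> x \<in> B \<Longrightarrow> x \<in> points k l"
  using partitions_Union[OF p] by (auto simp: thr_def)

lemma thr_same: "B \<in> thr p \<Longrightarrow> x \<in> B \<Longrightarrow> y \<in> B \<Longrightarrow> same p x y"
  by (auto simp: thr_def same_def)

lemma thr_eq: "B \<in> thr p \<Longrightarrow> B' \<in> thr p \<Longrightarrow> x \<in> B \<Longrightarrow> y \<in> B' \<Longrightarrow> same p x y \<Longrightarrow> B = B'"
  using partitions_block_eq[OF p] by (auto simp: thr_def)

text \<open>Blocks are compared by least upper points. An overlap in the upper row would give the
  crossing \<open>Up u0\<close>, \<open>Up u'\<close>, \<open>Up u\<close>, \<open>Low v\<close>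
  with any lower point \<open>v\<close> of \<open>B'\<close>. As lower points are read backwards, an
  inversion in the lower row would give the crossing \<open>Up u0\<close>, \<open>Up u0'\<close>,
  \<open>Low v\<close>, \<open>Low v'\<close>.\<close>

lemma thr_order:
  assumes B: "B \<in> thr p" "B' \<in> thr p" and u: "Up u0 \<in> B" "Up u0' \<in> B'" "u0 < u0'"
    and min: "\<And>u. Up u \<in> B' \<Longrightarrow> u0' \<le> u"
  shows "Up u \<in> B \<Longrightarrow> Up u' \<in> B' \<Longrightarrow> u < u'" and "Low v \<in> B \<Longrightarrow> Low v' \<in> B' \<Longrightarrow> v < v'"
proof -
  have ne: "B \<noteq> B'" using min[of u0] u by auto
  have n: "\<not> (pos k l a < pos k l b \<and> pos k l b < pos k l c \<and> pos k l c < pos k l d)"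
    if "a \<in> B" "b \<in> B'" "c \<in> B" "d \<in> B'" for a b c d
  proof
    assume "pos k l a < pos k l b \<and> pos k l b < pos k l c \<and> pos k l c < pos k l d"
    then have "same p a b"
      using nest thr_in[OF B(1)] thr_in[OF B(2)] thr_same[OF B(1)] thr_same[OF B(2)] that
      unfolding nesting_def by blast
    then show False using thr_eq B that ne by blast
  qed
  show "u < u'" if uu: "Up u \<in> B" "Up u' \<in> B'"
  proof (rule ccontr)
    assume "\<not> u < u'"
    moreover have "u \<noteq> u'" using uu thr_eq[OF B uu(1)] thr_same[OF B(1)] ne by auto
    moreover obtain v where v: "Low v \<in> B'" using B by (auto simp: thr_def)
    ultimately show False
      using n[OF u(1) uu(2) uu(1) v] min[OF uu(2)] u(3) thr_in[OF B(1) uu(1)] thr_in[OF B(2) v] by auto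
  qed
  show "v < v'" if vv: "Low v \<in> B" "Low v' \<in> B'"
  proof (rule ccontr)
    assume "\<not> v < v'"
    moreover have "v \<noteq> v'" using vv thr_eq[OF B vv(1)] thr_same[OF B(1)] ne by auto
    ultimately show False
      using n[OF u(1,2) vv] u(3) thr_in[OF B(2) u(2)] thr_in[OF B(1) vv(1)] thr_in[OF B(2) vv(2)] by auto
  qed
qed

lemma thr_enumeration:
  obtains g where "inj_on g {1..through_blocks p}" "g ` {1..through_blocks p} = thr p"
    and "ordered_along Up (through_blocks p) g" and "ordered_along Low (through_blocks p) g"
proof -
  define m where "m B = (LEAST u. Up u \<in> B)" for B
  have m: "Up (m B) \<in> B" "\<And>u. Up u \<in> B \<Longrightarrow> m B \<le> u" if B: "B \<in> thr p" for B
  proof -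
    obtain u where "Up u \<in> B" using B by (auto simp: thr_def)
    then show "Up (m B) \<in> B" unfolding m_def by (rule LeastI)
    show "\<And>u. Up u \<in> B \<Longrightarrow> m B \<le> u" unfolding m_def by (rule Least_le)
  qed
  have inj: "inj_on m (thr p)"
  proof (rule inj_onI)
    fix B B' assume B: "B \<in> thr p" "B' \<in> thr p" "m B = m B'"
    then have "Up (m B) \<in> B" "Up (m B) \<in> B'" using m(1)[OF B(1)] m(1)[OF B(2)] by simp_all
    then show "B = B'" using thr_eq[OF B(1,2)] thr_same[OF B(1)] by blast
  qed
  have card: "card (m ` thr p) = through_blocks p" using card_image[OF inj] by (simp add: through_blocks_thr)
  obtain h where h: "bij_betw h {..<through_blocks p} (m ` thr p)" "strict_mono_on {..<through_blocks p} h"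
    using ex_bij_betw_strict_mono_card[of "m ` thr p"] finite_thr[OF p] card by auto
  \<comment> \<open>\<open>h\<close> counts from 0, whereas points of a row count from 1.\<close>
  define g where "g i = inv_into (thr p) m (h (i - 1))" for i
  have sh: "bij_betw (\<lambda>i. i - 1) {1..n} {..<n}" for n :: nat
    by (rule bij_betw_byWitness[where f'=Suc]) auto
  have "bij_betw (inv_into (thr p) m) (m ` thr p) (thr p)"
    by (rule bij_betw_inv_into) (use inj in \<open>simp add: bij_betw_def\<close>)
  then have g: "bij_betw g {1..through_blocks p} (thr p)"
    using bij_betw_trans[OF bij_betw_trans[OF sh h(1)]] by (simp add: g_def[abs_def] comp_def)
  have lt: "m (g i) < m (g i')" if "1 \<le> i" "i < i'" "i' \<le> through_blocks p" for i i'
  proof -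
    have "m (g j) = h (j - 1)" if "1 \<le> j" "j \<le> through_blocks p" for j
      unfolding g_def by (rule f_inv_into_f) (use h(1) that in \<open>auto simp: bij_betw_def\<close>)
    moreover have "i - 1 < i' - 1" "i' - 1 < through_blocks p" using that by auto
    then have "h (i - 1) < h (i' - 1)"
      using strict_mono_onD[OF h(2)] by simp
    ultimately show ?thesis using that by simp
  qed
  have gin: "g i \<in> thr p" if "1 \<le> i" "i \<le> through_blocks p" for i
    using g that by (auto simp: bij_betw_def)
  show ?thesis
  proof (rule that[of g])
    show "inj_on g {1..through_blocks p}" "g ` {1..through_blocks p} = thr p"
      using g by (simp_all add: bij_betw_def)
    have "(Up u \<in> g i \<longrightarrow> Up u' \<in> g i' \<longrightarrow> u < u') \<and> (Low u \<in> g i \<longrightarrow> Low u' \<in> g i' \<longrightarrow> u < u')"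
      if i: "1 \<le> i" "i < i'" "i' \<le> through_blocks p" for i i' u u'
    proof -
      have B: "g i \<in> thr p" "g i' \<in> thr p" using gin i by auto
      show ?thesis
        using thr_order[OF B m(1)[OF B(1)] m(1)[OF B(2)] lt[OF i] m(2)[OF B(2)]] by blast
    qed
    then show "ordered_along Up (through_blocks p) g" "ordered_along Low (through_blocks p) g"
      unfolding ordered_along_def by blast+
  qed
qed

text \<open>A crossing in \<open>b\<close> is traced back to \<open>p\<close>: a chord ending in
  lower point \<open>j\<close> is replaced by one ending in some actual lower point of the
  through-block \<open>g j\<close>, which in both diagrams is read after all upper points. Two
  chords that both reach the lower row are excluded by \<open>order\<close>.\<close>

lemma factor_upper:
  assumes inj: "inj_on g {1..T}" and img: "g ` {1..T} = thr p"
    and order: "ordered_along Up T g"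
    and K: "K = T + of_bool s"
    and b: "b = kernel (points k K) (upper_label p T g)"
  shows "nesting (pos k K) (points k K) (same b)"
    and "pairing (points k l) (same p) \<Longrightarrow> pairing (points k K) (same b)"
    and "s \<Longrightarrow> isolated b (Low (T + 1))"
    and "\<And>i i'. 1 \<le> i \<Longrightarrow> i \<le> k \<Longrightarrow> 1 \<le> i' \<Longrightarrow> i' \<le> k \<Longrightarrow> same b (Up i) (Up i') \<longleftrightarrow> same p (Up i) (Up i')"
    and "\<And>i j. 1 \<le> i \<Longrightarrow> i \<le> k \<Longrightarrow> 1 \<le> j \<Longrightarrow> j \<le> T \<Longrightarrow> same b (Up i) (Low j) \<longleftrightarrow> Up i \<in> g j"
proof -
  have gthr: "g j \<in> thr p" if "1 \<le> j" "j \<le> T" for j using img that by force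
  have ginj: "i = j" if "g i = g j" "1 \<le> i" "i \<le> T" "1 \<le> j" "j \<le> T" for i j
    using inj_onD[OF inj that(1)] that by auto
  have cls: "{y. same p u y} = {y. same p v y} \<longleftrightarrow> same p u v" if "v \<in> points k l" for u v
    using partition_same_trans[OF partitions_on[OF p]] partition_same_refl[OF partitions_on[OF p] that] same_sym
    by (metis mem_Collect_eq Collect_cong)
  have clsg: "{y. same p u y} = g j \<longleftrightarrow> u \<in> g j" if "1 \<le> j" "j \<le> T" "u \<in> points k l" for u j
    using partition_class[OF partitions_on[OF p], of "g j"] gthr[OF that(1,2)]
      partition_same_refl[OF partitions_on[OF p] that(3)] by (auto simp: thr_def)
  show UU: "same b (Up i) (Up i') \<longleftrightarrow> same p (Up i) (Up i')"
    if "1 \<le> i" "i \<le> k" "1 \<le> i'" "i' \<le> k" for i i'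
    using that cls[of "Up i'" "Up i"] by (simp add: b same_kernel upper_label_def)
  show UL: "same b (Up i) (Low j) \<longleftrightarrow> Up i \<in> g j" if "1 \<le> i" "i \<le> k" "1 \<le> j" "j \<le> T" for i j
    using that clsg[of j "Up i"] K by (simp add: b same_kernel upper_label_def)
  have UL': "same b (Up i) (Low j) \<longleftrightarrow> 1 \<le> i \<and> i \<le> k \<and> 1 \<le> j \<and> j \<le> T \<and> Up i \<in> g j" for i j
  proof (cases "1 \<le> i \<and> i \<le> k \<and> 1 \<le> j \<and> j \<le> T")
    case False
    then have "\<not> same b (Up i) (Low j)" by (auto simp: b same_kernel upper_label_def)
    then show ?thesis using False by blast
  qed (use UL in simp)
  have LL: "i = j" if "same b (Low i) (Low j)" for i j
    using that ginj[of i j] K by (cases s) (auto simp: b same_kernel upper_label_def split: if_splits)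
  have in_pts: "x \<in> points k K" "y \<in> points k K" if "same b x y" for x y
    using that by (auto simp: b same_kernel upper_label_def)
  show "isolated b (Low (T + 1))" if s
    unfolding isolated_def
  proof (intro allI impI)
    fix y assume y: "same b (Low (T + 1)) y"
    then show "y = Low (T + 1)" using UL' LL same_sym[OF y] by (cases y) auto
  qed
  show "nesting (pos k K) (points k K) (same b)"
    unfolding nesting_def
  proof (intro ballI impI)
    fix x y z w assume S: "x \<in> points k K" "y \<in> points k K" "z \<in> points k K" "w \<in> points k K"
      and lt: "pos k K x < pos k K y" "pos k K y < pos k K z" "pos k K z < pos k K w"
      and xz: "same b x z" and yw: "same b y w"
    have up: "pos k K u \<le> k \<longleftrightarrow> u \<in> range Up" if "u \<in> points k K" for u
      using that by (cases u) auto
    show "same b x y"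
    proof (cases z)
      case (Low jz)
      then obtain jw where w: "w = Low jw" using up[OF S(3)] up[OF S(4)] lt by (cases w) auto
      have "jw < jz" using lt Low w S by auto
      obtain ix where x: "x = Up ix" using xz Low lt by (cases x) (auto dest: LL)
      obtain iy where y: "y = Up iy" using yw w lt by (cases y) (auto dest: LL)
      \<comment> \<open>The lower ends appear in reversed reading order, so planarity would require
        \<open>ix < iy\<close> and \<open>jz < jw\<close> together; \<open>order\<close> contradicts
        this.\<close>
      have "iy < ix" using ordered_alongD[OF order, of jw jz iy ix] xz yw \<open>jw < jz\<close> UL' unfolding x y w Low by auto
      then show ?thesis using lt x y by simp
    next
      case (Up iz)
      then obtain ix iy where x: "x = Up ix" and y: "y = Up iy"
        using up[OF S(1)] up[OF S(2)] up[OF S(3)] lt by auto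
      have ixz: "same p x z" using xz UU S unfolding x Up by auto
      obtain w' where w': "w' \<in> points k l" "pos k l z < pos k l w'" "same p y w'"
      proof (cases w)
        case w: (Up iw)
        show ?thesis
          by (rule that[of w]) (use w y Up S yw lt UU in auto)
      next
        case (Low jw)
        then have j: "1 \<le> jw" "jw \<le> T" "Up iy \<in> g jw" using yw UL' y by auto
        then obtain v where v: "Low v \<in> g jw" using gthr[of jw] by (auto simp: thr_def)
        then have "Low v \<in> points k l" using thr_in[OF gthr[OF j(1,2)] v] by simp
        moreover from this have "pos k l z < pos k l (Low v)" using Up S(3) by auto
        moreover have "same p y (Low v)" using thr_same[OF gthr[OF j(1,2)]] j v y by simp
        ultimately show ?thesis using that[of "Low v"] by blast
      qed
      have "same p x y"
        using nest S lt w' ixz x y Up unfolding nesting_def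
        by (elim ballE[of _ _ x] ballE[of _ _ y] ballE[of _ _ z] ballE[of _ _ w']) auto
      then show ?thesis using UU S x y by auto
    qed
  qed
  show "pairing (points k K) (same b)" if pair: "pairing (points k l) (same p)"
    unfolding pairing_def
  proof (intro ballI impI)
    fix x y z assume S: "x \<in> points k K" "y \<in> points k K" "z \<in> points k K"
      and xy: "same b x y" and yz: "same b y z"
    have xz: "same b x z" using xy yz by (auto simp: b same_kernel upper_label_def)
    note yx = same_sym[OF xy] and zy = same_sym[OF yz] and zx = same_sym[OF xz]
    \<comment> \<open>The through-block \<open>g j\<close> also has a lower point, so a pairing
      leaves room for a single upper point.\<close>
    have pr: "u = v" if uv: "Up u \<in> g j" "Up v \<in> g j" and j: "1 \<le> j" "j \<le> T" for u v j
    proof -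
      obtain w where w: "Low w \<in> g j" using gthr[OF j] by (auto simp: thr_def)
      have "same p (Up u) (Up v)" "same p (Up v) (Low w)"
        using thr_same[OF gthr[OF j]] uv w by auto
      then have "Up u = Up v \<or> Up v = Low w \<or> Up u = Low w"
        using pair thr_in[OF gthr[OF j]] uv w unfolding pairing_def by blast
      then show ?thesis by simp
    qed
    have UUL: "u = v" if "same b (Up u) (Low j)" "same b (Up v) (Low j)" for u v j
      using that pr[of u j v] by (simp add: UL')
    show "x = y \<or> y = z \<or> x = z"
    proof (cases x; cases y; cases z)
      fix u v w assume *: "x = Up u" "y = Up v" "z = Up w"
      then have "same p x y" "same p y z" "x \<in> points k l" "y \<in> points k l" "z \<in> points k l"
        using UU S xy yz by auto
      then show ?thesis using pair unfolding pairing_def by blast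
    qed (metis LL UUL xy yz xz yx zy zx)+
  qed
qed

end

context planar_category
begin

lemma proj_C: "proj T s \<in> C (T + of_bool s) (T + of_bool s)"
proof -
  let ?K = "T + of_bool s"
  have cases: "\<exists>i \<in> {1..T}. x = Up i \<and> z = Low i"
    if "same (proj T s) x z" "pos ?K ?K x < pos ?K ?K z" for x z
    using that by (auto simp: same_proj)
  have "nesting (pos ?K ?K) (points ?K ?K) (same (proj T s))"
    unfolding nesting_def
  proof (intro ballI impI)
    fix a b c d
    assume lt: "pos ?K ?K a < pos ?K ?K b" "pos ?K ?K b < pos ?K ?K c" "pos ?K ?K c < pos ?K ?K d"
      and "same (proj T s) a c" "same (proj T s) b d"
    then obtain i j where "a = Up i" "c = Low i" "b = Up j" "d = Low j" "i \<in> {1..T}" "j \<in> {1..T}"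
      using cases[of a c] cases[of b d] by auto
    then show "same (proj T s) a b" using lt by auto
  qed
  moreover have "pairing (points ?K ?K) (same (proj T s))"
    by (auto simp: pairing_def same_proj)
  ultimately show ?thesis
    using C_cases proj_partitions[of T s] by (auto simp: NC'_iff NC'_b_iff)
qed

text \<open>\<open>p\<close> is cut across its through-blocks: \<open>b\<close> is its upper half,
  and \<open>a\<close> is the reflected upper half of \<open>dual p\<close>, built from the same
  enumeration of through-blocks. The choice of \<open>s\<close> in \<open>par\<close> gives both
  halves an even number of points, as membership in \<open>C\<close> demands.\<close>

lemma factorization:
  assumes pC: "p \<in> C k l" and T: "T = through_blocks p" and par: "even (k + T + of_bool s)"
  obtains a b where "b \<in> C k (T + of_bool s)" "a \<in> C (T + of_bool s) l"
    "p = pcomp a (pcomp (proj T s) b)"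
proof -
  interpret nested_partition k l p
    by unfold_locales (use pC C_partitions C_nesting in auto)
  let ?K = "T + of_bool s"
  obtain g where g: "inj_on g {1..T}" "g ` {1..T} = thr p"
    "ordered_along Up T g" "ordered_along Low T g"
    using thr_enumeration unfolding T by metis
  define b where "b = kernel (points k ?K) (upper_label p T g)"
  note B = factor_upper[OF g(1,2,3) refl b_def]
  interpret D: nested_partition l k "dual p"
    by unfold_locales (use dual_partitions[OF p] nesting_dual[OF p nest] in auto)
  define h where "h j = flip ` g j" for j
  have h: "inj_on h {1..T}" "h ` {1..T} = thr (dual p)" "ordered_along Up T h"
  proof -
    show "inj_on h {1..T}" by (rule inj_onI) (simp only: h_def flip_image_eq_iff inj_onD[OF g(1)])
    show "h ` {1..T} = thr (dual p)"
      unfolding thr_dual g(2)[symmetric] by (simp add: h_def image_image)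
    show "ordered_along Up T h"
      using g(4) unfolding ordered_along_def h_def flip_vimage by simp
  qed
  define a' where "a' = kernel (points l ?K) (upper_label (dual p) T h)"
  define a where "a = dual a'"
  note A = D.factor_upper[OF h refl a'_def]
  have bp: "b \<in> partitions k ?K" and a'p: "a' \<in> partitions l ?K"
    by (simp_all add: partitions_def a'_def b_def kernel_partition)
  have ap: "a \<in> partitions ?K l" unfolding a_def by (rule dual_partitions[OF a'p])
  have a_nest: "nesting (pos ?K l) (points ?K l) (same a)" unfolding a_def by (rule nesting_dual[OF a'p A(1)])
  have a_pair: "pairing (points ?K l) (same a)" if "pairing (points k l) (same p)"
    unfolding a_def by (rule pairing_dual[OF A(2)[OF pairing_dual[OF that]]])
  have ev: "even (k + ?K)" "even (?K + l)" using C_even[OF pC] par by (cases s; simp)+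
  have bC: "b \<in> C k ?K"
    using C_cases bp B(1,2) ev pC by (auto simp: NC'_iff NC'_b_iff)
  have aC: "a \<in> C ?K l"
    using C_cases ap a_nest a_pair ev pC by (auto simp: NC'_iff NC'_b_iff)
  have "pcomp a b = p"
  proof (rule partition_eqI)
    show "partition_on (points k l) (pcomp a b)" "partition_on (points k l) p"
      using pcomp_partitions[OF bp ap] C_partitions[OF pC] by (simp_all add: partitions_on)
    fix x y assume xy: "x \<in> points k l" "y \<in> points k l"
    note on = partitions_on[OF p]
    have cls: "Collect (same (dual p) z) = flip ` Collect (same p (flip z))" for z
      by (auto simp: same_dual flip_vimage)
    show "same (pcomp a b) x y \<longleftrightarrow> same p x y"
    proof
      \<comment> \<open>Each point is labelled by the block of \<open>p\<close> that it represents;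
        \<open>Inr ()\<close> is the label of the surplus middle point, which is isolated in both
        halves.\<close>
      let ?F = "\<lambda>z. case z of Top i \<Rightarrow> Inl {y. same p (Up i) y}
        | Mid j \<Rightarrow> if j \<le> T then Inl (g j) else Inr () | Bot j \<Rightarrow> Inl {y. same p (Low j) y}"
      assume "same (pcomp a b) x y"
      then have "conn (stack a b) (in_outer x) (in_outer y)" by (simp add: same_pcomp)
      then have "?F (in_outer x) = ?F (in_outer y)"
      proof (rule conn_stack_invariant)
        fix u v assume "same b u v"
        then show "?F (in_upper u) = ?F (in_upper v)" by (cases u; cases v) (auto simp: b_def same_kernel upper_label_def)
      next
        fix u v assume "same a u v"
        then have "upper_label (dual p) T h (flip u) = upper_label (dual p) T h (flip v)"
          by (simp add: a_def a'_def same_dual same_kernel)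
        then show "?F (in_lower u) = ?F (in_lower v)"
          by (cases u; cases v) (auto simp: upper_label_def h_def cls flip_image_eq_iff split: if_splits)
      qed
      then have "{z. same p x z} = {z. same p y z}" by (cases x; cases y) auto
      then show "same p x y" using partition_same_refl[OF on xy(2)] by auto
    next
      have UL: "conn (stack a b) (Top i) (Bot j)"
        if ij: "same p (Up i) (Low j)" for i j
      proof -
        have pts: "Up i \<in> points k l" "Low j \<in> points k l" using partition_same_in[OF on ij] by auto
        obtain Bl where Bl: "Bl \<in> p" "Up i \<in> Bl" "Low j \<in> Bl" using ij by (auto simp: same_def)
        then have "Bl \<in> g ` {1..T}" unfolding g(2) by (auto simp: thr_def)
        then obtain n where n: "Bl = g n" "1 \<le> n" "n \<le> T" by auto
        have "same b (Up i) (Low n)" using B(5)[of i n] n Bl pts by simp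
        moreover have "same a (Up n) (Low j)" 
          using A(5)[of j n] n Bl pts by (simp add: a_def same_dual h_def flip_vimage same_sym)
        ultimately show ?thesis
          using conn_stack(1)[of b "Up i" "Low n" a] conn_stack(2)[of a "Up n" "Low j" b] conn_trans
          by (metis in_upper.simps in_lower.simps)
      qed
      assume s: "same p x y"
      show "same (pcomp a b) x y"
        unfolding same_pcomp
      proof (cases x; cases y)
        fix i i' assume *: "x = Up i" "y = Up i'"
        then have "same b x y" using B(4) xy s by auto
        then show "conn (stack a b) (in_outer x) (in_outer y)"
          using conn_stack(1)[of b x y a] * by simp
      next
        fix i i' assume *: "x = Low i" "y = Low i'"
        then have "same a x y" using A(4) xy s by (auto simp: a_def same_dual)
        then show "conn (stack a b) (in_outer x) (in_outer y)"
          using conn_stack(2)[of a x y b] * by simp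
      next
        fix i j assume "x = Up i" "y = Low j"
        then show "conn (stack a b) (in_outer x) (in_outer y)" using UL s by simp
      next
        fix i j assume "x = Low i" "y = Up j"
        then show "conn (stack a b) (in_outer x) (in_outer y)"
          using UL same_sym[OF s] by (simp add: conn_sym)
      qed
    qed
  qed
  then have "p = pcomp a (pcomp (proj T s) b)"
    using pcomp_proj_left[OF bp] B(3) by simp
  then show ?thesis using that bC aC by blast
qed

text \<open>Choosing an upper and a lower point in each through-block, in order, gives increasing
  maps into \<open>{1..T}\<close> defined on at least \<open>T\<close> indices. Such maps are the
  identity, so the \<open>n\<close>-th through-block contains \<open>Up n\<close> and
  \<open>Low n\<close>. This is the reason why the corner of \<open>proj T s\<close> is
  one-dimensional modulo its ideal.\<close>

lemma proj_unique:
  assumes q: "q \<in> C (T + of_bool s) (T + of_bool s)" and T: "T \<le> through_blocks q"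
    and iso: "s \<Longrightarrow> isolated q (Up (T + 1)) \<and> isolated q (Low (T + 1))"
  shows "q = proj T s"
proof -
  let ?K = "T + of_bool s"
  interpret nested_partition ?K ?K q
    by unfold_locales (use q C_partitions C_nesting in auto)
  let ?N = "through_blocks q"
  obtain g where g: "inj_on g {1..?N}" "g ` {1..?N} = thr q"
    "ordered_along Up ?N g" "ordered_along Low ?N g"
    using thr_enumeration by metis
  have gthr: "g i \<in> thr q" if "1 \<le> i" "i \<le> ?N" for i using g(2) that by force
  have rigid: "h n = n \<and> ?N = T"
    if h: "\<And>i i'. 1 \<le> i \<Longrightarrow> i < i' \<Longrightarrow> i' \<le> ?N \<Longrightarrow> h i < h i'" "\<And>i. 1 \<le> i \<Longrightarrow> i \<le> ?N \<Longrightarrow> 1 \<le> h i \<and> h i \<le> T"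
      and n: "1 \<le> n" "n \<le> ?N" for h :: "nat \<Rightarrow> nat" and n
  proof -
    have le: "h i + (j - i) \<le> h j" if "1 \<le> i" "i \<le> j" "j \<le> ?N" for i j
      using that(2,3)
    proof (induction j rule: dec_induct)
      case (step j)
      then show ?case using h(1)[of j "Suc j"] that(1) by simp
    qed simp
    \<comment> \<open>The growth of \<open>h\<close> above \<open>n\<close> bounds
      \<open>h n\<close> from above and the growth below \<open>n\<close> bounds it from below;
      because of \<open>T \<le> ?N\<close> the two bounds meet.\<close>
    have "h n + (?N - n) \<le> T" using le[of n ?N] h(2)[of ?N] n by simp
    moreover have "h 1 + (n - 1) \<le> h n" using le[of 1 n] n by blast
    moreover have "1 \<le> h 1" using h(2)[of 1] n by simp
    ultimately show ?thesis using T n by arith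
  qed
  define hu hl where "hu n = (SOME u. Up u \<in> g n)" and "hl n = (SOME u. Low u \<in> g n)" for n
  have hu: "Up (hu n) \<in> g n" and hl: "Low (hl n) \<in> g n" if "1 \<le> n" "n \<le> ?N" for n
    using gthr[OF that] unfolding hu_def hl_def thr_def by (auto intro: someI)
  have uniq: "same q (Up (hu n)) (Low (hl n))" if "1 \<le> n" "n \<le> ?N" for n
    using thr_same[OF gthr[OF that] hu[OF that] hl[OF that]] .
  \<comment> \<open>A surplus point is isolated and hence cannot belong to a through-block.\<close>
  have bounds: "1 \<le> hu n \<and> hu n \<le> T" "1 \<le> hl n \<and> hl n \<le> T" if "1 \<le> n" "n \<le> ?N" for n
  proof -
    have pts: "Up (hu n) \<in> points ?K ?K" "Low (hl n) \<in> points ?K ?K"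
      using thr_in[OF gthr[OF that] hu[OF that]] thr_in[OF gthr[OF that] hl[OF that]] by simp_all
    have "hu n \<noteq> T + 1" if s using iso[OF that] uniq[OF \<open>1 \<le> n\<close> \<open>n \<le> ?N\<close>] unfolding isolated_def by auto
    moreover have "hl n \<noteq> T + 1" if s
      using iso[OF that] same_sym[OF uniq[OF \<open>1 \<le> n\<close> \<open>n \<le> ?N\<close>]] unfolding isolated_def by auto
    ultimately show "1 \<le> hu n \<and> hu n \<le> T" "1 \<le> hl n \<and> hl n \<le> T"
      using pts by (cases s; auto simp: le_Suc_eq)+
  qed
  have hu_id: "hu n = n" "?N = T" if "1 \<le> n" "n \<le> ?N" for n
    using rigid[of hu, OF _ bounds(1) that] ordered_alongD[OF g(3)] hu by simp_all
  have hl_id: "hl n = n" if "1 \<le> n" "n \<le> ?N" for n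
    using rigid[of hl, OF _ bounds(2) that] ordered_alongD[OF g(4)] hl by simp
  have in_g: "Up n \<in> g n" "Low n \<in> g n" if "n \<in> {1..T}" for n
    using hu[of n] hl[of n] hu_id[of n] hl_id[of n] that T by auto
  show ?thesis
  proof (rule partition_eqI)
    show "partition_on (points ?K ?K) q" "partition_on (points ?K ?K) (proj T s)"
      using C_partitions[OF q] proj_partitions[of T s] by (simp_all add: partitions_on)
    fix x y assume xy: "x \<in> points ?K ?K" "y \<in> points ?K ?K"
    have cases: "(\<exists>n \<in> {1..T}. z \<in> {Up n, Low n}) \<or> s \<and> z \<in> {Up (T + 1), Low (T + 1)}"
      if "z \<in> points ?K ?K" for z
      using that by (cases z; cases s) (auto simp: le_Suc_eq)
    show "same q x y \<longleftrightarrow> same (proj T s) x y"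
    proof
      assume s: "same q x y"
      show "same (proj T s) x y"
      proof (cases "s \<and> (x \<in> {Up (T + 1), Low (T + 1)} \<or> y \<in> {Up (T + 1), Low (T + 1)})")
        case True
        then have "x = y" using iso s same_sym[OF s] unfolding isolated_def by auto
        then show ?thesis using True by (auto simp: same_proj)
      next
        case False
        then obtain n n' where n: "n \<in> {1..T}" "x \<in> {Up n, Low n}" "n' \<in> {1..T}" "y \<in> {Up n', Low n'}"
          using cases[OF xy(1)] cases[OF xy(2)] by blast
        then have "x \<in> g n" "y \<in> g n'" using in_g by auto
        then have "g n = g n'" using thr_eq[of "g n" "g n'" x y] gthr n s T by auto
        then have "n = n'" using inj_onD[OF g(1)] n T by auto
        then show ?thesis using n by (auto simp: same_proj)
      qed
    next
      assume "same (proj T s) x y"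
      then consider n where "n \<in> {1..T}" "x \<in> {Up n, Low n}" "y \<in> {Up n, Low n}" | "x = y"
        unfolding same_proj by blast
      then show "same q x y"
      proof cases
        case 1
        then have "x \<in> g n" "y \<in> g n" using in_g by auto
        moreover have "g n \<in> thr q" using gthr[of n] 1 T by simp
        ultimately show ?thesis using thr_same by blast
      next
        case 2
        then show ?thesis using partition_same_refl[OF partitions_on[OF C_partitions[OF q]]] xy by auto
      qed
    qed
  qed
qed

end

section \<open>Algebras with trivial idempotents\<close>

text \<open>Carrier and unit are explicit because the algebra in question is the endomorphism ring
  of one object: a subset of a type of matrices whose unit is the idempotent defining the
  object.\<close>

locale unital_algebra = module scale
  for scale :: "complex \<Rightarrow> 'm::ab_group_add \<Rightarrow> 'm" +
  fixes R :: "'m set" and mult :: "'m \<Rightarrow> 'm \<Rightarrow> 'm" (infixl "\<bullet>" 70) and one :: 'm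
  assumes zero_in: "0 \<in> R" and one_in: "one \<in> R"
    and add_in: "x \<in> R \<Longrightarrow> y \<in> R \<Longrightarrow> x + y \<in> R"
    and scale_in: "x \<in> R \<Longrightarrow> scale c x \<in> R"
    and mult_in: "x \<in> R \<Longrightarrow> y \<in> R \<Longrightarrow> x \<bullet> y \<in> R"
    and mult_assoc: "x \<in> R \<Longrightarrow> y \<in> R \<Longrightarrow> z \<in> R \<Longrightarrow> (x \<bullet> y) \<bullet> z = x \<bullet> (y \<bullet> z)"
    and one_mult: "x \<in> R \<Longrightarrow> one \<bullet> x = x" and mult_one: "x \<in> R \<Longrightarrow> x \<bullet> one = x"
    and mult_add_left: "x \<in> R \<Longrightarrow> y \<in> R \<Longrightarrow> z \<in> R \<Longrightarrow> (x + y) \<bullet> z = x \<bullet> z + y \<bullet> z"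
    and mult_add_right: "x \<in> R \<Longrightarrow> y \<in> R \<Longrightarrow> z \<in> R \<Longrightarrow> x \<bullet> (y + z) = x \<bullet> y + x \<bullet> z"
    and mult_scale_left: "x \<in> R \<Longrightarrow> y \<in> R \<Longrightarrow> scale c x \<bullet> y = scale c (x \<bullet> y)"
    and mult_scale_right: "x \<in> R \<Longrightarrow> y \<in> R \<Longrightarrow> x \<bullet> scale c y = scale c (x \<bullet> y)"
begin

lemma uminus_in: "x \<in> R \<Longrightarrow> - x \<in> R"
  using scale_in[of x "-1"] by simp

lemma diff_in: "x \<in> R \<Longrightarrow> y \<in> R \<Longrightarrow> x - y \<in> R"
  using add_in[of x "- y"] uminus_in[of y] by simp

lemma sum_in: "(\<And>i. i \<in> I \<Longrightarrow> f i \<in> R) \<Longrightarrow> sum f I \<in> R"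
  by (induction I rule: infinite_finite_induct) (auto simp: zero_in add_in)

lemma mult_zero_left: "x \<in> R \<Longrightarrow> 0 \<bullet> x = 0"
  using mult_add_left[of 0 0 x] zero_in by simp

lemma mult_zero_right: "x \<in> R \<Longrightarrow> x \<bullet> 0 = 0"
  using mult_add_right[of x 0 0] zero_in by simp

lemma mult_diff_right: "x \<in> R \<Longrightarrow> y \<in> R \<Longrightarrow> z \<in> R \<Longrightarrow> x \<bullet> (y - z) = x \<bullet> y - x \<bullet> z"
  using mult_add_right[of x "y - z" z] diff_in[of y z] by (simp add: algebra_simps)

lemma mult_sum_right:
  "x \<in> R \<Longrightarrow> (\<And>i. i \<in> I \<Longrightarrow> f i \<in> R) \<Longrightarrow> x \<bullet> sum f I = (\<Sum>i\<in>I. x \<bullet> f i)"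
  by (induction I rule: infinite_finite_induct) (auto simp: mult_zero_right mult_add_right sum_in)

lemma mult_sum_left:
  "x \<in> R \<Longrightarrow> (\<And>i. i \<in> I \<Longrightarrow> f i \<in> R) \<Longrightarrow> sum f I \<bullet> x = (\<Sum>i\<in>I. f i \<bullet> x)"
  by (induction I rule: infinite_finite_induct) (auto simp: mult_zero_left mult_add_left sum_in)

definition pow :: "'m \<Rightarrow> nat \<Rightarrow> 'm" where
  "pow x n = (mult x ^^ n) one"

lemma pow_0: "pow x 0 = one" and pow_Suc: "pow x (Suc n) = x \<bullet> pow x n"
  by (simp_all add: pow_def)

lemma pow_in: "x \<in> R \<Longrightarrow> pow x n \<in> R"
  by (induction n) (auto simp: pow_0 pow_Suc one_in mult_in)

lemma pow_commute: "x \<in> R \<Longrightarrow> y \<in> R \<Longrightarrow> x \<bullet> y = y \<bullet> x \<Longrightarrow> pow x n \<bullet> y = y \<bullet> pow x n"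
proof (induction n)
  case (Suc n)
  have "pow x (Suc n) \<bullet> y = x \<bullet> (y \<bullet> pow x n)"
    using Suc by (simp add: pow_Suc mult_assoc pow_in)
  also have "\<dots> = y \<bullet> pow x (Suc n)"
    using Suc.prems mult_assoc[of x y "pow x n"] mult_assoc[of y x "pow x n"] by (simp add: pow_Suc pow_in)
  finally show ?case .
qed (simp add: pow_0 one_mult mult_one)

lemma pow_add: "x \<in> R \<Longrightarrow> pow x (m + n) = pow x m \<bullet> pow x n"
  by (induction m) (auto simp: pow_0 pow_Suc one_mult mult_assoc pow_in)

lemma pow_mult:
  assumes "x \<in> R" "y \<in> R" "x \<bullet> y = y \<bullet> x"
  shows "pow (x \<bullet> y) n = pow x n \<bullet> pow y n"
proof (induction n)
  case (Suc n)
  have "pow (x \<bullet> y) (Suc n) = x \<bullet> (y \<bullet> (pow x n \<bullet> pow y n))"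
    using Suc assms(1,2) by (simp add: pow_Suc mult_assoc pow_in mult_in)
  also have "y \<bullet> (pow x n \<bullet> pow y n) = (pow x n \<bullet> y) \<bullet> pow y n"
    using assms pow_commute[of x y n] mult_assoc[of y "pow x n" "pow y n"] by (simp add: pow_in)
  finally show ?case using assms by (simp add: pow_Suc mult_assoc pow_in mult_in)
qed (simp add: pow_0 one_mult one_in)

lemma geometric:
  assumes "x \<in> R"
  shows "(\<Sum>i<n. pow x i) \<bullet> (one - x) = one - pow x n"
proof -
  have "pow x i \<bullet> (one - x) = pow x i - pow x (Suc i)" for i
    using assms pow_commute[of x x i] by (simp add: mult_diff_right pow_in one_in mult_one pow_Suc)
  then have "(\<Sum>i<n. pow x i) \<bullet> (one - x) = (\<Sum>i<n. pow x i - pow x (Suc i))"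
    using assms by (subst mult_sum_left) (auto simp: diff_in one_in pow_in)
  also have "\<dots> = one - pow x n"
    by (subst sum_lessThan_telescope') (simp add: pow_0)
  finally show ?thesis .
qed

text \<open>The lowest power of \<open>a\<close> in a linear relation is a multiple of the next one, so some power of
  \<open>a\<close> is cut out by an idempotent.\<close>

lemma power_regular:
  assumes a: "a \<in> R" and c: "j0 \<le> N" "c j0 \<noteq> 0" and rel: "(\<Sum>j\<le>N. scale (c j) (pow a j)) = 0"
  obtains n w where "w \<in> R" "a \<bullet> w = w \<bullet> a" "pow a n = pow a n \<bullet> (a \<bullet> w)"
proof -
  define n where "n = (LEAST j. c j \<noteq> 0)"
  have n: "c n \<noteq> 0" "n \<le> N" and below: "\<And>j. j < n \<Longrightarrow> c j = 0"
  proof -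
    show "c n \<noteq> 0" unfolding n_def using c(2) by (rule LeastI)
    have "n \<le> j0" unfolding n_def using c(2) by (rule Least_le)
    then show "n \<le> N" using c(1) by simp
    show "\<And>j. j < n \<Longrightarrow> c j = 0" unfolding n_def using not_less_Least by blast
  qed
  \<comment> \<open>The terms of the relation above degree \<open>n\<close>, divided by the power
    \<open>n + 1\<close> of \<open>a\<close>. After normalisation the relation reads
    \<open>pow a n = pow a (Suc n) \<bullet> w\<close>.\<close>
  define s where "s = (\<Sum>j\<in>{n<..N}. scale (c j) (pow a (j - Suc n)))"
  define w where "w = scale (- inverse (c n)) s"
  have s: "s \<in> R" unfolding s_def using a by (intro sum_in scale_in pow_in)
  have w: "w \<in> R" unfolding w_def using s by (rule scale_in)
  have comm: "a \<bullet> s = s \<bullet> a"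
    unfolding s_def using a pow_commute[of a a]
    by (simp add: mult_sum_left mult_sum_right scale_in pow_in mult_scale_left mult_scale_right)
  have "(\<Sum>j\<le>N. scale (c j) (pow a j)) = (\<Sum>j\<in>{n..N}. scale (c j) (pow a j))"
    by (rule sum.mono_neutral_right) (use below in auto)
  also have "{n..N} = insert n {n<..N}" using n by auto
  also have "(\<Sum>j\<in>insert n {n<..N}. scale (c j) (pow a j))
      = scale (c n) (pow a n) + (\<Sum>j\<in>{n<..N}. scale (c j) (pow a j))" by simp
  also have "(\<Sum>j\<in>{n<..N}. scale (c j) (pow a j)) = (\<Sum>j\<in>{n<..N}. pow a (Suc n) \<bullet> scale (c j) (pow a (j - Suc n)))"
  proof (rule sum.cong)
    fix j assume "j \<in> {n<..N}"
    then show "scale (c j) (pow a j) = pow a (Suc n) \<bullet> scale (c j) (pow a (j - Suc n))"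
      using pow_add[OF a, of "Suc n" "j - Suc n"] a by (simp add: mult_scale_right pow_in)
  qed simp
  also have "\<dots> = pow a (Suc n) \<bullet> s"
    unfolding s_def using a by (subst mult_sum_right) (auto simp: pow_in scale_in)
  finally have "scale (c n) (pow a n) + pow a (Suc n) \<bullet> s = 0" using rel by simp
  then have "scale (c n) (pow a n) = - (pow a (Suc n) \<bullet> s)" by (simp add: eq_neg_iff_add_eq_0)
  then have "scale (inverse (c n)) (scale (c n) (pow a n)) = scale (inverse (c n)) (- (pow a (Suc n) \<bullet> s))" by simp
  then have "pow a n = pow a (Suc n) \<bullet> w"
    using n mult_scale_right[OF pow_in[OF a] s, of "Suc n" "- inverse (c n)"] by (simp add: w_def)
  also have "\<dots> = pow a n \<bullet> (a \<bullet> w)"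
    using a pow_commute[of a a n] w by (simp add: pow_Suc mult_assoc[symmetric] pow_in)
  finally have "pow a n = pow a n \<bullet> (a \<bullet> w)" .
  moreover have "a \<bullet> w = w \<bullet> a"
    unfolding w_def mult_scale_left[OF s a] mult_scale_right[OF a s] comm ..
  ultimately show ?thesis using that w by blast
qed

text \<open>Fitting's lemma. With \<open>w\<close> from \<open>power_regular\<close> and
  \<open>y = a \<bullet> w\<close>, the power \<open>pow y n\<close> is idempotent and acts as a
  unit on \<open>pow a n\<close>. If it vanishes then \<open>a\<close> is nilpotent and the
  geometric series inverts \<open>b = one - a\<close>; if it is \<open>one\<close> then
  \<open>a\<close> itself has a left inverse.\<close>

lemma left_inverse_of_sum_one:
  assumes idem: "\<And>e. e \<in> R \<Longrightarrow> e \<bullet> e = e \<Longrightarrow> e = 0 \<or> e = one"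
    and dep: "\<And>v :: nat \<Rightarrow> 'm. (\<And>j. v j \<in> R) \<Longrightarrow>
      \<exists>c N. (\<exists>j\<le>N. c j \<noteq> 0) \<and> (\<Sum>j\<le>N. scale (c j) (v j)) = 0"
    and ab: "a \<in> R" "b \<in> R" "a + b = one"
  shows "\<exists>z \<in> R. z \<bullet> a = one \<or> z \<bullet> b = one"
proof -
  note a = ab(1)
  obtain c N j0 where "j0 \<le> N" "c j0 \<noteq> 0" "(\<Sum>j\<le>N. scale (c j) (pow a j)) = 0"
    using dep[of "pow a"] pow_in[OF a] by blast
  then obtain n w where w: "w \<in> R" "a \<bullet> w = w \<bullet> a" "pow a n = pow a n \<bullet> (a \<bullet> w)"
    using power_regular[OF a, of j0 N c] by blast
  define y where "y = a \<bullet> w"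
  have y: "y \<in> R" using a w by (simp add: y_def mult_in)
  have ay: "pow a n \<bullet> pow y m = pow a n" for m
  proof (induction m)
    case (Suc m)
    then show ?case using w(3) y a
      by (simp add: pow_Suc y_def[symmetric] mult_assoc[symmetric] pow_in)
  qed (simp add: pow_0 mult_one pow_in a)
  have yn: "pow y n = pow a n \<bullet> pow w n" unfolding y_def using a w by (intro pow_mult)
  have wa: "pow w n \<bullet> pow a n = pow a n \<bullet> pow w n"
  proof (rule pow_commute)
    show "w \<bullet> pow a n = pow a n \<bullet> w" using pow_commute[OF a w(1,2), of n] by simp
  qed (use a w in \<open>simp_all add: pow_in\<close>)
  have "pow y n \<bullet> pow y n = (pow w n \<bullet> pow a n) \<bullet> pow y n" by (simp add: yn wa)
  also have "\<dots> = pow w n \<bullet> pow a n" using ay[of n] a w y by (simp add: mult_assoc pow_in)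
  also have "\<dots> = pow y n" by (simp add: yn wa)
  finally have "pow y n = 0 \<or> pow y n = one" using idem pow_in[OF y] by blast
  then show ?thesis
  proof
    assume "pow y n = 0"
    then have "pow a n = 0" using ay[of n] a by (simp add: mult_zero_right pow_in)
    moreover have "b = one - a" using ab by (simp add: algebra_simps)
    ultimately have "(\<Sum>i<n. pow a i) \<bullet> b = one" using geometric[OF a, of n] by simp
    moreover have "(\<Sum>i<n. pow a i) \<in> R" using a by (intro sum_in pow_in)
    ultimately show ?thesis by blast
  next
    assume 1: "pow y n = one"
    show ?thesis
    proof (cases n)
      \<comment> \<open>Here \<open>pow y n = one\<close> carries no information, but the regularity
        relation itself reads \<open>one = a \<bullet> w\<close>.\<close>
      case 0
      then have "w \<bullet> a = one" using w a by (simp add: pow_0 one_mult mult_in)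
      then show ?thesis using w by blast
    next
      case (Suc m)
      have "(pow w n \<bullet> pow a m) \<bullet> a = pow w n \<bullet> pow a n"
        using a w pow_commute[of a a m] by (simp add: Suc pow_Suc mult_assoc pow_in mult_in)
      then have "(pow w n \<bullet> pow a m) \<bullet> a = one" using 1 wa yn by simp
      moreover have "pow w n \<bullet> pow a m \<in> R" using a w by (simp add: mult_in pow_in)
      ultimately show ?thesis by blast
    qed
  qed
qed

text \<open>The factor \<open>z\<close> makes the induction work: if the first summand has no left
  inverse, the left inverse of \<open>z \<bullet> sum x I\<close> is absorbed into a new
  \<open>z\<close> for the shorter sum.\<close>

lemma left_inverse_of_sum:
  assumes idem: "\<And>e. e \<in> R \<Longrightarrow> e \<bullet> e = e \<Longrightarrow> e = 0 \<or> e = one"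
    and dep: "\<And>v :: nat \<Rightarrow> 'm. (\<And>j. v j \<in> R) \<Longrightarrow>
      \<exists>c N. (\<exists>j\<le>N. c j \<noteq> 0) \<and> (\<Sum>j\<le>N. scale (c j) (v j)) = 0"
    and nonzero: "one \<noteq> 0"
    and "finite I" "\<And>i. i \<in> I \<Longrightarrow> x i \<in> R" "z \<in> R" "z \<bullet> sum x I = one"
  shows "\<exists>i \<in> I. \<exists>z \<in> R. z \<bullet> x i = one"
  using assms(4-7)
proof (induction I arbitrary: z rule: finite_induct)
  case empty
  then show ?case using nonzero by (simp add: mult_zero_right)
next
  case (insert i I)
  have x: "x i \<in> R" "sum x I \<in> R" using insert.prems by (auto intro: sum_in)
  have "z \<bullet> x i + z \<bullet> sum x I = one"
    using insert x by (simp add: mult_add_right)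
  then obtain u where u: "u \<in> R" "u \<bullet> (z \<bullet> x i) = one \<or> u \<bullet> (z \<bullet> sum x I) = one"
    using left_inverse_of_sum_one[OF idem dep] insert.prems x by (metis mult_in)
  then have "(u \<bullet> z) \<bullet> x i = one \<or> (u \<bullet> z) \<bullet> sum x I = one"
    using insert.prems x by (simp add: mult_assoc)
  moreover have "u \<bullet> z \<in> R" using u insert.prems by (simp add: mult_in)
  ultimately show ?case using insert.IH[of "u \<bullet> z"] insert.prems by blast
qed

end

section \<open>Preadditive categories\<close>

locale preadd_category =
  fixes A :: "('o, 'm::ab_group_add) preadd_cat"
  assumes zero_Hom: "X \<in> Obj A \<Longrightarrow> Y \<in> Obj A \<Longrightarrow> 0 \<in> Hom A X Y"
    and add_Hom: "X \<in> Obj A \<Longrightarrow> Y \<in> Obj A \<Longrightarrow> f \<in> Hom A X Y \<Longrightarrow> g \<in> Hom A X Y \<Longrightarrow> f + g \<in> Hom A X Y"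
    and uminus_Hom: "X \<in> Obj A \<Longrightarrow> Y \<in> Obj A \<Longrightarrow> f \<in> Hom A X Y \<Longrightarrow> - f \<in> Hom A X Y"
    and Comp_Hom: "X \<in> Obj A \<Longrightarrow> Y \<in> Obj A \<Longrightarrow> Z \<in> Obj A \<Longrightarrow>
      f \<in> Hom A X Y \<Longrightarrow> g \<in> Hom A Y Z \<Longrightarrow> Comp A X Y Z g f \<in> Hom A X Z"
    and Comp_assoc: "W \<in> Obj A \<Longrightarrow> X \<in> Obj A \<Longrightarrow> Y \<in> Obj A \<Longrightarrow> Z \<in> Obj A \<Longrightarrow>
      f \<in> Hom A W X \<Longrightarrow> g \<in> Hom A X Y \<Longrightarrow> h \<in> Hom A Y Z \<Longrightarrow>
      Comp A W X Z (Comp A X Y Z h g) f = Comp A W Y Z h (Comp A W X Y g f)"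
    and Ident_Hom: "X \<in> Obj A \<Longrightarrow> Ident A X \<in> Hom A X X"
    and Comp_Ident_left: "X \<in> Obj A \<Longrightarrow> Y \<in> Obj A \<Longrightarrow> f \<in> Hom A X Y \<Longrightarrow> Comp A X Y Y (Ident A Y) f = f"
    and Comp_Ident_right: "X \<in> Obj A \<Longrightarrow> Y \<in> Obj A \<Longrightarrow> f \<in> Hom A X Y \<Longrightarrow> Comp A X X Y f (Ident A X) = f"
    and Comp_add_left: "X \<in> Obj A \<Longrightarrow> Y \<in> Obj A \<Longrightarrow> Z \<in> Obj A \<Longrightarrow>
      f \<in> Hom A X Y \<Longrightarrow> g \<in> Hom A Y Z \<Longrightarrow> g' \<in> Hom A Y Z \<Longrightarrow>
      Comp A X Y Z (g + g') f = Comp A X Y Z g f + Comp A X Y Z g' f"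
    and Comp_add_right: "X \<in> Obj A \<Longrightarrow> Y \<in> Obj A \<Longrightarrow> Z \<in> Obj A \<Longrightarrow>
      f \<in> Hom A X Y \<Longrightarrow> f' \<in> Hom A X Y \<Longrightarrow> g \<in> Hom A Y Z \<Longrightarrow>
      Comp A X Y Z g (f + f') = Comp A X Y Z g f + Comp A X Y Z g f'"
begin

lemma diff_Hom: "X \<in> Obj A \<Longrightarrow> Y \<in> Obj A \<Longrightarrow> f \<in> Hom A X Y \<Longrightarrow> g \<in> Hom A X Y \<Longrightarrow> f - g \<in> Hom A X Y"
  using add_Hom[of X Y f "- g"] uminus_Hom[of X Y g] by simp

lemma sum_Hom:
  "X \<in> Obj A \<Longrightarrow> Y \<in> Obj A \<Longrightarrow> (\<And>i. i \<in> I \<Longrightarrow> f i \<in> Hom A X Y) \<Longrightarrow> sum f I \<in> Hom A X Y"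
  by (induction I rule: infinite_finite_induct) (auto simp: zero_Hom add_Hom)

lemma Comp_zero_left:
  "X \<in> Obj A \<Longrightarrow> Y \<in> Obj A \<Longrightarrow> Z \<in> Obj A \<Longrightarrow> f \<in> Hom A X Y \<Longrightarrow> Comp A X Y Z 0 f = 0"
  using Comp_add_left[of X Y Z f 0 0] zero_Hom[of Y Z] by simp

lemma Comp_zero_right:
  "X \<in> Obj A \<Longrightarrow> Y \<in> Obj A \<Longrightarrow> Z \<in> Obj A \<Longrightarrow> g \<in> Hom A Y Z \<Longrightarrow> Comp A X Y Z g 0 = 0"
  using Comp_add_right[of X Y Z 0 0 g] zero_Hom[of X Y] by simp

lemma Comp_diff_left: "X \<in> Obj A \<Longrightarrow> Y \<in> Obj A \<Longrightarrow> Z \<in> Obj A \<Longrightarrow>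
    f \<in> Hom A X Y \<Longrightarrow> g \<in> Hom A Y Z \<Longrightarrow> g' \<in> Hom A Y Z \<Longrightarrow>
    Comp A X Y Z (g - g') f = Comp A X Y Z g f - Comp A X Y Z g' f"
  using Comp_add_left[of X Y Z f "g - g'" g'] diff_Hom[of Y Z g g'] by (simp add: algebra_simps)

lemma Comp_diff_right: "X \<in> Obj A \<Longrightarrow> Y \<in> Obj A \<Longrightarrow> Z \<in> Obj A \<Longrightarrow>
    f \<in> Hom A X Y \<Longrightarrow> f' \<in> Hom A X Y \<Longrightarrow> g \<in> Hom A Y Z \<Longrightarrow>
    Comp A X Y Z g (f - f') = Comp A X Y Z g f - Comp A X Y Z g f'"
  using Comp_add_right[of X Y Z "f - f'" f' g] diff_Hom[of X Y f f'] by (simp add: algebra_simps)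

lemma Comp_sum_left: "X \<in> Obj A \<Longrightarrow> Y \<in> Obj A \<Longrightarrow> Z \<in> Obj A \<Longrightarrow>
    f \<in> Hom A X Y \<Longrightarrow> (\<And>i. i \<in> I \<Longrightarrow> g i \<in> Hom A Y Z) \<Longrightarrow>
    Comp A X Y Z (sum g I) f = (\<Sum>i\<in>I. Comp A X Y Z (g i) f)"
  by (induction I rule: infinite_finite_induct) (auto simp: Comp_zero_left Comp_add_left sum_Hom)

lemma Comp_sum_right: "X \<in> Obj A \<Longrightarrow> Y \<in> Obj A \<Longrightarrow> Z \<in> Obj A \<Longrightarrow>
    (\<And>i. i \<in> I \<Longrightarrow> f i \<in> Hom A X Y) \<Longrightarrow> g \<in> Hom A Y Z \<Longrightarrow>
    Comp A X Y Z g (sum f I) = (\<Sum>i\<in>I. Comp A X Y Z g (f i))"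
  by (induction I rule: infinite_finite_induct) (auto simp: Comp_zero_right Comp_add_right sum_Hom)

definition retract :: "'o \<Rightarrow> 'o \<Rightarrow> bool" where
  "retract X Y \<longleftrightarrow> (\<exists>i \<in> Hom A X Y. \<exists>r \<in> Hom A Y X. Comp A X Y X r i = Ident A X)"

text \<open>Indecomposability expressed inside one endomorphism ring. It implies
  \<open>indecomposable\<close> in general, and the converse holds in an idempotent completion, see
  \<open>indecomposable_connected\<close>.\<close>

definition connected_end :: "'o \<Rightarrow> bool" where
  "connected_end X \<longleftrightarrow> X \<in> Obj A \<and> Ident A X \<noteq> 0 \<and>
     (\<forall>e \<in> Hom A X X. Comp A X X X e e = e \<longrightarrow> e = 0 \<or> e = Ident A X)"

lemma retract_trans:
  assumes O: "X \<in> Obj A" "Y \<in> Obj A" "Z \<in> Obj A" and "retract X Y" "retract Y Z"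
  shows "retract X Z"
proof -
  obtain i r j s where i: "i \<in> Hom A X Y" "r \<in> Hom A Y X" "Comp A X Y X r i = Ident A X"
    "j \<in> Hom A Y Z" "s \<in> Hom A Z Y" "Comp A Y Z Y s j = Ident A Y"
    using assms unfolding retract_def by blast
  have "Comp A X Z X (Comp A Z Y X r s) (Comp A X Y Z j i) = Comp A X Y X r (Comp A X Z Y s (Comp A X Y Z j i))"
    using O i by (simp add: Comp_assoc Comp_Hom)
  also have "Comp A X Z Y s (Comp A X Y Z j i) = i"
    using O i by (simp add: Comp_assoc[symmetric] Comp_Ident_left)
  finally have "Comp A X Z X (Comp A Z Y X r s) (Comp A X Y Z j i) = Ident A X" using i by simp
  then show ?thesis unfolding retract_def using Comp_Hom O i by blast
qed

lemma isomorphic_retract: "isomorphic A X Y \<Longrightarrow> retract X Y"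
  unfolding isomorphic_def retract_def by blast

lemma isomorphic_refl: "X \<in> Obj A \<Longrightarrow> isomorphic A X X"
  unfolding isomorphic_def using Ident_Hom Comp_Ident_left by blast

lemma isomorphic_sym: "isomorphic A X Y \<Longrightarrow> isomorphic A Y X"
  unfolding isomorphic_def by blast

lemma isomorphic_trans:
  assumes O: "X \<in> Obj A" "Y \<in> Obj A" "Z \<in> Obj A" and "isomorphic A X Y" "isomorphic A Y Z"
  shows "isomorphic A X Z"
proof -
  obtain i r j s where i: "i \<in> Hom A X Y" "r \<in> Hom A Y X" "Comp A X Y X r i = Ident A X" "Comp A Y X Y i r = Ident A Y"
    "j \<in> Hom A Y Z" "s \<in> Hom A Z Y" "Comp A Y Z Y s j = Ident A Y" "Comp A Z Y Z j s = Ident A Z"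
    using assms unfolding isomorphic_def by blast
  have "Comp A X Z X (Comp A Z Y X r s) (Comp A X Y Z j i) = Comp A X Y X r (Comp A X Z Y s (Comp A X Y Z j i))"
    using O i by (simp add: Comp_assoc Comp_Hom)
  also have "Comp A X Z Y s (Comp A X Y Z j i) = i"
    using O i by (simp add: Comp_assoc[symmetric] Comp_Ident_left)
  finally have 1: "Comp A X Z X (Comp A Z Y X r s) (Comp A X Y Z j i) = Ident A X" using i by simp
  have "Comp A Z X Z (Comp A X Y Z j i) (Comp A Z Y X r s) = Comp A Z Y Z j (Comp A Z X Y i (Comp A Z Y X r s))"
    using O i by (simp add: Comp_assoc Comp_Hom)
  also have "Comp A Z X Y i (Comp A Z Y X r s) = s"
    using O i by (simp add: Comp_assoc[symmetric] Comp_Ident_left)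
  finally have "Comp A Z X Z (Comp A X Y Z j i) (Comp A Z Y X r s) = Ident A Z" using i by simp
  then show ?thesis unfolding isomorphic_def using 1 Comp_Hom O i by blast
qed

lemma iso_class_eq_iff:
  assumes "X \<in> Obj A" "Y \<in> Obj A"
  shows "iso_class A X = iso_class A Y \<longleftrightarrow> isomorphic A X Y"
proof
  assume "iso_class A X = iso_class A Y"
  moreover have "Y \<in> iso_class A Y" using assms isomorphic_refl by (simp add: iso_class_def)
  ultimately show "isomorphic A X Y" by (auto simp: iso_class_def)
next
  have *: "iso_class A V \<subseteq> iso_class A U" if "U \<in> Obj A" "V \<in> Obj A" "isomorphic A U V" for U V
    using that isomorphic_trans[of U V] unfolding iso_class_def by blast
  assume "isomorphic A X Y"
  then show "iso_class A X = iso_class A Y"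
    using *[of X Y] *[of Y X] assms isomorphic_sym by blast
qed

text \<open>The composite \<open>?e\<close> of retraction and inclusion is an idempotent of
  \<open>Y\<close>. If it were 0, then \<open>r = r ?e\<close> would vanish and with it the identity
  of \<open>X\<close>; hence it is the identity of \<open>Y\<close>.\<close>

lemma retract_connected_isomorphic:
  assumes X: "X \<in> Obj A" "Ident A X \<noteq> 0" and Y: "connected_end Y" and "retract X Y"
  shows "isomorphic A X Y"
proof -
  have O: "X \<in> Obj A" "Y \<in> Obj A" using X Y by (auto simp: connected_end_def)
  obtain i r where i: "i \<in> Hom A X Y" "r \<in> Hom A Y X" "Comp A X Y X r i = Ident A X"
    using assms unfolding retract_def by blast
  let ?e = "Comp A Y X Y i r"
  have e: "?e \<in> Hom A Y Y" using O i by (simp add: Comp_Hom)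
  have re: "Comp A Y Y X r ?e = r"
    using O i by (simp add: Comp_assoc[symmetric] Comp_Ident_left)
  have "Comp A Y Y Y ?e ?e = ?e"
    using O i e re by (simp add: Comp_assoc)
  then have "?e = 0 \<or> ?e = Ident A Y" using Y e by (auto simp: connected_end_def)
  moreover have False if "?e = 0"
  proof -
    have "r = 0" using re that O i by (simp add: Comp_zero_right)
    then show False using i X O by (simp add: Comp_zero_left)
  qed
  ultimately show ?thesis unfolding isomorphic_def using i by blast
qed

lemma connected_isomorphic:
  assumes X: "connected_end X" and Y: "Y \<in> Obj A" and "isomorphic A X Y"
  shows "connected_end Y"
proof -
  have XO: "X \<in> Obj A" using X by (simp add: connected_end_def)
  obtain f g where f: "f \<in> Hom A X Y" "g \<in> Hom A Y X" "Comp A X Y X g f = Ident A X" "Comp A Y X Y f g = Ident A Y"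
    using assms unfolding isomorphic_def by blast
  have "Ident A Y \<noteq> 0"
  proof
    assume "Ident A Y = 0"
    then have "f = 0" using Comp_Ident_left[OF XO Y f(1)] Comp_zero_left[OF XO Y Y f(1)] by simp
    then show False using f(3) Comp_zero_right[OF XO Y XO f(2)] X by (simp add: connected_end_def)
  qed
  moreover have "e = 0 \<or> e = Ident A Y" if e: "e \<in> Hom A Y Y" "Comp A Y Y Y e e = e" for e
  proof -
    let ?ef = "Comp A X Y Y e f"
    let ?d = "Comp A X Y X g ?ef"
    have ef: "?ef \<in> Hom A X Y" "?d \<in> Hom A X X" using XO Y f e by (simp_all add: Comp_Hom)
    have fg: "Comp A W X Y f (Comp A W Y X g h) = h" if "W \<in> Obj A" "h \<in> Hom A W Y" for W h
      using Comp_assoc[of W Y X Y h g f] that XO Y f by (simp add: Comp_Ident_left)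
    have "Comp A X X X ?d ?d = Comp A X Y X g (Comp A X Y Y e (Comp A X X Y f ?d))"
      using XO Y f e ef by (simp add: Comp_assoc Comp_Hom)
    also have "\<dots> = Comp A X Y X g (Comp A X Y Y e ?ef)" using fg[OF XO ef(1)] by simp
    also have "\<dots> = ?d" using Comp_assoc[of X Y Y Y f e e] XO Y f e by simp
    finally have "?d = 0 \<or> ?d = Ident A X" using X ef by (simp add: connected_end_def)
    moreover have "e = Comp A Y X Y (Comp A X X Y f ?d) g"
      unfolding fg[OF XO ef(1)] using Comp_assoc[of Y X Y Y g f e] XO Y f e by (simp add: Comp_Ident_right)
    ultimately show ?thesis
      using XO Y f by (auto simp: Comp_zero_right Comp_zero_left Comp_Ident_right)
  qed
  ultimately show ?thesis using Y by (simp add: connected_end_def)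
qed

lemma zero_object_iff: "zero_object A X \<longleftrightarrow> X \<in> Obj A \<and> Ident A X = 0"
proof
  assume z: "zero_object A X"
  then have X: "X \<in> Obj A" by (simp add: zero_object_def)
  then have "\<exists>!f. f \<in> Hom A X X" using z by (auto simp: zero_object_def)
  then have "Ident A X = 0" using Ident_Hom[OF X] zero_Hom[OF X X] by blast
  then show "X \<in> Obj A \<and> Ident A X = 0" using X by simp
next
  assume X: "X \<in> Obj A \<and> Ident A X = 0"
  have "f = 0" if "Y \<in> Obj A" "f \<in> Hom A X Y" for f Y
    using Comp_Ident_right[of X Y f] Comp_zero_right[of X X Y f] X that by simp
  moreover have "f = 0" if "Y \<in> Obj A" "f \<in> Hom A Y X" for f Y
    using Comp_Ident_left[of Y X f] Comp_zero_left[of Y X X f] X that by simp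
  ultimately have "\<exists>!f. f \<in> Hom A X Y" "\<exists>!f. f \<in> Hom A Y X" if "Y \<in> Obj A" for Y
    using that X by (auto intro!: ex1I[of _ 0] zero_Hom)
  then show "zero_object A X" using X unfolding zero_object_def by blast
qed

text \<open>The projection onto \<open>Y\<close> is an idempotent \<open>?e\<close> of
  \<open>X\<close>. If it is 0 then \<open>p\<close>, hence \<open>Y\<close>, vanishes; if it is the
  identity then \<open>q = q ?e = 0\<close>, hence \<open>Z\<close> vanishes.\<close>

lemma connected_indecomposable:
  assumes X: "connected_end X"
  shows "indecomposable A X"
  unfolding indecomposable_def
proof (intro conjI ballI impI)
  show XO: "X \<in> Obj A" and "\<not> zero_object A X" using X by (auto simp: connected_end_def zero_object_iff)
  fix Y Z assume O: "Y \<in> Obj A" "Z \<in> Obj A" and "is_biproduct A X Y Z"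
  then obtain i j p q where i: "i \<in> Hom A Y X" "j \<in> Hom A Z X" "p \<in> Hom A X Y" "q \<in> Hom A X Z"
    "Comp A Y X Y p i = Ident A Y" "Comp A Z X Z q j = Ident A Z"
    "Comp A Z X Y p j = 0" "Comp A Y X Z q i = 0"
    unfolding is_biproduct_def by blast
  let ?e = "Comp A X Y X i p"
  have e: "?e \<in> Hom A X X" using XO O i by (simp add: Comp_Hom)
  have pe: "Comp A X X Y p ?e = p"
    using XO O i by (simp add: Comp_assoc[symmetric] Comp_Ident_left)
  have "Comp A X X X ?e ?e = ?e" using XO O i e pe by (simp add: Comp_assoc)
  then consider "?e = 0" | "?e = Ident A X" using X e by (auto simp: connected_end_def)
  then show "zero_object A Y \<or> zero_object A Z"
  proof cases
    case 1
    then have "p = 0" using pe XO O i by (simp add: Comp_zero_right)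
    then have "Ident A Y = 0" using i XO O by (simp add: Comp_zero_left)
    then show ?thesis using O by (simp add: zero_object_iff)
  next
    case 2
    have "Comp A X X Z q ?e = 0"
      using Comp_assoc[of X Y X Z p i q] XO O i by (simp add: Comp_zero_left)
    then have "q = 0" using 2 XO O i by (simp add: Comp_Ident_right)
    then have "Ident A Z = 0" using i XO O by (simp add: Comp_zero_left)
    then show ?thesis using O by (simp add: zero_object_iff)
  qed
qed

end

text \<open>Restores the scalars that the record of a category does not carry.
  \<open>dependent\<close> states finite dimension of endomorphism algebras in the form in which it
  is applied, namely to the sequence of powers of an endomorphism.\<close>

locale hom_finite_category = preadd_category A + module scale
  for A :: "('o, 'm::ab_group_add) preadd_cat" and scale :: "complex \<Rightarrow> 'm \<Rightarrow> 'm" +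
  assumes scale_Hom: "X \<in> Obj A \<Longrightarrow> Y \<in> Obj A \<Longrightarrow> f \<in> Hom A X Y \<Longrightarrow> scale c f \<in> Hom A X Y"
    and Comp_scale_left: "X \<in> Obj A \<Longrightarrow> Y \<in> Obj A \<Longrightarrow> Z \<in> Obj A \<Longrightarrow>
      f \<in> Hom A X Y \<Longrightarrow> g \<in> Hom A Y Z \<Longrightarrow> Comp A X Y Z (scale c g) f = scale c (Comp A X Y Z g f)"
    and Comp_scale_right: "X \<in> Obj A \<Longrightarrow> Y \<in> Obj A \<Longrightarrow> Z \<in> Obj A \<Longrightarrow>
      f \<in> Hom A X Y \<Longrightarrow> g \<in> Hom A Y Z \<Longrightarrow> Comp A X Y Z g (scale c f) = scale c (Comp A X Y Z g f)"
    and dependent: "X \<in> Obj A \<Longrightarrow> (\<And>j. v j \<in> Hom A X X) \<Longrightarrow>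
      \<exists>c (N::nat). (\<exists>j\<le>N. c j \<noteq> 0) \<and> (\<Sum>j\<le>N. scale (c j) (v j)) = 0"
begin

lemma end_algebra: "X \<in> Obj A \<Longrightarrow> unital_algebra scale (Hom A X X) (Comp A X X X) (Ident A X)"
  by unfold_locales (simp_all add: zero_Hom Ident_Hom add_Hom scale_Hom Comp_Hom
    Comp_assoc Comp_Ident_left Comp_Ident_right Comp_add_left Comp_add_right Comp_scale_left Comp_scale_right)

lemma left_inverse_cases:
  assumes X: "connected_end X" and ab: "a \<in> Hom A X X" "b \<in> Hom A X X" "a + b = Ident A X"
  shows "\<exists>z \<in> Hom A X X. Comp A X X X z a = Ident A X \<or> Comp A X X X z b = Ident A X"
proof -
  have XO: "X \<in> Obj A" using X by (simp add: connected_end_def)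
  interpret E: unital_algebra scale "Hom A X X" "Comp A X X X" "Ident A X"
    by (rule end_algebra[OF XO])
  show ?thesis
    by (rule E.left_inverse_of_sum_one) (use X ab dependent[OF XO] in \<open>auto simp: connected_end_def\<close>)
qed

text \<open>Some \<open>b i\<close> after \<open>a i\<close> has a left inverse \<open>z\<close> in
  the endomorphism ring of \<open>X\<close>, and then \<open>z\<close> after \<open>b i\<close> is a
  retraction for \<open>a i\<close>. This is the exchange step of the Krull-Schmidt theorem.\<close>

lemma retract_of_summand:
  assumes X: "connected_end X" and fin: "finite I"
    and Y: "\<And>i. i \<in> I \<Longrightarrow> Y i \<in> Obj A \<and> a i \<in> Hom A X (Y i) \<and> b i \<in> Hom A (Y i) X"
    and sum: "(\<Sum>i\<in>I. Comp A X (Y i) X (b i) (a i)) = Ident A X"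
  shows "\<exists>i \<in> I. retract X (Y i)"
proof -
  have XO: "X \<in> Obj A" using X by (simp add: connected_end_def)
  interpret E: unital_algebra scale "Hom A X X" "Comp A X X X" "Ident A X"
    by (rule end_algebra[OF XO])
  have "\<exists>i \<in> I. \<exists>z \<in> Hom A X X. Comp A X X X z (Comp A X (Y i) X (b i) (a i)) = Ident A X"
  proof (rule E.left_inverse_of_sum)
    show "Ident A X \<in> Hom A X X" using XO by (rule Ident_Hom)
    show "Comp A X X X (Ident A X) (\<Sum>i\<in>I. Comp A X (Y i) X (b i) (a i)) = Ident A X"
      unfolding sum using XO by (simp add: Comp_Ident_left Ident_Hom)
  qed (use X XO Y fin dependent[OF XO] in \<open>auto simp: connected_end_def Comp_Hom\<close>)
  then obtain i z where i: "i \<in> I" "z \<in> Hom A X X" "Comp A X X X z (Comp A X (Y i) X (b i) (a i)) = Ident A X"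
    by blast
  then have "Comp A X (Y i) X (Comp A (Y i) X X z (b i)) (a i) = Ident A X"
    using Y[OF i(1)] XO by (simp add: Comp_assoc)
  then have "retract X (Y i)"
    unfolding retract_def using Y[OF i(1)] i(2) XO Comp_Hom by blast
  then show ?thesis using i by blast
qed

end

section \<open>Completions\<close>

lemma additive_completion_simps:
  "Obj (additive_completion A) = lists (Obj A)"
  "M \<in> Hom (additive_completion A) xs ys \<longleftrightarrow> (\<forall>i j.
        (i < length ys \<and> j < length xs \<longrightarrow> M i j \<in> Hom A (xs ! j) (ys ! i)) \<and>
        (\<not> (i < length ys \<and> j < length xs) \<longrightarrow> M i j = 0))"
  "Comp (additive_completion A) xs ys zs N M = (\<lambda>i j.
        if i < length zs \<and> j < length xs
        then \<Sum>r<length ys. Comp A (xs ! j) (ys ! r) (zs ! i) (N i r) (M r j)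
        else 0)"
  "Ident (additive_completion A) xs = (\<lambda>i j. if i = j \<and> i < length xs then Ident A (xs ! i) else 0)"
  by (simp_all add: additive_completion_def)

context preadd_category
begin

lemma additive_completion_preadd: "preadd_category (additive_completion A)"
proof
  fix X Y Z W :: "'o list" and f f' g g' h
  let ?B = "additive_completion A"
  assume X: "X \<in> Obj ?B" and Y: "Y \<in> Obj ?B"
  then have XY: "\<And>j. j < length X \<Longrightarrow> X ! j \<in> Obj A" "\<And>j. j < length Y \<Longrightarrow> Y ! j \<in> Obj A"
    by (auto simp: additive_completion_simps in_lists_conv_set)
  show "Ident ?B X \<in> Hom ?B X X" using XY by (auto simp: additive_completion_simps Ident_Hom zero_Hom)
  show "0 \<in> Hom ?B X Y" using XY by (simp add: additive_completion_simps zero_Hom)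
  show "f + g \<in> Hom ?B X Y" if "f \<in> Hom ?B X Y" "g \<in> Hom ?B X Y"
    using XY that by (simp add: additive_completion_simps add_Hom)
  show "- f \<in> Hom ?B X Y" if "f \<in> Hom ?B X Y"
    using XY that by (simp add: additive_completion_simps uminus_Hom)
  have delta: "(\<Sum>r<n. if r = i then u r else 0) = u i" "(\<Sum>r<n. if i = r then u r else 0) = u i"
    if "i < n" for n i and u :: "nat \<Rightarrow> 'm"
    using that by simp_all
  show "Comp ?B X Y Y (Ident ?B Y) f = f" if f: "f \<in> Hom ?B X Y"
  proof (intro ext)
    fix i j
    show "Comp ?B X Y Y (Ident ?B Y) f i j = f i j"
    proof (cases "i < length Y \<and> j < length X")
      case True
      then have "(\<Sum>r<length Y. Comp A (X ! j) (Y ! r) (Y ! i) (if i = r \<and> i < length Y then Ident A (Y ! i) else 0) (f r j))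
        = (\<Sum>r<length Y. if i = r then f r j else 0)"
        using f XY by (intro sum.cong) (auto simp: additive_completion_simps Comp_Ident_left Comp_zero_left)
      then show ?thesis using True by (simp add: additive_completion_simps)
    qed (use f in \<open>auto simp: additive_completion_simps\<close>)
  qed
  show "Comp ?B X X Y f (Ident ?B X) = f" if f: "f \<in> Hom ?B X Y"
  proof (intro ext)
    fix i j
    show "Comp ?B X X Y f (Ident ?B X) i j = f i j"
    proof (cases "i < length Y \<and> j < length X")
      case True
      then have "(\<Sum>r<length X. Comp A (X ! j) (X ! r) (Y ! i) (f i r) (if r = j \<and> r < length X then Ident A (X ! r) else 0))
        = (\<Sum>r<length X. if r = j then f i r else 0)"
        using f XY by (intro sum.cong) (auto simp: additive_completion_simps Comp_Ident_right Comp_zero_right)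
      then show ?thesis using True by (simp add: additive_completion_simps)
    qed (use f in \<open>auto simp: additive_completion_simps\<close>)
  qed
  assume Z: "Z \<in> Obj ?B"
  then have Zj: "\<And>j. j < length Z \<Longrightarrow> Z ! j \<in> Obj A"
    by (auto simp: additive_completion_simps in_lists_conv_set)
  show "Comp ?B X Y Z g f \<in> Hom ?B X Z" if "f \<in> Hom ?B X Y" "g \<in> Hom ?B Y Z"
    using XY Zj that by (auto simp: additive_completion_simps intro!: sum_Hom Comp_Hom)
  show "Comp ?B X Y Z (g + g') f = Comp ?B X Y Z g f + Comp ?B X Y Z g' f"
    if "f \<in> Hom ?B X Y" "g \<in> Hom ?B Y Z" "g' \<in> Hom ?B Y Z"
    using XY Zj that
    by (intro ext) (auto simp: additive_completion_simps Comp_add_left sum.distrib[symmetric] intro!: sum.cong)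
  show "Comp ?B X Y Z g (f + f') = Comp ?B X Y Z g f + Comp ?B X Y Z g f'"
    if "f \<in> Hom ?B X Y" "f' \<in> Hom ?B X Y" "g \<in> Hom ?B Y Z"
    using XY Zj that
    by (intro ext) (auto simp: additive_completion_simps Comp_add_right sum.distrib[symmetric] intro!: sum.cong)
  assume W: "W \<in> Obj ?B"
  then have Wj: "\<And>j. j < length W \<Longrightarrow> W ! j \<in> Obj A"
    by (auto simp: additive_completion_simps in_lists_conv_set)
  show "Comp ?B W X Z (Comp ?B X Y Z h g) f = Comp ?B W Y Z h (Comp ?B W X Y g f)"
    if f: "f \<in> Hom ?B W X" and g: "g \<in> Hom ?B X Y" and h: "h \<in> Hom ?B Y Z"
  proof (intro ext)
    fix i j
    show "Comp ?B W X Z (Comp ?B X Y Z h g) f i j = Comp ?B W Y Z h (Comp ?B W X Y g f) i j"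
    proof (cases "i < length Z \<and> j < length W")
      case True
      note O = Wj[of j] XY Zj[of i]
      have fj: "f r j \<in> Hom A (W ! j) (X ! r)" if "r < length X" for r
        using f True that by (simp add: additive_completion_simps)
      have gj: "g s r \<in> Hom A (X ! r) (Y ! s)" if "r < length X" "s < length Y" for r s
        using g that by (simp add: additive_completion_simps)
      have hj: "h i s \<in> Hom A (Y ! s) (Z ! i)" if "s < length Y" for s
        using h True that by (simp add: additive_completion_simps)
      have "(\<Sum>r<length X. Comp A (W ! j) (X ! r) (Z ! i)
          (\<Sum>s<length Y. Comp A (X ! r) (Y ! s) (Z ! i) (h i s) (g s r)) (f r j))
        = (\<Sum>r<length X. \<Sum>s<length Y. Comp A (W ! j) (Y ! s) (Z ! i) (h i s) (Comp A (W ! j) (X ! r) (Y ! s) (g s r) (f r j)))"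
      proof (rule sum.cong[OF refl])
        fix r assume "r \<in> {..<length X}"
        then have r: "r < length X" by simp
        show "Comp A (W ! j) (X ! r) (Z ! i) (\<Sum>s<length Y. Comp A (X ! r) (Y ! s) (Z ! i) (h i s) (g s r)) (f r j)
          = (\<Sum>s<length Y. Comp A (W ! j) (Y ! s) (Z ! i) (h i s) (Comp A (W ! j) (X ! r) (Y ! s) (g s r) (f r j)))"
          by (subst Comp_sum_left) (use O True fj gj hj r in \<open>auto intro!: sum.cong Comp_Hom Comp_assoc\<close>)
      qed
      also have "\<dots> = (\<Sum>s<length Y. \<Sum>r<length X. Comp A (W ! j) (Y ! s) (Z ! i) (h i s) (Comp A (W ! j) (X ! r) (Y ! s) (g s r) (f r j)))"
        by (rule sum.swap)
      also have "\<dots> = (\<Sum>s<length Y. Comp A (W ! j) (Y ! s) (Z ! i) (h i s)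
          (\<Sum>r<length X. Comp A (W ! j) (X ! r) (Y ! s) (g s r) (f r j)))"
      proof (rule sum.cong[OF refl])
        fix s assume "s \<in> {..<length Y}"
        then have s: "s < length Y" by simp
        show "(\<Sum>r<length X. Comp A (W ! j) (Y ! s) (Z ! i) (h i s) (Comp A (W ! j) (X ! r) (Y ! s) (g s r) (f r j)))
          = Comp A (W ! j) (Y ! s) (Z ! i) (h i s) (\<Sum>r<length X. Comp A (W ! j) (X ! r) (Y ! s) (g s r) (f r j))"
          by (subst Comp_sum_right) (use O True fj gj hj s in \<open>auto intro!: Comp_Hom\<close>)
      qed
      finally show ?thesis using True by (simp add: additive_completion_simps)
    next
      case False
      then show ?thesis unfolding additive_completion_simps by auto
    qed
  qed
qed

end

lemma idempotent_completion_simps: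
  "(X, e) \<in> Obj (idempotent_completion A) \<longleftrightarrow> X \<in> Obj A \<and> e \<in> Hom A X X \<and> Comp A X X X e e = e"
  "m \<in> Hom (idempotent_completion A) (X, e) (Y, f) \<longleftrightarrow>
     m \<in> Hom A X Y \<and> Comp A X X Y m e = m \<and> Comp A X Y Y f m = m"
  "Comp (idempotent_completion A) (X, e) (Y, f) (Z, g) = Comp A X Y Z"
  "Ident (idempotent_completion A) (X, e) = e"
  by (simp_all add: idempotent_completion_def)

context preadd_category
begin

lemma idempotent_completion_preadd: "preadd_category (idempotent_completion A)"
proof
  fix X' Y' Z' W' :: "'o \<times> 'm" and f f' g g' h
  let ?B = "idempotent_completion A"
  obtain X e Y u Z z W w where pairs: "X' = (X, e)" "Y' = (Y, u)" "Z' = (Z, z)" "W' = (W, w)"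
    by (metis surj_pair)
  assume "X' \<in> Obj ?B"
  then have X: "X \<in> Obj A" "e \<in> Hom A X X" "Comp A X X X e e = e"
    by (auto simp: pairs idempotent_completion_simps)
  show "Ident ?B X' \<in> Hom ?B X' X'" using X by (simp add: pairs idempotent_completion_simps)
  assume "Y' \<in> Obj ?B"
  then have Y: "Y \<in> Obj A" "u \<in> Hom A Y Y" "Comp A Y Y Y u u = u"
    by (auto simp: pairs idempotent_completion_simps)
  show "0 \<in> Hom ?B X' Y'"
    using X Y by (simp add: pairs idempotent_completion_simps zero_Hom Comp_zero_left Comp_zero_right)
  show "f + g \<in> Hom ?B X' Y'" if "f \<in> Hom ?B X' Y'" "g \<in> Hom ?B X' Y'"
    using X Y that by (simp add: pairs idempotent_completion_simps add_Hom Comp_add_left Comp_add_right)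
  show "- f \<in> Hom ?B X' Y'" if "f \<in> Hom ?B X' Y'"
    using X Y that Comp_diff_left[of X X Y e 0 f] Comp_diff_right[of X Y Y 0 f u]
    by (simp add: pairs idempotent_completion_simps uminus_Hom zero_Hom Comp_zero_left Comp_zero_right)
  show "Comp ?B X' Y' Y' (Ident ?B Y') f = f" if "f \<in> Hom ?B X' Y'"
    using that by (simp add: pairs idempotent_completion_simps)
  show "Comp ?B X' X' Y' f (Ident ?B X') = f" if "f \<in> Hom ?B X' Y'"
    using that by (simp add: pairs idempotent_completion_simps)
  assume "Z' \<in> Obj ?B"
  then have Z: "Z \<in> Obj A" "z \<in> Hom A Z Z" "Comp A Z Z Z z z = z"
    by (auto simp: pairs idempotent_completion_simps)
  show "Comp ?B X' Y' Z' g f \<in> Hom ?B X' Z'" if "f \<in> Hom ?B X' Y'" "g \<in> Hom ?B Y' Z'"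
    using X Y Z that Comp_assoc[of X Y Z Z f g z] Comp_assoc[of X X Y Z e f g]
    by (simp add: pairs idempotent_completion_simps Comp_Hom)
  show "Comp ?B X' Y' Z' (g + g') f = Comp ?B X' Y' Z' g f + Comp ?B X' Y' Z' g' f"
    if "f \<in> Hom ?B X' Y'" "g \<in> Hom ?B Y' Z'" "g' \<in> Hom ?B Y' Z'"
    using X Y Z that by (simp add: pairs idempotent_completion_simps Comp_add_left)
  show "Comp ?B X' Y' Z' g (f + f') = Comp ?B X' Y' Z' g f + Comp ?B X' Y' Z' g f'"
    if "f \<in> Hom ?B X' Y'" "f' \<in> Hom ?B X' Y'" "g \<in> Hom ?B Y' Z'"
    using X Y Z that by (simp add: pairs idempotent_completion_simps Comp_add_right)
  assume "W' \<in> Obj ?B"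
  then have W: "W \<in> Obj A"
    by (auto simp: pairs idempotent_completion_simps)
  show "Comp ?B W' X' Z' (Comp ?B X' Y' Z' h g) f = Comp ?B W' Y' Z' h (Comp ?B W' X' Y' g f)"
    if "f \<in> Hom ?B W' X'" "g \<in> Hom ?B X' Y'" "h \<in> Hom ?B Y' Z'"
    using W X Y Z that by (simp add: pairs idempotent_completion_simps Comp_assoc)
qed

text \<open>Here idempotent completeness enters: an idempotent \<open>e\<close> of
  \<open>(Z, f)\<close> splits it into the objects \<open>(Z, e)\<close> and
  \<open>(Z, f - e)\<close>, with \<open>e\<close> and \<open>f - e\<close> serving both as
  inclusions and as projections.\<close>

lemma indecomposable_connected:
  assumes "indecomposable (idempotent_completion A) X"
  shows "preadd_category.connected_end (idempotent_completion A) X"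
proof -
  interpret K: preadd_category "idempotent_completion A" by (rule idempotent_completion_preadd)
  let ?B = "idempotent_completion A"
  obtain Z f where Xeq: "X = (Z, f)" by (cases X)
  have X: "X \<in> Obj ?B" "\<not> zero_object ?B X"
    and dec: "\<And>Y W. Y \<in> Obj ?B \<Longrightarrow> W \<in> Obj ?B \<Longrightarrow> is_biproduct ?B X Y W \<Longrightarrow> zero_object ?B Y \<or> zero_object ?B W"
    using assms by (auto simp: indecomposable_def)
  have Z: "Z \<in> Obj A" "f \<in> Hom A Z Z" "Comp A Z Z Z f f = f"
    using X by (auto simp: Xeq idempotent_completion_simps)
  have "e = 0 \<or> e = Ident ?B X" if e: "e \<in> Hom ?B X X" "Comp ?B X X X e e = e" for e
  proof -
    have e': "e \<in> Hom A Z Z" "Comp A Z Z Z e f = e" "Comp A Z Z Z f e = e" "Comp A Z Z Z e e = e"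
      using e by (auto simp: Xeq idempotent_completion_simps)
    have d: "f - e \<in> Hom A Z Z" "Comp A Z Z Z (f - e) f = f - e" "Comp A Z Z Z f (f - e) = f - e"
      "Comp A Z Z Z (f - e) (f - e) = f - e" "Comp A Z Z Z (f - e) e = 0" "Comp A Z Z Z e (f - e) = 0"
      using Z e' by (simp_all add: diff_Hom Comp_diff_left Comp_diff_right)
    have "is_biproduct ?B X (Z, e) (Z, f - e)"
      unfolding is_biproduct_def Xeq
      by (rule bexI[of _ e], rule bexI[of _ "f - e"], rule bexI[of _ e], rule bexI[of _ "f - e"])
        (use Z e' d in \<open>simp_all add: idempotent_completion_simps\<close>)
    then have "zero_object ?B (Z, e) \<or> zero_object ?B (Z, f - e)"
      using dec Z e' d by (simp add: idempotent_completion_simps)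
    then show ?thesis by (auto simp: K.zero_object_iff Xeq idempotent_completion_simps)
  qed
  then show ?thesis using X by (auto simp: K.connected_end_def K.zero_object_iff)
qed

text \<open>The idempotent is inclusion after retraction. Passing to \<open>(Z, e)\<close> moves
  \<open>X\<close> onto the underlying object of \<open>(Z, f)\<close>, so that \<open>e\<close> can
  be compared with \<open>f\<close> inside one algebra.\<close>

lemma retract_image:
  assumes X: "X \<in> Obj (idempotent_completion A)" and Z: "(Z, f) \<in> Obj (idempotent_completion A)"
    and "preadd_category.retract (idempotent_completion A) X (Z, f)"
  obtains e where "e \<in> Hom A Z Z" "Comp A Z Z Z e e = e" "Comp A Z Z Z e f = e" "Comp A Z Z Z f e = e"
    "isomorphic (idempotent_completion A) X (Z, e)"
proof -
  interpret K: preadd_category "idempotent_completion A" by (rule idempotent_completion_preadd)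
  obtain Y u where Xeq: "X = (Y, u)" by (cases X)
  have O: "Y \<in> Obj A" "Z \<in> Obj A" "f \<in> Hom A Z Z" "u \<in> Hom A Y Y" "Comp A Z Z Z f f = f" "Comp A Y Y Y u u = u"
    using X Z by (auto simp: Xeq idempotent_completion_simps)
  obtain i r where i: "i \<in> Hom A Y Z" "Comp A Y Y Z i u = i" "Comp A Y Z Z f i = i"
    "r \<in> Hom A Z Y" "Comp A Z Z Y r f = r" "Comp A Z Y Y u r = r" "Comp A Y Z Y r i = u"
    using assms(3) unfolding K.retract_def by (auto simp: Xeq idempotent_completion_simps)
  let ?e = "Comp A Z Y Z i r"
  have eH: "?e \<in> Hom A Z Z" using O i by (simp add: Comp_Hom)
  have re: "Comp A Z Z Y r ?e = r" using O i by (simp add: Comp_assoc[symmetric])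
  have ei: "Comp A Y Z Z ?e i = i" using O i by (simp add: Comp_assoc)
  have ee: "Comp A Z Z Z ?e ?e = ?e" using O i eH re by (simp add: Comp_assoc)
  have ef: "Comp A Z Z Z ?e f = ?e" "Comp A Z Z Z f ?e = ?e"
    using O i by (simp add: Comp_assoc, simp add: Comp_assoc[symmetric])
  have "isomorphic (idempotent_completion A) X (Z, ?e)"
    unfolding isomorphic_def Xeq
    by (rule bexI[of _ i], rule bexI[of _ r]) (use O i re ei in \<open>simp_all add: idempotent_completion_simps\<close>)
  then show ?thesis using that eH ee ef by blast
qed

end

section \<open>Linear combinations of partitions\<close>

abbreviation keys :: "lin \<Rightarrow> ptn set" where "keys \<equiv> Poly_Mapping.keys"
abbreviation lookup :: "lin \<Rightarrow> ptn \<Rightarrow> complex" where "lookup \<equiv> Poly_Mapping.lookup"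
abbreviation single :: "ptn \<Rightarrow> complex \<Rightarrow> lin" where "single \<equiv> Poly_Mapping.single"

definition cscale :: "complex \<Rightarrow> lin \<Rightarrow> lin" where
  "cscale c = Poly_Mapping.map ((*) c)"

lemma lookup_cscale: "lookup (cscale c f) p = c * lookup f p"
  by (simp add: cscale_def Poly_Mapping.map.rep_eq when_def)

lemma module_cscale: "module cscale"
  by unfold_locales (auto intro!: poly_mapping_eqI simp: lookup_cscale lookup_add algebra_simps)

lemma keys_cscale: "keys (cscale c f) \<subseteq> keys f"
  by (auto simp: in_keys_iff lookup_cscale)

lemma cscale_single: "cscale c (single p a) = single p (c * a)"
  by (rule poly_mapping_eqI) (simp add: lookup_cscale lookup_single when_def)

text \<open>The sets \<open>keys\<close> shrink under cancellation; summing over fixed larger sets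
  allows bilinearity to be checked term by term.\<close>

lemma lin_comp_superset:
  assumes "finite S" "keys g \<subseteq> S" "finite T" "keys f \<subseteq> T"
  shows "lin_comp t g f = (\<Sum>q\<in>S. \<Sum>p\<in>T. single (pcomp q p) (lookup g q * lookup f p * t ^ loops q p))"
proof -
  have "lin_comp t g f = (\<Sum>q\<in>keys g. \<Sum>p\<in>T. single (pcomp q p) (lookup g q * lookup f p * t ^ loops q p))"
    unfolding lin_comp_def
    by (intro sum.cong refl sum.mono_neutral_left) (use assms in \<open>auto simp: in_keys_iff\<close>)
  also have "\<dots> = (\<Sum>q\<in>S. \<Sum>p\<in>T. single (pcomp q p) (lookup g q * lookup f p * t ^ loops q p))"
    by (intro sum.mono_neutral_left) (use assms in \<open>auto simp: in_keys_iff\<close>)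
  finally show ?thesis .
qed

lemma lin_comp_add_left: "lin_comp t (g + g') f = lin_comp t g f + lin_comp t g' f"
proof -
  let ?S = "keys g \<union> keys g'" and ?T = "keys f"
  have "keys (g + g') \<subseteq> ?S" by (rule keys_add)
  then show ?thesis
    by (simp add: lin_comp_superset[of ?S _ ?T] lookup_add algebra_simps single_add sum.distrib)
qed

lemma lin_comp_add_right: "lin_comp t g (f + f') = lin_comp t g f + lin_comp t g f'"
proof -
  let ?S = "keys g" and ?T = "keys f \<union> keys f'"
  have "keys (f + f') \<subseteq> ?T" by (rule keys_add)
  then show ?thesis
    by (simp add: lin_comp_superset[of ?S _ ?T] lookup_add algebra_simps single_add sum.distrib)
qed

lemma lin_comp_zero [simp]: "lin_comp t 0 f = 0" "lin_comp t g 0 = 0"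
  by (simp_all add: lin_comp_def)

lemma lin_comp_sum_left: "lin_comp t (sum g I) f = (\<Sum>i\<in>I. lin_comp t (g i) f)"
  by (induction I rule: infinite_finite_induct) (auto simp: lin_comp_add_left)

lemma lin_comp_sum_right: "lin_comp t g (sum f I) = (\<Sum>i\<in>I. lin_comp t g (f i))"
  by (induction I rule: infinite_finite_induct) (auto simp: lin_comp_add_right)

lemma lin_comp_scale_left: "lin_comp t (cscale c g) f = cscale c (lin_comp t g f)"
proof -
  have "lin_comp t (cscale c g) f = (\<Sum>q\<in>keys g. \<Sum>p\<in>keys f. single (pcomp q p) (lookup (cscale c g) q * lookup f p * t ^ loops q p))"
    by (rule lin_comp_superset) (simp_all add: keys_cscale)
  then show ?thesis
    by (simp add: lin_comp_def module.scale_sum_right[OF module_cscale] cscale_single lookup_cscale mult_ac)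
qed

lemma lin_comp_scale_right: "lin_comp t g (cscale c f) = cscale c (lin_comp t g f)"
proof -
  have "lin_comp t g (cscale c f) = (\<Sum>q\<in>keys g. \<Sum>p\<in>keys f. single (pcomp q p) (lookup g q * lookup (cscale c f) p * t ^ loops q p))"
    by (rule lin_comp_superset) (simp_all add: keys_cscale)
  then show ?thesis
    by (simp add: lin_comp_def module.scale_sum_right[OF module_cscale] cscale_single lookup_cscale mult_ac)
qed

lemma lin_comp_single: "lin_comp t (single q a) (single p b) = single (pcomp q p) (a * b * t ^ loops q p)"
  by (subst lin_comp_superset[of "{q}" _ "{p}"]) auto

lemma sum_single: "(\<Sum>p\<in>keys f. single p (lookup f p)) = f"
proof (rule poly_mapping_eqI)
  fix q show "lookup (\<Sum>p\<in>keys f. single p (lookup f p)) q = lookup f q"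
    by (simp add: lookup_sum lookup_single when_def in_keys_iff)
qed

text \<open>On basis elements the composites agree by \<open>pcomp_assoc\<close> and the exponents
  of \<open>t\<close> by \<open>loops_assoc\<close>; bilinearity does the rest.\<close>

lemma lin_comp_assoc:
  assumes "\<And>p. p \<in> keys f \<Longrightarrow> finite (\<Union>p)" "\<And>p. p \<in> keys g \<Longrightarrow> finite (\<Union>p)" "\<And>p. p \<in> keys h \<Longrightarrow> finite (\<Union>p)"
  shows "lin_comp t (lin_comp t h g) f = lin_comp t h (lin_comp t g f)"
proof -
  let ?f = "\<lambda>p. single p (lookup f p)" and ?g = "\<lambda>p. single p (lookup g p)" and ?h = "\<lambda>p. single p (lookup h p)"
  have 1: "lin_comp t (lin_comp t (?h r) (?g q)) (?f p) = lin_comp t (?h r) (lin_comp t (?g q) (?f p))"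
    if "p \<in> keys f" "q \<in> keys g" "r \<in> keys h" for p q r
    using pcomp_assoc[of p q r] loops_assoc[of p q r] assms that
    by (simp add: lin_comp_single mult.assoc power_add[symmetric]) (simp add: mult_ac power_add[symmetric] add.commute)
  have "lin_comp t (lin_comp t (sum ?h (keys h)) (sum ?g (keys g))) (sum ?f (keys f))
    = lin_comp t (sum ?h (keys h)) (lin_comp t (sum ?g (keys g)) (sum ?f (keys f)))"
    unfolding lin_comp_sum_left lin_comp_sum_right
    by (intro sum.cong refl 1) 
  then show ?thesis unfolding sum_single .
qed

lemma keys_lin_comp: "keys (lin_comp t g f) \<subseteq> {pcomp q p |q p. q \<in> keys g \<and> p \<in> keys f}"
proof -
  have "keys (\<Sum>p\<in>keys f. single (pcomp q p) (lookup g q * lookup f p * t ^ loops q p))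
      \<subseteq> (\<lambda>p. pcomp q p) ` keys f" for q
    by (rule order_trans[OF keys_sum]) (auto split: if_splits)
  then show ?thesis unfolding lin_comp_def
    by (intro order_trans[OF keys_sum]) fast
qed

text \<open>A homogeneous system with more unknowns than equations has a non-trivial solution: an
  equation with a non-zero coefficient is used to eliminate one unknown.\<close>

lemma finite_coordinates_dependent:
  fixes v :: "'j \<Rightarrow> 'i \<Rightarrow> complex"
  assumes "finite I" "finite J" "card I < card J"
  shows "\<exists>c. (\<exists>j\<in>J. c j \<noteq> 0) \<and> (\<forall>i\<in>I. (\<Sum>j\<in>J. c j * v j i) = 0)"
  using assms
proof (induction I arbitrary: J v rule: finite_induct)
  case empty
  then have "J \<noteq> {}" by auto
  then show ?case by (intro exI[of _ "\<lambda>_. 1"]) auto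
next
  case (insert i I)
  show ?case
  proof (cases "\<forall>j\<in>J. v j i = 0")
    case True
    have "card I < card J" using insert by simp
    then obtain c where "\<exists>j\<in>J. c j \<noteq> 0" "\<forall>i\<in>I. (\<Sum>j\<in>J. c j * v j i) = 0"
      using insert.IH[OF insert.prems(1), of v] by blast
    then show ?thesis using True by (intro exI[of _ c]) auto
  next
    case False
    then obtain j0 where j0: "j0 \<in> J" "v j0 i \<noteq> 0" by blast
    let ?w = "\<lambda>j k. v j k - v j i / v j0 i * v j0 k"
    have "card I < card (J - {j0})" using insert j0 by simp
    then obtain c where c: "\<exists>j\<in>J - {j0}. c j \<noteq> 0" "\<forall>k\<in>I. (\<Sum>j\<in>J - {j0}. c j * ?w j k) = 0"
      using insert.IH[of "J - {j0}" ?w] insert.prems(1) by blast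
    \<comment> \<open>The coefficient at the pivot \<open>j0\<close> is determined by solving
      equation \<open>i\<close>.\<close>
    define d where "d = (\<lambda>j. if j = j0 then - (\<Sum>j\<in>J - {j0}. c j * v j i) / v j0 i else c j)"
    have split: "(\<Sum>j\<in>J. d j * v j k) = (\<Sum>j\<in>J - {j0}. c j * ?w j k)" for k
    proof -
      have "(\<Sum>j\<in>J. d j * v j k) = d j0 * v j0 k + (\<Sum>j\<in>J - {j0}. c j * v j k)"
        using insert.prems(1) j0 by (simp add: sum.remove d_def)
      also have "d j0 * v j0 k = - (\<Sum>j\<in>J - {j0}. c j * (v j i / v j0 i * v j0 k))"
        by (simp add: d_def sum_distrib_right sum_divide_distrib mult.assoc)
      finally show ?thesis by (simp add: right_diff_distrib sum_subtractf)
    qed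
    have "(\<Sum>j\<in>J - {j0}. c j * ?w j i) = 0" using j0 by simp
    then have "\<forall>k\<in>insert i I. (\<Sum>j\<in>J. d j * v j k) = 0" unfolding split using c by simp
    moreover have "\<exists>j\<in>J. d j \<noteq> 0" using c by (auto simp: d_def)
    ultimately show ?thesis by blast
  qed
qed

text \<open>The strands of the identity tie every middle point to an outer point, so no component
  stays within the middle row.\<close>

lemma loops_id:
  assumes "p \<in> partitions k l"
  shows "loops (id_ptn l) p = 0" and "loops p (id_ptn k) = 0"
proof -
  have no: "{K \<in> comps (stack q r). K \<subseteq> range Mid} = {}"
    if h: "\<And>j. Mid j \<in> \<Union>(stack q r) \<Longrightarrow> \<exists>z. z \<notin> range Mid \<and> conn (stack q r) (Mid j) z" for q r
  proof (rule ccontr)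
    assume "\<not> ?thesis"
    then obtain K x where K: "K \<in> comps (stack q r)" "K \<subseteq> range Mid" "x \<in> K"
      using comps_nonempty by blast
    then obtain j where j: "x = Mid j" by blast
    then obtain z where "z \<notin> range Mid" "conn (stack q r) x z"
      using h[of j] K(3) comps_subset[OF K(1)] by blast
    then show False using K mem_comps[OF K(1,3)] by blast
  qed
  have id: "id_ptn n \<in> partitions n n" for n using proj_partitions[of n False] by (simp add: proj_id)
  have sid: "same (id_ptn n) (Up j) (Low j)" if "j \<in> {1..n}" for n j
    using that by (auto simp: proj_id[symmetric] same_proj)
  have "\<exists>z. z \<notin> range Mid \<and> conn (stack (id_ptn l) p) (Mid j) z"
    if "Mid j \<in> \<Union>(stack (id_ptn l) p)" for j
    using that conn_stack(2)[OF sid, of j l p] unfolding Union_stack[OF assms id]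
    by (intro exI[of _ "Bot j"]) auto
  then have "{K \<in> comps (stack (id_ptn l) p). K \<subseteq> range Mid} = {}" by (rule no)
  then show "loops (id_ptn l) p = 0"
    by (simp only: loops_def components_eq_comps card.empty)
  have "\<exists>z. z \<notin> range Mid \<and> conn (stack p (id_ptn k)) (Mid j) z"
    if "Mid j \<in> \<Union>(stack p (id_ptn k))" for j
    using that conn_sym[OF conn_stack(1)[OF sid, of j k p]] unfolding Union_stack[OF id assms]
    by (intro exI[of _ "Top j"]) auto
  then have "{K \<in> comps (stack p (id_ptn k)). K \<subseteq> range Mid} = {}" by (rule no)
  then show "loops p (id_ptn k) = 0"
    by (simp only: loops_def components_eq_comps card.empty)
qed

lemma Rep0_simps: "Obj (Rep0 C t) = UNIV" "Hom (Rep0 C t) = lin_hom C"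
  "Comp (Rep0 C t) k l m = lin_comp t" "Ident (Rep0 C t) k = single (id_ptn k) 1"
  by (simp_all add: Rep0_def)

definition unit_mat :: "lin \<Rightarrow> nat \<Rightarrow> nat \<Rightarrow> lin" where
  "unit_mat x = (\<lambda>i j. if i = 0 \<and> j = 0 then x else 0)"

lemma unit_mat_eq_iff [simp]: "unit_mat x = unit_mat y \<longleftrightarrow> x = y"
  by (auto simp: unit_mat_def fun_eq_iff)

lemma unit_mat_0 [simp]: "unit_mat 0 = 0"
  by (auto simp: unit_mat_def fun_eq_iff)

lemma unit_mat_eq_0_iff [simp]: "unit_mat x = 0 \<longleftrightarrow> x = 0"
  by (metis unit_mat_0 unit_mat_eq_iff)

lemma unit_mat_add: "unit_mat (x + y) = unit_mat x + unit_mat y"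
  by (auto simp: unit_mat_def fun_eq_iff)

lemma unit_mat_sum: "unit_mat (sum f I) = (\<Sum>i\<in>I. unit_mat (f i))"
  by (induction I rule: infinite_finite_induct) (simp_all add: unit_mat_add)

lemma image_obj_unit_mat: "image_obj k e = ([k], unit_mat e)"
  by (simp add: image_obj_def unit_mat_def)

definition mscale :: "complex \<Rightarrow> (nat \<Rightarrow> nat \<Rightarrow> lin) \<Rightarrow> nat \<Rightarrow> nat \<Rightarrow> lin" where
  "mscale c M = (\<lambda>i j. cscale c (M i j))"

lemma module_mscale: "module mscale"
  by unfold_locales (simp_all add: mscale_def fun_eq_iff module.scale_right_distrib[OF module_cscale]
    module.scale_left_distrib[OF module_cscale] module.scale_scale[OF module_cscale] module.scale_one[OF module_cscale])

section \<open>The completed category of one of the two families\<close>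

locale planar_rep = planar_category +
  fixes t :: complex
  assumes t: "t \<noteq> 0"
begin

abbreviation comp (infixl "\<bullet>" 70) where "g \<bullet> f \<equiv> lin_comp t g f"

lemma lin_hom_zero: "0 \<in> lin_hom C k l"
  and lin_hom_add: "x \<in> lin_hom C k l \<Longrightarrow> y \<in> lin_hom C k l \<Longrightarrow> x + y \<in> lin_hom C k l"
  and lin_hom_uminus: "x \<in> lin_hom C k l \<Longrightarrow> - x \<in> lin_hom C k l"
  and lin_hom_scale: "x \<in> lin_hom C k l \<Longrightarrow> cscale c x \<in> lin_hom C k l"
  and lin_hom_single: "p \<in> C k l \<Longrightarrow> single p a \<in> lin_hom C k l"
  using keys_add[of x y] keys_cscale[of c x] by (auto simp: lin_hom_def)

lemma lin_hom_diff: "x \<in> lin_hom C k l \<Longrightarrow> y \<in> lin_hom C k l \<Longrightarrow> x - y \<in> lin_hom C k l"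
  using lin_hom_add[of x k l "- y"] lin_hom_uminus[of y] by simp

lemma lin_hom_comp: "x \<in> lin_hom C k l \<Longrightarrow> y \<in> lin_hom C l m \<Longrightarrow> y \<bullet> x \<in> lin_hom C k m"
  using keys_lin_comp[of t y x] pcomp_C unfolding lin_hom_def by blast

lemma lin_hom_finite: "x \<in> lin_hom C k l \<Longrightarrow> p \<in> keys x \<Longrightarrow> finite (\<Union>p)"
  using partitions_Union[OF C_partitions] by (auto simp: lin_hom_def)

lemma comp_assoc:
  "x \<in> lin_hom C k l \<Longrightarrow> y \<in> lin_hom C l' m \<Longrightarrow> z \<in> lin_hom C m' n \<Longrightarrow> (z \<bullet> y) \<bullet> x = z \<bullet> (y \<bullet> x)"
  by (rule lin_comp_assoc) (blast intro: lin_hom_finite)+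

lemma comp_id_left: "x \<in> lin_hom C k l \<Longrightarrow> single (id_ptn l) 1 \<bullet> x = x"
proof -
  assume x: "x \<in> lin_hom C k l"
  have "single (id_ptn l) 1 \<bullet> (\<Sum>p\<in>keys x. single p (lookup x p)) = (\<Sum>p\<in>keys x. single p (lookup x p))"
    unfolding lin_comp_sum_right
  proof (rule sum.cong[OF refl])
    fix p assume "p \<in> keys x"
    then have "p \<in> partitions k l" using x C_partitions by (auto simp: lin_hom_def)
    then show "single (id_ptn l) 1 \<bullet> single p (lookup x p) = single p (lookup x p)"
      using pcomp_proj_left[of p k l False] loops_id(1)[of p k l] by (simp add: lin_comp_single proj_id)
  qed
  then show ?thesis unfolding sum_single .
qed

lemma comp_id_right: "x \<in> lin_hom C k l \<Longrightarrow> x \<bullet> single (id_ptn k) 1 = x"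
proof -
  assume x: "x \<in> lin_hom C k l"
  have "(\<Sum>p\<in>keys x. single p (lookup x p)) \<bullet> single (id_ptn k) 1 = (\<Sum>p\<in>keys x. single p (lookup x p))"
    unfolding lin_comp_sum_left
  proof (rule sum.cong[OF refl])
    fix p assume "p \<in> keys x"
    then have "p \<in> partitions k l" using x C_partitions by (auto simp: lin_hom_def)
    then show "single p (lookup x p) \<bullet> single (id_ptn k) 1 = single p (lookup x p)"
      using pcomp_proj_right[of p k False l] loops_id(2)[of p k l] by (simp add: lin_comp_single proj_id)
  qed
  then show ?thesis unfolding sum_single .
qed

lemma id_hom: "single (id_ptn k) 1 \<in> lin_hom C k k"
  using proj_C[of k False] by (intro lin_hom_single) (simp add: proj_id)

sublocale R0: preadd_category "Rep0 C t"
  by unfold_locales (use lin_hom_comp in \<open>auto simp: Rep0_simps lin_hom_zero lin_hom_add lin_hom_uminus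
    comp_assoc id_hom comp_id_left comp_id_right lin_comp_add_left lin_comp_add_right\<close>)

sublocale Add: preadd_category "additive_completion (Rep0 C t)"
  by (rule R0.additive_completion_preadd)

lemma Rep_unfold: "Rep C t = idempotent_completion (additive_completion (Rep0 C t))"
  by (simp add: Rep_def)

lemma finite_C: "finite (C k l)"
  using finite_subset[OF _ finite_partitions] C_partitions by blast

lemma mat_scale_left: "Comp (additive_completion (Rep0 C t)) X Y Z (mscale c g) f
    = mscale c (Comp (additive_completion (Rep0 C t)) X Y Z g f)"
  by (auto simp: additive_completion_simps Rep0_simps mscale_def fun_eq_iff lin_comp_scale_left
    module.scale_sum_right[OF module_cscale] module.scale_zero_right[OF module_cscale])

lemma mat_scale_right: "Comp (additive_completion (Rep0 C t)) X Y Z g (mscale c f)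
    = mscale c (Comp (additive_completion (Rep0 C t)) X Y Z g f)"
  by (auto simp: additive_completion_simps Rep0_simps mscale_def fun_eq_iff lin_comp_scale_right
    module.scale_sum_right[OF module_cscale] module.scale_zero_right[OF module_cscale])

lemma sum_fun_apply: "(\<Sum>j\<in>J. f j) x y = (\<Sum>j\<in>J. (f j x y :: lin))"
  by (induction J rule: infinite_finite_induct) auto

lemma matrices_dependent:
  assumes v: "\<And>j. v j \<in> Hom (additive_completion (Rep0 C t)) xs xs"
  shows "\<exists>c (N::nat). (\<exists>j\<le>N. c j \<noteq> 0) \<and> (\<Sum>j\<le>N. mscale (c j) (v j)) = 0"
proof -
  let ?n = "length xs"
  \<comment> \<open>A finite set of coordinates: matrix position and partition. The union lets
    partitions occur at positions where they do not belong; there the coordinate is simply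
    0.\<close>
  define I where "I = {..<?n} \<times> {..<?n} \<times> (\<Union>a<?n. \<Union>b<?n. C (xs ! b) (xs ! a))"
  have fin: "finite I" unfolding I_def using finite_C by auto
  obtain c where c: "\<exists>j\<in>{..card I}. c j \<noteq> 0"
    "\<forall>i\<in>I. (\<Sum>j\<in>{..card I}. c j * (case i of (a, b, p) \<Rightarrow> lookup (v j a b) p)) = 0"
    using finite_coordinates_dependent[OF fin, of "{..card I}" "\<lambda>j i. case i of (a, b, p) \<Rightarrow> lookup (v j a b) p"]
    by auto
  have "(\<Sum>j\<le>card I. mscale (c j) (v j)) a b = 0" for a b
  proof (rule poly_mapping_eqI)
    fix p
    have "lookup ((\<Sum>j\<le>card I. mscale (c j) (v j)) a b) p = (\<Sum>j\<le>card I. c j * lookup (v j a b) p)"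
      by (simp add: sum_fun_apply lookup_sum mscale_def lookup_cscale)
    also have "\<dots> = 0"
    proof (cases "(a, b, p) \<in> I")
      case True
      then show ?thesis using c(2) by fastforce
    next
      case False
      have "lookup (v j a b) p = 0" for j
      proof (cases "a < ?n \<and> b < ?n")
        case True
        then have "keys (v j a b) \<subseteq> C (xs ! b) (xs ! a)"
          using v[of j] by (simp add: additive_completion_simps Rep0_simps lin_hom_def)
        then show ?thesis using False True unfolding I_def by (auto simp: in_keys_iff)
      next
        case False
        then have "v j a b = 0" using v[of j] unfolding additive_completion_simps by blast
        then show ?thesis by simp
      qed
      then show ?thesis by simp
    qed
    finally show "lookup ((\<Sum>j\<le>card I. mscale (c j) (v j)) a b) p = lookup 0 p" by simp
  qed
  then have "(\<Sum>j\<le>card I. mscale (c j) (v j)) = 0" by (simp add: fun_eq_iff)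
  then show ?thesis using c(1) by (intro exI[of _ c] exI[of _ "card I"]) auto
qed

sublocale K: hom_finite_category "Rep C t" mscale
proof -
  interpret pre: preadd_category "Rep C t"
    unfolding Rep_unfold by (rule Add.idempotent_completion_preadd)
  interpret module mscale by (rule module_mscale)
  show "hom_finite_category (Rep C t) mscale"
  proof
    fix X Y Z :: rep_obj and c f g
    let ?B = "additive_completion (Rep0 C t)"
    show "mscale c f \<in> Hom (Rep C t) X Y" if "f \<in> Hom (Rep C t) X Y"
    proof -
      have "mscale c f \<in> Hom ?B xs ys" if "f \<in> Hom ?B xs ys" for xs ys
        using that by (auto simp: additive_completion_simps Rep0_simps mscale_def lin_hom_scale
          module.scale_zero_right[OF module_cscale])
      then show ?thesis using that
        by (cases X; cases Y) (simp add: Rep_unfold idempotent_completion_simps mat_scale_left mat_scale_right)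
    qed
    show "Comp (Rep C t) X Y Z (mscale c g) f = mscale c (Comp (Rep C t) X Y Z g f)"
      by (cases X; cases Y; cases Z) (simp add: Rep_unfold idempotent_completion_simps mat_scale_left)
    show "Comp (Rep C t) X Y Z g (mscale c f) = mscale c (Comp (Rep C t) X Y Z g f)"
      by (cases X; cases Y; cases Z) (simp add: Rep_unfold idempotent_completion_simps mat_scale_right)
  next
    fix X :: rep_obj and v :: "nat \<Rightarrow> nat \<Rightarrow> nat \<Rightarrow> lin"
    assume "\<And>j. v j \<in> Hom (Rep C t) X X"
    then have "v j \<in> Hom (additive_completion (Rep0 C t)) (fst X) (fst X)" for j
      by (cases X) (simp add: Rep_unfold idempotent_completion_simps)
    then show "\<exists>c (N::nat). (\<exists>j\<le>N. c j \<noteq> 0) \<and> (\<Sum>j\<le>N. mscale (c j) (v j)) = 0"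
      by (rule matrices_dependent)
  qed
qed

lemma unit_mat_Hom: "M \<in> Hom (additive_completion (Rep0 C t)) [k] [l] \<longleftrightarrow> (\<exists>x \<in> lin_hom C k l. M = unit_mat x)"
proof
  assume M: "M \<in> Hom (additive_completion (Rep0 C t)) [k] [l]"
  then have "M 0 0 \<in> lin_hom C k l" "M = unit_mat (M 0 0)"
    by (auto simp: additive_completion_simps Rep0_simps unit_mat_def fun_eq_iff)
  then show "\<exists>x \<in> lin_hom C k l. M = unit_mat x" by blast
qed (auto simp: additive_completion_simps Rep0_simps unit_mat_def)

lemma unit_mat_Comp: "Comp (additive_completion (Rep0 C t)) [k] [l] [m] (unit_mat y) (unit_mat x) = unit_mat (y \<bullet> x)"
  by (auto simp: additive_completion_simps Rep0_simps unit_mat_def fun_eq_iff)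

lemma image_obj_Obj: "image_obj k e \<in> Obj (Rep C t) \<longleftrightarrow> e \<in> lin_hom C k k \<and> e \<bullet> e = e"
  unfolding image_obj_unit_mat Rep_unfold idempotent_completion_simps unit_mat_Hom
  by (auto simp: additive_completion_simps(1) Rep0_simps unit_mat_Comp)

lemma image_obj_Hom: "M \<in> Hom (Rep C t) (image_obj k e) (image_obj l f) \<longleftrightarrow>
    (\<exists>x \<in> lin_hom C k l. M = unit_mat x \<and> x \<bullet> e = x \<and> f \<bullet> x = x)"
  unfolding image_obj_unit_mat Rep_unfold idempotent_completion_simps unit_mat_Hom
  by (auto simp: unit_mat_Comp)

lemma image_obj_Comp: "Comp (Rep C t) (image_obj k e) (image_obj l f) (image_obj m g) (unit_mat y) (unit_mat x)
    = unit_mat (y \<bullet> x)"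
  unfolding image_obj_unit_mat Rep_unfold idempotent_completion_simps by (rule unit_mat_Comp)

lemma image_obj_Ident: "Ident (Rep C t) (image_obj k e) = unit_mat e"
  unfolding image_obj_unit_mat Rep_unfold idempotent_completion_simps ..

section \<open>The idempotent of a projective partition and its corner\<close>

definition u :: "nat \<Rightarrow> bool \<Rightarrow> lin" where
  "u T s = single (proj T s) (inverse (t ^ loops (proj T s) (proj T s)))"

lemma u_hom: "u T s \<in> lin_hom C (T + of_bool s) (T + of_bool s)"
  unfolding u_def by (intro lin_hom_single proj_C)

lemma proj_scale_u: "single (proj T s) 1 = cscale (t ^ loops (proj T s) (proj T s)) (u T s)"
  using t by (simp add: u_def cscale_single)

lemma pcomp_proj_proj: "pcomp (proj T s) (proj T s) = proj T s"
  using pcomp_proj_left[OF proj_partitions] proj_isolated by blast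

lemma u_idem: "u T s \<bullet> u T s = u T s"
  using t by (simp add: u_def lin_comp_single pcomp_proj_proj mult.assoc)

lemma u_proj: "u T s \<bullet> single (proj T s) 1 = single (proj T s) 1" "single (proj T s) 1 \<bullet> u T s = single (proj T s) 1"
  unfolding proj_scale_u lin_comp_scale_left lin_comp_scale_right u_idem by simp_all

lemma lookup_u: "lookup (u T s) (proj T s) \<noteq> 0"
  using t by (simp add: u_def)

lemma u_id: "u T False = single (id_ptn T) 1"
proof -
  have "id_ptn T \<in> partitions T T" using proj_partitions[of T False] by (simp add: proj_id)
  then show ?thesis using loops_id[of "id_ptn T" T T] by (simp add: u_def proj_id)
qed

abbreviation corner_of :: "nat \<Rightarrow> bool \<Rightarrow> lin set" where
  "corner_of T s \<equiv> corner C t (T + of_bool s) (proj T s)"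

text \<open>\<open>u T s\<close> is a non-zero multiple of \<open>proj T s\<close>, so the corner
  can be cut out by an idempotent, and its elements are those fixed by that idempotent on both
  sides.\<close>

lemma corner_iff:
  "x \<in> corner_of T s \<longleftrightarrow> x \<in> lin_hom C (T + of_bool s) (T + of_bool s) \<and> u T s \<bullet> x = x \<and> x \<bullet> u T s = x"
proof -
  let ?K = "T + of_bool s" and ?p = "single (proj T s) 1"
  have p: "?p \<in> lin_hom C ?K ?K" by (intro lin_hom_single proj_C)
  note u = u_hom[of T s]
  show ?thesis
  proof
    assume "x \<in> corner_of T s"
    then obtain y where y: "y \<in> lin_hom C ?K ?K" "x = ?p \<bullet> (y \<bullet> ?p)" by (auto simp: corner_def)
    have yp: "y \<bullet> ?p \<in> lin_hom C ?K ?K" using lin_hom_comp p y by blast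
    have "u T s \<bullet> x = x" unfolding y comp_assoc[OF yp p u, symmetric] u_proj ..
    moreover have "x \<bullet> u T s = x" unfolding y comp_assoc[OF u yp p] comp_assoc[OF u p y(1)] u_proj ..
    ultimately show "x \<in> lin_hom C ?K ?K \<and> u T s \<bullet> x = x \<and> x \<bullet> u T s = x"
      using lin_hom_comp[OF yp p] y by simp
  next
    assume x: "x \<in> lin_hom C ?K ?K \<and> u T s \<bullet> x = x \<and> x \<bullet> u T s = x"
    let ?c = "t ^ loops (proj T s) (proj T s)"
    \<comment> \<open>Each of the two outer factors \<open>?p\<close> multiplies by
      \<open>?c\<close>; the scalar cancels both.\<close>
    let ?y = "cscale (inverse (?c * ?c)) x"
    have "?p \<bullet> (?y \<bullet> ?p) = cscale (?c * (?c * inverse (?c * ?c))) x"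
      using x unfolding proj_scale_u lin_comp_scale_left lin_comp_scale_right
      by (simp add: module.scale_scale[OF module_cscale] mult_ac)
    also have "?c * (?c * inverse (?c * ?c)) = 1" using t by (simp add: field_simps)
    finally have "x = ?p \<bullet> (?y \<bullet> ?p)" by (simp only: module.scale_one[OF module_cscale])
    moreover have "?y \<in> lin_hom C ?K ?K" using x by (intro lin_hom_scale) simp
    ultimately show "x \<in> corner_of T s" unfolding corner_def by (rule image_eqI)
  qed
qed

text \<open>The factors \<open>proj T s\<close> on both sides leave the surplus points isolated, as
  \<open>proj_unique\<close> requires. Hence \<open>proj T s\<close> is the only partition in the
  corner that does not belong to lower terms.\<close>

lemma corner_keys:
  assumes "x \<in> corner_of T s" "q \<in> keys x" "T \<le> through_blocks q"
  shows "q = proj T s"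
proof (rule proj_unique)
  let ?K = "T + of_bool s" and ?p = "single (proj T s) 1"
  have "x \<in> lin_hom C ?K ?K" using assms by (simp add: corner_iff)
  then show "q \<in> C ?K ?K" using assms by (auto simp: lin_hom_def)
  show "T \<le> through_blocks q" by fact
  obtain y where y: "x = ?p \<bullet> (y \<bullet> ?p)" using assms by (auto simp: corner_def)
  obtain r' where r': "q = pcomp (proj T s) r'" "r' \<in> keys (y \<bullet> ?p)"
    using assms(2) keys_lin_comp[of t ?p "y \<bullet> ?p"] unfolding y by (auto split: if_splits)
  then obtain r where q: "q = pcomp (proj T s) (pcomp r (proj T s))"
    using keys_lin_comp[of t y ?p] by (auto split: if_splits)
  show "isolated q (Up (T + 1)) \<and> isolated q (Low (T + 1))" if s
    unfolding q using that by (intro conjI isolated_pcomp_Up isolated_pcomp_Low proj_isolated)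
qed

section \<open>The filtration by through-blocks\<close>

text \<open>A filtration of all morphism spaces at once, compatible with composition on either side
  by \<open>low_comp\<close>. Its part \<open>low T\<close> meets the corner of
  \<open>proj T s\<close> in the ideal $I_p$.\<close>

definition low :: "nat \<Rightarrow> lin set" where
  "low n = {x. \<forall>q \<in> keys x. through_blocks q < n}"

lemma low_mono: "x \<in> low m \<Longrightarrow> m \<le> n \<Longrightarrow> x \<in> low n"
  by (auto simp: low_def)

lemma low_add: "x \<in> low n \<Longrightarrow> y \<in> low n \<Longrightarrow> x + y \<in> low n"
  using keys_add[of x y] by (auto simp: low_def)

lemma low_diff: "x \<in> low n \<Longrightarrow> y \<in> low n \<Longrightarrow> x - y \<in> low n"
  using keys_diff[of x y] by (auto simp: low_def)

lemma low_scale: "x \<in> low n \<Longrightarrow> cscale c x \<in> low n"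
  using keys_cscale[of c x] by (auto simp: low_def)

lemma low_comp:
  assumes x: "x \<in> lin_hom C k l" and y: "y \<in> lin_hom C l m" and "x \<in> low n \<or> y \<in> low n"
  shows "y \<bullet> x \<in> low n"
  unfolding low_def
proof (intro CollectI ballI)
  fix r assume "r \<in> keys (y \<bullet> x)"
  then obtain q p where r: "r = pcomp q p" "q \<in> keys y" "p \<in> keys x" using keys_lin_comp by blast
  then have "p \<in> partitions k l" "q \<in> partitions l m"
    using x y C_partitions by (auto simp: lin_hom_def)
  then have "through_blocks r \<le> through_blocks p" "through_blocks r \<le> through_blocks q"
    unfolding r(1) by (rule through_blocks_pcomp_upper through_blocks_pcomp_lower)+
  then show "through_blocks r < n" using assms(3) r unfolding low_def by fastforce
qed

lemma u_low: "u T s \<in> low n \<longleftrightarrow> T < n"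
  using t by (auto simp: low_def u_def through_blocks_proj)

lemma scale_u_low: "cscale a (u T s) \<in> low T \<Longrightarrow> a = 0"
  using t by (auto simp: low_def u_def cscale_single through_blocks_proj split: if_splits)

lemma corner_ideal_iff: "x \<in> corner_ideal C t (T + of_bool s) (proj T s) \<longleftrightarrow> x \<in> corner_of T s \<and> x \<in> low T"
  by (auto simp: corner_ideal_def low_def through_blocks_proj)

lemma corner_u: "u T s \<in> corner_of T s"
  by (simp add: corner_iff u_hom u_idem)

lemma corner_diff: "x \<in> corner_of T s \<Longrightarrow> y \<in> corner_of T s \<Longrightarrow> x - y \<in> corner_of T s"
proof -
  assume "x \<in> corner_of T s" "y \<in> corner_of T s"
  moreover have "u T s \<bullet> (x - y) = u T s \<bullet> x - u T s \<bullet> y" "(x - y) \<bullet> u T s = x \<bullet> u T s - y \<bullet> u T s"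
    using lin_comp_add_right[of t "u T s" "x - y" y] lin_comp_add_left[of t "x - y" y "u T s"] by simp_all
  ultimately show ?thesis by (simp add: corner_iff lin_hom_diff)
qed

lemma comp_diff_right: "z \<bullet> (x - y) = z \<bullet> x - z \<bullet> y" and comp_diff_left: "(x - y) \<bullet> z = x \<bullet> z - y \<bullet> z"
  using lin_comp_add_right[of t z "x - y" y] lin_comp_add_left[of t "x - y" y z] by simp_all

lemma corner_decompose:
  assumes x: "x \<in> corner_of T s"
  obtains a where "x - cscale a (u T s) \<in> low T"
proof
  let ?p = "proj T s"
  let ?a = "lookup x ?p * inverse (lookup (u T s) ?p)"
  show "x - cscale ?a (u T s) \<in> low T"
    unfolding low_def
  proof (intro CollectI ballI, rule ccontr)
    fix q assume q: "q \<in> keys (x - cscale ?a (u T s))" and "\<not> through_blocks q < T"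
    have k: "keys (cscale ?a (u T s)) \<subseteq> {?p}" using keys_cscale[of ?a "u T s"] by (auto simp: u_def split: if_splits)
    have "q = ?p"
    proof (cases "q \<in> keys x")
      case True
      then show ?thesis using corner_keys[OF x] \<open>\<not> through_blocks q < T\<close> by simp
    next
      case False
      then show ?thesis using q keys_diff[of x "cscale ?a (u T s)"] k by blast
    qed
    moreover have "lookup (x - cscale ?a (u T s)) ?p = 0"
      using lookup_u[of T s] by (simp add: lookup_minus lookup_cscale)
    ultimately show False using q by (simp add: in_keys_iff)
  qed
qed

text \<open>Modulo \<open>low T\<close> the corner is spanned by \<open>u T s\<close>. If
  \<open>x\<close> is congruent to \<open>a\<close> times that unit, idempotence forces
  \<open>a = a * a\<close>, hence \<open>a\<close> is 0 or 1.\<close>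

lemma corner_idempotent:
  assumes x: "x \<in> corner_of T s" "x \<bullet> x = x"
  shows "x \<in> low T \<or> x - u T s \<in> low T"
proof -
  let ?K = "T + of_bool s" and ?u = "u T s"
  obtain a where a: "x - cscale a ?u \<in> low T" using corner_decompose[OF x(1)] .
  have xH: "x \<in> lin_hom C ?K ?K" and ux: "?u \<bullet> x = x" "x \<bullet> ?u = x" using x by (simp_all add: corner_iff)
  have "x \<bullet> (x - cscale a ?u) \<in> low T"
    by (rule low_comp[OF _ xH]) (use a xH u_hom lin_hom_scale lin_hom_diff in blast)+
  then have "x - cscale a x \<in> low T" by (simp add: comp_diff_right x lin_comp_scale_right ux)
  \<comment> \<open>Subtracting \<open>(1 - a)\<close> times the congruence for \<open>x\<close>
    eliminates \<open>x\<close> and leaves a multiple of \<open>u T s\<close>.\<close>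
  then have "(x - cscale a x) - ((x - cscale a ?u) - cscale a (x - cscale a ?u)) \<in> low T"
    using a low_diff low_scale by blast
  moreover have "(x - cscale a x) - ((x - cscale a ?u) - cscale a (x - cscale a ?u)) = cscale (a - a * a) ?u"
    by (rule poly_mapping_eqI) (simp add: lookup_minus lookup_add lookup_cscale algebra_simps)
  ultimately have "a - a * a = 0" using scale_u_low by metis
  then have "a = 0 \<or> a = 1" by algebra
  then show ?thesis
    using a module.scale_one[OF module_cscale] module.scale_zero_left[OF module_cscale] by auto
qed

section \<open>Primitive lifts of the unit\<close>

lemma primitive_lift_iff:
  "primitive_lift C t (T + of_bool s) (proj T s) e \<longleftrightarrow>
     primitive_idempotent t (corner_of T s) e \<and> e - u T s \<in> low T"
  unfolding primitive_lift_def u_def[symmetric] corner_ideal_iff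
  using corner_diff[OF _ corner_u] unfolding primitive_idempotent_def by blast

lemma lift_not_low: "e - u T s \<in> low T \<Longrightarrow> e \<notin> low T"
  using low_diff[of e T "e - u T s"] u_low[of T s T] by auto

text \<open>Without a primitive lift, every lift would split into two non-zero orthogonal
  idempotents, one of which is again a lift and splits further. This produces arbitrarily many
  non-zero orthogonal idempotents, which are linearly independent in a finite-dimensional
  space.\<close>

lemma primitive_lift_exists: "\<exists>e. primitive_lift C t (T + of_bool s) (proj T s) e"
proof (rule ccontr)
  assume no: "\<not> ?thesis"
  let ?K = "T + of_bool s" and ?R = "corner_of T s"
  have H: "x \<in> lin_hom C ?K ?K" if "x \<in> ?R" for x using that by (simp add: corner_iff)
  let ?orth = "\<lambda>(n::nat) v. \<forall>i<n. v i \<in> ?R \<and> v i \<noteq> 0 \<and> v i \<bullet> v i = v i \<and> (\<forall>j<n. i \<noteq> j \<longrightarrow> v i \<bullet> v j = 0)"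
  \<comment> \<open>\<open>f\<close> is the summand that is again congruent to the unit; by
    \<open>corner_idempotent\<close> at least one of the two is, as they are not both in
    \<open>low T\<close>.\<close>
  have step: "\<exists>f g. f \<in> ?R \<and> g \<in> ?R \<and> f \<bullet> f = f \<and> g \<bullet> g = g \<and> f \<bullet> g = 0 \<and> g \<bullet> f = 0 \<and> e = f + g \<and> g \<noteq> 0 \<and> f - u T s \<in> low T"
    if e: "e \<in> ?R" "e \<bullet> e = e" "e - u T s \<in> low T" for e
  proof -
    have "e \<noteq> 0" using lift_not_low[OF e(3)] by (auto simp: low_def)
    then obtain f g where fg: "f \<in> ?R" "g \<in> ?R" "f \<bullet> f = f" "g \<bullet> g = g" "f \<bullet> g = 0" "g \<bullet> f = 0" "e = f + g" "f \<noteq> 0" "g \<noteq> 0"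
      using no e unfolding primitive_lift_iff primitive_idempotent_def by blast
    have "\<not> (f \<in> low T \<and> g \<in> low T)" using low_add lift_not_low[OF e(3)] fg(7) by blast
    then have "f - u T s \<in> low T \<or> g - u T s \<in> low T"
      using corner_idempotent[OF fg(1,3)] corner_idempotent[OF fg(2,4)] by blast
    then show ?thesis
    proof
      assume "f - u T s \<in> low T"
      then show ?thesis using fg by blast
    next
      assume "g - u T s \<in> low T"
      then show ?thesis using fg by (intro exI[of _ g] exI[of _ f]) (simp add: add.commute)
    qed
  qed
  \<comment> \<open>\<open>e\<close> is the lift still to be split and \<open>v\<close> lists the
    idempotents split off so far. Orthogonality of \<open>e\<close> to all of them passes to its
    summands, so that \<open>g\<close> can be appended to the list.\<close>
  have family: "\<exists>e v. e \<in> ?R \<and> e \<bullet> e = e \<and> e - u T s \<in> low T \<and> ?orth n v \<and> (\<forall>i<n. e \<bullet> v i = 0 \<and> v i \<bullet> e = 0)" for n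
  proof (induction n)
    case 0
    show ?case using corner_u u_idem by (intro exI[of _ "u T s"] exI[of _ "\<lambda>_. 0"]) (simp add: low_def)
  next
    case (Suc n)
    then obtain e v where e: "e \<in> ?R" "e \<bullet> e = e" "e - u T s \<in> low T"
      and v: "?orth n v" "\<forall>i<n. e \<bullet> v i = 0 \<and> v i \<bullet> e = 0" by blast
    obtain f g where fg: "f \<in> ?R" "g \<in> ?R" "f \<bullet> f = f" "g \<bullet> g = g" "f \<bullet> g = 0" "g \<bullet> f = 0" "e = f + g"
      "g \<noteq> 0" "f - u T s \<in> low T" using step[OF e] by blast
    have ef: "f \<bullet> e = f" "e \<bullet> f = f" "g \<bullet> e = g" "e \<bullet> g = g"
      unfolding fg(7) by (simp_all add: lin_comp_add_left lin_comp_add_right fg(3-6))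
    have "f \<bullet> v i = 0 \<and> v i \<bullet> f = 0 \<and> g \<bullet> v i = 0 \<and> v i \<bullet> g = 0" if "i < n" for i
    proof -
      have vi: "v i \<in> lin_hom C ?K ?K" "e \<bullet> v i = 0" "v i \<bullet> e = 0" using v that H by auto
      have "x \<bullet> v i = (x \<bullet> e) \<bullet> v i" if "x \<bullet> e = x" for x using that by simp
      have "x \<bullet> v i = 0" if "x \<bullet> e = x" "x \<in> ?R" for x
        using comp_assoc[OF vi(1) H[OF e(1)] H[OF that(2)]] that vi by simp
      moreover have "v i \<bullet> x = 0" if "e \<bullet> x = x" "x \<in> ?R" for x
        using comp_assoc[OF H[OF that(2)] H[OF e(1)] vi(1)] that vi by simp
      ultimately show ?thesis using ef fg by blast
    qed
    then show ?case
      using fg v by (intro exI[of _ f] exI[of _ "v(n := g)"]) (auto simp: less_Suc_eq)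
  qed
  have "\<exists>v. ?orth n v" for n using family[of n] by (elim exE conjE) (rule exI)
  \<comment> \<open>One idempotent more than the dimension of the endomorphism algebra.\<close>
  from this[of "Suc (card (C ?K ?K))"] obtain v where v: "?orth (Suc (card (C ?K ?K))) v" by (elim exE)
  obtain c where c: "\<exists>j\<in>{..card (C ?K ?K)}. c j \<noteq> 0"
    "\<forall>p\<in>C ?K ?K. (\<Sum>j\<in>{..card (C ?K ?K)}. c j * lookup (v j) p) = 0"
    using finite_coordinates_dependent[OF finite_C, of "{..card (C ?K ?K)}" ?K ?K "\<lambda>j p. lookup (v j) p"] by auto
  have "(\<Sum>j\<le>card (C ?K ?K). cscale (c j) (v j)) = 0"
  proof (rule poly_mapping_eqI)
    fix p
    have "(\<Sum>j\<le>card (C ?K ?K). c j * lookup (v j) p) = 0"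
    proof (cases "p \<in> C ?K ?K")
      case False
      then have "lookup (v j) p = 0" if "j \<le> card (C ?K ?K)" for j
        using v H[of "v j"] that by (auto simp: lin_hom_def in_keys_iff less_Suc_eq_le)
      then show ?thesis by simp
    qed (use c in blast)
    then show "lookup (\<Sum>j\<le>card (C ?K ?K). cscale (c j) (v j)) p = lookup 0 p"
      by (simp add: lookup_sum lookup_cscale)
  qed
  moreover obtain j0 where j0: "j0 \<le> card (C ?K ?K)" "c j0 \<noteq> 0" using c by auto
  \<comment> \<open>Multiplication by \<open>v j0\<close> annihilates all other terms of the
    relation.\<close>
  ultimately have "0 = v j0 \<bullet> (\<Sum>j\<le>card (C ?K ?K). cscale (c j) (v j))" by simp
  also have "\<dots> = (\<Sum>j\<le>card (C ?K ?K). cscale (c j) (v j0 \<bullet> v j))"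
    by (simp add: lin_comp_sum_right lin_comp_scale_right)
  also have "\<dots> = (\<Sum>j\<le>card (C ?K ?K). if j = j0 then cscale (c j) (v j0) else 0)"
    by (rule sum.cong) (use v j0 in \<open>auto simp: less_Suc_eq_le module.scale_zero_right[OF module_cscale]\<close>)
  also have "\<dots> = cscale (c j0) (v j0)" using j0 by simp
  finally have "cscale (inverse (c j0)) (cscale (c j0) (v j0)) = 0"
    by (simp add: module.scale_zero_right[OF module_cscale])
  then have "v j0 = 0"
    using j0 by (simp add: module.scale_scale[OF module_cscale] module.scale_one[OF module_cscale])
  moreover have "v j0 \<noteq> 0" using v j0(1) less_Suc_eq_le by blast
  ultimately show False by contradiction
qed

abbreviation im :: "nat \<Rightarrow> bool \<Rightarrow> lin \<Rightarrow> rep_obj" where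
  "im T s e \<equiv> image_obj (T + of_bool s) e"

lemma im_u_Obj: "im T s (u T s) \<in> Obj (Rep C t)"
  by (simp add: image_obj_Obj u_hom u_idem)

lemma lift_facts:
  assumes "primitive_lift C t (T + of_bool s) (proj T s) e"
  shows "e \<in> corner_of T s" "e \<bullet> e = e" "e - u T s \<in> low T"
    "e \<in> lin_hom C (T + of_bool s) (T + of_bool s)" "u T s \<bullet> e = e" "e \<bullet> u T s = e"
    "im T s e \<in> Obj (Rep C t)"
  using assms unfolding primitive_lift_iff primitive_idempotent_def corner_iff image_obj_Obj by blast+

text \<open>An idempotent \<open>f\<close> of the image satisfies
  \<open>f = f \<bullet> e = e \<bullet> f\<close>, so \<open>e\<close> is the orthogonal sum of
  \<open>f\<close> and \<open>e - f\<close> within the corner, and primitivity makes one of them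
  0.\<close>

lemma lift_connected:
  assumes e: "primitive_lift C t (T + of_bool s) (proj T s) e"
  shows "K.connected_end (im T s e)"
  unfolding K.connected_end_def
proof (intro conjI ballI impI)
  note ef = lift_facts[OF e]
  show "im T s e \<in> Obj (Rep C t)" by (rule ef)
  show "Ident (Rep C t) (im T s e) \<noteq> 0"
    using e by (simp add: image_obj_Ident primitive_lift_def primitive_idempotent_def)
  fix M assume M: "M \<in> Hom (Rep C t) (im T s e) (im T s e)"
    and MM: "Comp (Rep C t) (im T s e) (im T s e) (im T s e) M M = M"
  then obtain f where f: "f \<in> lin_hom C (T + of_bool s) (T + of_bool s)" "M = unit_mat f" "f \<bullet> e = f" "e \<bullet> f = f"
    unfolding image_obj_Hom by blast
  have ff: "f \<bullet> f = f" using MM unfolding f(2) image_obj_Comp by simp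
  have "u T s \<bullet> f = f" using comp_assoc[OF f(1) ef(4) u_hom, of T s] ef(5) f(4) by simp
  moreover have "f \<bullet> u T s = f" using comp_assoc[OF u_hom ef(4) f(1), of T s] ef(6) f(3) by simp
  ultimately have fc: "f \<in> corner_of T s" using f(1) by (simp add: corner_iff)
  have gc: "e - f \<in> corner_of T s" using corner_diff ef(1) fc .
  have "f = 0 \<or> e - f = 0"
    using e fc gc ff f(3,4) ef(2) unfolding primitive_lift_def primitive_idempotent_def
    by (auto simp: comp_diff_left comp_diff_right)
  then show "M = 0 \<or> M = Ident (Rep C t) (im T s e)"
    by (auto simp: f(2) image_obj_Ident)
qed

text \<open>This is what makes the definite description in \<open>L_triv\<close> meaningful. Since
  \<open>e\<close> and \<open>f\<close> agree modulo \<open>low T\<close>, so do \<open>e\<close>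
  and \<open>?efe\<close>. Hence in the decomposition of \<open>e\<close> into \<open>?efe\<close>
  and \<open>e - ?efe\<close> the first term must have a left inverse \<open>z\<close>, and
  \<open>z \<bullet> ?ef\<close> is then a left inverse of \<open>?fe\<close>, viewed as a morphism
  between the images.\<close>

lemma lifts_isomorphic:
  assumes e: "primitive_lift C t (T + of_bool s) (proj T s) e"
    and f: "primitive_lift C t (T + of_bool s) (proj T s) f"
  shows "isomorphic (Rep C t) (im T s e) (im T s f)"
proof (rule K.retract_connected_isomorphic)
  let ?K = "T + of_bool s" and ?X = "im T s e" and ?Y = "im T s f"
  note ef = lift_facts[OF e] and ff = lift_facts[OF f]
  show "?X \<in> Obj (Rep C t)" "Ident (Rep C t) ?X \<noteq> 0" "K.connected_end ?Y"
    using lift_connected[OF e] lift_connected[OF f] by (simp_all add: K.connected_end_def)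
  let ?fe = "f \<bullet> e" and ?ef = "e \<bullet> f"
  let ?efe = "?ef \<bullet> e"
  have H: "?fe \<in> lin_hom C ?K ?K" "?ef \<in> lin_hom C ?K ?K" "?efe \<in> lin_hom C ?K ?K"
    using lin_hom_comp ef(4) ff(4) by blast+
  have efe: "?efe \<bullet> e = ?efe" "e \<bullet> ?efe = ?efe"
    using comp_assoc[OF ef(4) ef(4) H(2)] comp_assoc[OF ef(4) H(2) ef(4)] comp_assoc[OF ff(4) ef(4) ef(4)] ef(2)
    by simp_all
  have a: "unit_mat ?efe \<in> Hom (Rep C t) ?X ?X" unfolding image_obj_Hom using H efe by blast
  have b: "unit_mat (e - ?efe) \<in> Hom (Rep C t) ?X ?X"
    unfolding image_obj_Hom using lin_hom_diff[OF ef(4) H(3)] efe ef(2)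
    by (intro bexI[of _ "e - ?efe"]) (simp_all add: comp_diff_left comp_diff_right)
  have sum: "unit_mat ?efe + unit_mat (e - ?efe) = Ident (Rep C t) ?X"
    by (simp add: image_obj_Ident unit_mat_add[symmetric])
  have small: "e - ?efe \<in> low T"
  proof -
    have "e - f \<in> low T" using low_diff[OF ef(3) ff(3)] by simp
    then have "e \<bullet> (e - f) \<in> low T" using low_comp[OF lin_hom_diff[OF ef(4) ff(4)] ef(4)] by blast
    then have "(e \<bullet> (e - f)) \<bullet> e \<in> low T"
      using low_comp[OF ef(4) lin_hom_comp[OF lin_hom_diff[OF ef(4) ff(4)] ef(4)]] by blast
    then show ?thesis by (simp add: comp_diff_right comp_diff_left ef(2))
  qed
  obtain Z where Z: "Z \<in> Hom (Rep C t) ?X ?X"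
    "Comp (Rep C t) ?X ?X ?X Z (unit_mat ?efe) = Ident (Rep C t) ?X \<or>
     Comp (Rep C t) ?X ?X ?X Z (unit_mat (e - ?efe)) = Ident (Rep C t) ?X"
    using K.left_inverse_cases[OF lift_connected[OF e] a b sum] by blast
  then obtain z where z: "z \<in> lin_hom C ?K ?K" "Z = unit_mat z" "z \<bullet> e = z" "e \<bullet> z = z"
    unfolding image_obj_Hom by blast
  have "z \<bullet> ?efe = e \<or> z \<bullet> (e - ?efe) = e"
    using Z(2) unfolding z(2) image_obj_Comp image_obj_Ident by simp
  \<comment> \<open>The left side lies in \<open>low T\<close>, whereas a lift of the unit does
    not.\<close>
  moreover have "z \<bullet> (e - ?efe) \<noteq> e"
    using low_comp[OF lin_hom_diff[OF ef(4) H(3)] z(1)] small lift_not_low[OF ef(3)] by metis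
  ultimately have ze: "z \<bullet> ?efe = e" by blast
  show "K.retract ?X ?Y"
    unfolding K.retract_def
  proof (rule bexI[of _ "unit_mat ?fe"], rule bexI[of _ "unit_mat (z \<bullet> ?ef)"])
    have "(z \<bullet> ?ef) \<bullet> ?fe = z \<bullet> (?ef \<bullet> ?fe)" using comp_assoc[OF H(1,2) z(1)] .
    also have "?ef \<bullet> ?fe = e \<bullet> (f \<bullet> ?fe)" using comp_assoc[OF H(1) ff(4) ef(4)] .
    also have "f \<bullet> ?fe = ?fe" using comp_assoc[OF ef(4) ff(4) ff(4)] ff(2) by simp
    also have "e \<bullet> ?fe = ?efe" using comp_assoc[OF ef(4) ff(4) ef(4)] by simp
    finally show "Comp (Rep C t) ?X ?Y ?X (unit_mat (z \<bullet> ?ef)) (unit_mat ?fe) = Ident (Rep C t) ?X"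
      unfolding image_obj_Comp image_obj_Ident ze by simp
    have "?fe \<bullet> e = ?fe" "f \<bullet> ?fe = ?fe"
      using comp_assoc[OF ef(4) ef(4) ff(4)] comp_assoc[OF ef(4) ff(4) ff(4)] ef(2) ff(2) by simp_all
    then show "unit_mat ?fe \<in> Hom (Rep C t) ?X ?Y" unfolding image_obj_Hom using H by blast
    have "?ef \<bullet> f = ?ef" using comp_assoc[OF ff(4) ff(4) ef(4)] ff(2) by simp
    then have "(z \<bullet> ?ef) \<bullet> f = z \<bullet> ?ef" using comp_assoc[OF ff(4) H(2) z(1)] by simp
    moreover have "e \<bullet> (z \<bullet> ?ef) = z \<bullet> ?ef" using comp_assoc[OF H(2) z(1) ef(4)] z(4) by simp
    ultimately show "unit_mat (z \<bullet> ?ef) \<in> Hom (Rep C t) ?Y ?X"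
      unfolding image_obj_Hom using lin_hom_comp[OF H(2) z(1)] by blast
  qed
qed

lemma L_triv_eq:
  assumes e: "primitive_lift C t (T + of_bool s) (proj T s) e"
  shows "L_triv C t (T + of_bool s) (proj T s) = iso_class (Rep C t) (im T s e)"
  unfolding L_triv_def
proof (rule the_equality)
  fix X assume "\<exists>f. primitive_lift C t (T + of_bool s) (proj T s) f \<and> X = iso_class (Rep C t) (im T s f)"
  then obtain f where f: "primitive_lift C t (T + of_bool s) (proj T s) f" "X = iso_class (Rep C t) (im T s f)"
    by blast
  then show "X = iso_class (Rep C t) (im T s e)"
    using lifts_isomorphic[OF f(1) e] K.iso_class_eq_iff[OF lift_facts(7)[OF f(1)] lift_facts(7)[OF e]] by simp
qed (use e in blast)

lemma lift_retract_bound: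
  assumes e: "primitive_lift C t (T + of_bool s) (proj T s) e"
    and f: "primitive_lift C t (T' + of_bool s') (proj T' s') f"
    and "K.retract (im T s e) (im T' s' f)"
  shows "T \<le> T'" and "even (T + of_bool s + (T' + of_bool s'))"
proof -
  let ?K = "T + of_bool s" and ?K' = "T' + of_bool s'"
  note ef = lift_facts[OF e] and ff = lift_facts[OF f]
  obtain M N where "M \<in> Hom (Rep C t) (im T s e) (im T' s' f)" "N \<in> Hom (Rep C t) (im T' s' f) (im T s e)"
    and NM: "Comp (Rep C t) (im T s e) (im T' s' f) (im T s e) N M = Ident (Rep C t) (im T s e)"
    using assms(3) unfolding K.retract_def by blast
  then obtain x y where x: "x \<in> lin_hom C ?K ?K'" "M = unit_mat x" "f \<bullet> x = x"
    and y: "y \<in> lin_hom C ?K' ?K" "N = unit_mat y"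
    unfolding image_obj_Hom by blast
  have yx: "y \<bullet> x = e" using NM unfolding x y image_obj_Comp image_obj_Ident by simp
  have "u T' s' \<bullet> x = x" using comp_assoc[OF x(1) ff(4) u_hom, of T' s'] ff(5) x(3) by simp
  \<comment> \<open>\<open>low\<close> is defined by a strict inequality, so passing through
    \<open>T'\<close> through-blocks means membership in \<open>low (Suc T')\<close>.\<close>
  moreover have "u T' s' \<bullet> x \<in> low (Suc T')" by (rule low_comp[OF x(1) u_hom]) (simp add: u_low)
  ultimately have "x \<in> low (Suc T')" by simp
  then have "e \<in> low (Suc T')" using low_comp[OF x(1) y(1)] yx by metis
  then show "T \<le> T'" using lift_not_low[OF ef(3)] low_mono not_less_eq_eq by blast
  have "x \<noteq> 0" using yx lift_not_low[OF ef(3)] by (auto simp: low_def)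
  then obtain p where "p \<in> keys x" by (metis keys_eq_empty ex_in_conv)
  then have "p \<in> C ?K ?K'" using x(1) by (auto simp: lin_hom_def)
  then show "even (?K + ?K')" by (rule C_even)
qed

lemma L_triv_inject:
  assumes "L_triv C t (T + of_bool s) (proj T s) = L_triv C t (T' + of_bool s') (proj T' s')"
  shows "T = T' \<and> s = s'"
proof -
  obtain e f where e: "primitive_lift C t (T + of_bool s) (proj T s) e"
    and f: "primitive_lift C t (T' + of_bool s') (proj T' s') f" using primitive_lift_exists by metis
  have i: "isomorphic (Rep C t) (im T s e) (im T' s' f)"
    using assms K.iso_class_eq_iff[OF lift_facts(7)[OF e] lift_facts(7)[OF f]]
    unfolding L_triv_eq[OF e] L_triv_eq[OF f] by simp
  have "T \<le> T'" "even (T + of_bool s + (T' + of_bool s'))" "T' \<le> T"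
    using lift_retract_bound[OF e f] lift_retract_bound[OF f e] K.isomorphic_retract i K.isomorphic_sym by blast+
  then show ?thesis by (cases s; cases s') auto
qed

lemma L_triv_indecomposable:
  "L_triv C t (T + of_bool s) (proj T s) \<in> indecomposable_classes (Rep C t)"
proof -
  obtain e where e: "primitive_lift C t (T + of_bool s) (proj T s) e" using primitive_lift_exists by metis
  show ?thesis
    unfolding L_triv_eq[OF e] indecomposable_classes_def
    using K.connected_indecomposable[OF lift_connected[OF e]] by blast
qed

section \<open>Every indecomposable object is obtained\<close>

text \<open>By \<open>e = e e\<close>, the identity of \<open>(xs, e)\<close> is the sum over the
  positions of \<open>xs\<close> of a column of \<open>e\<close> times the corresponding row, and
  each term factors through a single object \<open>[k]\<close>.\<close>

lemma retract_of_generator: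
  assumes X: "K.connected_end X"
  shows "\<exists>k. K.retract X (im k False (u k False))"
proof -
  obtain xs e where Xeq: "X = (xs, e)" by (cases X)
  let ?B = "additive_completion (Rep0 C t)"
  have "X \<in> Obj (Rep C t)" using X by (simp add: K.connected_end_def)
  then have e: "e \<in> Hom ?B xs xs" "Comp ?B xs xs xs e e = e"
    by (simp_all add: Xeq Rep_unfold idempotent_completion_simps)
  let ?n = "length xs"
  have eH: "e i j \<in> lin_hom C (xs ! j) (xs ! i)" if "i < ?n" "j < ?n" for i j
    using e(1) that by (simp add: additive_completion_simps Rep0_simps)
  have e0: "e i j = 0" if "\<not> (i < ?n \<and> j < ?n)" for i j
    using e(1) that unfolding additive_completion_simps by blast
  have ee: "(\<Sum>r<?n. e i r \<bullet> e r j) = e i j" if "i < ?n" "j < ?n" for i j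
    using fun_cong[OF fun_cong[OF e(2), of i], of j] that by (simp add: additive_completion_simps Rep0_simps)
  let ?Y = "\<lambda>i. im (xs ! i) False (u (xs ! i) False)"
  \<comment> \<open>Row \<open>i\<close> of \<open>e\<close> as a morphism to the object at position
    \<open>i\<close>; \<open>?b i\<close> is column \<open>i\<close>, as a morphism back.\<close>
  let ?a = "\<lambda>i r j. if r = (0::nat) then e i j else 0"
  let ?b = "\<lambda>i r j. if j = (0::nat) then e r i else 0"
  have Y: "?Y i = ([xs ! i], unit_mat (single (id_ptn (xs ! i)) 1))" for i
    by (simp add: image_obj_unit_mat u_id)
  have a: "?a i \<in> Hom (Rep C t) X (?Y i)" if i: "i < ?n" for i
  proof -
    have 1: "?a i \<in> Hom ?B xs [xs ! i]"
      using eH[OF i] e0 by (auto simp: additive_completion_simps Rep0_simps)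
    moreover have "Comp ?B xs xs [xs ! i] (?a i) e = ?a i"
      using ee[OF i] e0 by (auto simp: additive_completion_simps Rep0_simps fun_eq_iff)
    moreover have "Comp ?B xs [xs ! i] [xs ! i] (unit_mat (single (id_ptn (xs ! i)) 1)) (?a i) = ?a i"
      using comp_id_left[OF eH[OF i]] e0 by (auto simp: additive_completion_simps Rep0_simps fun_eq_iff unit_mat_def)
    ultimately show ?thesis unfolding Xeq Y Rep_unfold idempotent_completion_simps by blast
  qed
  have b: "?b i \<in> Hom (Rep C t) (?Y i) X" if i: "i < ?n" for i
  proof -
    have 1: "?b i \<in> Hom ?B [xs ! i] xs"
      using eH[OF _ i] e0 by (auto simp: additive_completion_simps Rep0_simps)
    moreover have "Comp ?B [xs ! i] xs xs e (?b i) = ?b i"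
      using ee[OF _ i] e0 by (auto simp: additive_completion_simps Rep0_simps fun_eq_iff)
    moreover have "Comp ?B [xs ! i] [xs ! i] xs (?b i) (unit_mat (single (id_ptn (xs ! i)) 1)) = ?b i"
      using comp_id_right[OF eH[OF _ i]] e0 by (auto simp: additive_completion_simps Rep0_simps fun_eq_iff unit_mat_def)
    ultimately show ?thesis unfolding Xeq Y Rep_unfold idempotent_completion_simps by blast
  qed
  have ab: "Comp (Rep C t) X (?Y i) X (?b i) (?a i) = (\<lambda>r j. e r i \<bullet> e i j)" if "i < ?n" for i
    unfolding Xeq Y Rep_unfold idempotent_completion_simps
    using e0 by (auto simp: additive_completion_simps Rep0_simps fun_eq_iff)
  have "(\<Sum>i\<in>{..<?n}. Comp (Rep C t) X (?Y i) X (?b i) (?a i)) = e"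
  proof (intro ext)
    fix r j
    have "(\<Sum>i\<in>{..<?n}. Comp (Rep C t) X (?Y i) X (?b i) (?a i)) r j = (\<Sum>i<?n. e r i \<bullet> e i j)"
      unfolding sum_fun_apply by (intro sum.cong refl) (simp only: ab lessThan_iff)
    also have "\<dots> = e r j"
      by (cases "r < ?n \<and> j < ?n") (use ee e0 in \<open>auto\<close>)
    finally show "(\<Sum>i\<in>{..<?n}. Comp (Rep C t) X (?Y i) X (?b i) (?a i)) r j = e r j" .
  qed
  also have "e = Ident (Rep C t) X" by (simp add: Xeq Rep_unfold idempotent_completion_simps)
  finally have sum: "(\<Sum>i\<in>{..<?n}. Comp (Rep C t) X (?Y i) X (?b i) (?a i)) = Ident (Rep C t) X" .
  have "?Y i \<in> Obj (Rep C t) \<and> ?a i \<in> Hom (Rep C t) X (?Y i) \<and> ?b i \<in> Hom (Rep C t) (?Y i) X"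
    if "i \<in> {..<?n}" for i using a b im_u_Obj that by blast
  from K.retract_of_summand[OF X finite_lessThan this sum] have "\<exists>i\<in>{..<?n}. K.retract X (?Y i)" .
  then show ?thesis by blast
qed

lemma factor_through_u:
  assumes q: "q \<in> C k l"
  obtains s x y where "x \<in> lin_hom C k (through_blocks q + of_bool s)"
    "y \<in> lin_hom C (through_blocks q + of_bool s) l"
    "y \<bullet> (u (through_blocks q) s \<bullet> x) = single q c"
proof -
  let ?T = "through_blocks q"
  obtain s where "even (k + ?T + of_bool s)"
    by (cases "even (k + ?T)") (auto intro: that[of False] that[of True])
  then obtain a b where ab: "b \<in> C k (?T + of_bool s)" "a \<in> C (?T + of_bool s) l" "q = pcomp a (pcomp (proj ?T s) b)"
    using factorization[OF q refl] by blast
  \<comment> \<open>\<open>d\<close> collects the loop factors and the scalar of \<open>u\<close>,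
    all of them powers of \<open>t\<close> or their inverses; dividing by it gives any prescribed
    coefficient.\<close>
  obtain d where d: "single a 1 \<bullet> (u ?T s \<bullet> single b 1) = single q d" "d \<noteq> 0"
    using t by (simp add: u_def lin_comp_single ab(3)[symmetric])
  have "single a (c / d) \<bullet> (u ?T s \<bullet> single b 1) = cscale (c / d) (single q d)"
    unfolding d(1)[symmetric] lin_comp_scale_left[symmetric] by (simp add: cscale_single)
  also have "\<dots> = single q c" using d by (simp add: cscale_single)
  finally show ?thesis using that ab lin_hom_single by blast
qed

text \<open>Expanding the middle factor of \<open>e = e \<bullet> (e \<bullet> e)\<close> in
  partitions writes the identity as a sum of terms, each factoring through \<open>u T s\<close> with
  \<open>T\<close> the number of through-blocks of one partition in \<open>e\<close>. One term
  already yields a retract, and \<open>low\<close> bounds its \<open>T\<close>.\<close>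

lemma low_summand_retract:
  assumes e: "K.connected_end (image_obj k e)" and low: "e \<in> low n"
  shows "\<exists>T s. T < n \<and> K.retract (image_obj k e) (im T s (u T s))"
proof -
  let ?X = "image_obj k e"
  have XO: "?X \<in> Obj (Rep C t)" using e by (simp add: K.connected_end_def)
  then have eH: "e \<in> lin_hom C k k" "e \<bullet> e = e" by (auto simp: image_obj_Obj)
  \<comment> \<open>Flag and both factors are packed into one triple, so that a single choice over
    the partitions suffices.\<close>
  have "\<exists>w. fst (snd w) \<in> lin_hom C k (through_blocks q + of_bool (fst w)) \<and>
      snd (snd w) \<in> lin_hom C (through_blocks q + of_bool (fst w)) k \<and>
      snd (snd w) \<bullet> (u (through_blocks q) (fst w) \<bullet> fst (snd w)) = single q (lookup e q)"
    if "q \<in> keys e" for q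
  proof -
    have "q \<in> C k k" using that eH by (auto simp: lin_hom_def)
    then obtain s x y where "x \<in> lin_hom C k (through_blocks q + of_bool s)"
        "y \<in> lin_hom C (through_blocks q + of_bool s) k"
        "y \<bullet> (u (through_blocks q) s \<bullet> x) = single q (lookup e q)"
      by (rule factor_through_u)
    then show ?thesis by (intro exI[of _ "(s, x, y)"]) (simp only: fst_conv snd_conv)
  qed
  then obtain w where w: "\<forall>q \<in> keys e. fst (snd (w q)) \<in> lin_hom C k (through_blocks q + of_bool (fst (w q))) \<and>
      snd (snd (w q)) \<in> lin_hom C (through_blocks q + of_bool (fst (w q))) k \<and>
      snd (snd (w q)) \<bullet> (u (through_blocks q) (fst (w q)) \<bullet> fst (snd (w q))) = single q (lookup e q)"
    using bchoice[of "keys e"] by meson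
  define s x y where "s q = fst (w q)" and "x q = fst (snd (w q))" and "y q = snd (snd (w q))" for q
  have xy: "x q \<in> lin_hom C k (through_blocks q + of_bool (s q))"
    "y q \<in> lin_hom C (through_blocks q + of_bool (s q)) k"
    "y q \<bullet> (u (through_blocks q) (s q) \<bullet> x q) = single q (lookup e q)" if "q \<in> keys e" for q
    using w that unfolding s_def x_def y_def by blast+
  let ?T = "through_blocks"
  let ?Y = "\<lambda>q. im (?T q) (s q) (u (?T q) (s q))"
  \<comment> \<open>Sandwiching the factors of \<open>q\<close> between \<open>e\<close> and
    \<open>u\<close> turns them into morphisms between the images.\<close>
  let ?a = "\<lambda>q. u (?T q) (s q) \<bullet> (x q \<bullet> e)" and ?b = "\<lambda>q. e \<bullet> (y q \<bullet> u (?T q) (s q))"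
  have aH: "?a q \<in> lin_hom C k (?T q + of_bool (s q))" and bH: "?b q \<in> lin_hom C (?T q + of_bool (s q)) k"
    if "q \<in> keys e" for q
    using that lin_hom_comp xy eH u_hom by blast+
  have a: "unit_mat (?a q) \<in> Hom (Rep C t) ?X (?Y q)" if q: "q \<in> keys e" for q
  proof -
    have xe: "x q \<bullet> e \<in> lin_hom C k (?T q + of_bool (s q))" using lin_hom_comp xy(1)[OF q] eH by blast
    have "?a q \<bullet> e = ?a q"
      using comp_assoc[OF eH(1) xe u_hom, of "?T q" "s q"] comp_assoc[OF eH(1) eH(1) xy(1)[OF q]] eH(2) by simp
    moreover have "u (?T q) (s q) \<bullet> ?a q = ?a q"
      using comp_assoc[OF xe u_hom u_hom, of "?T q" "s q" "?T q" "s q"] u_idem by simp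
    ultimately show ?thesis unfolding image_obj_Hom using aH[OF q] by blast
  qed
  have b: "unit_mat (?b q) \<in> Hom (Rep C t) (?Y q) ?X" if q: "q \<in> keys e" for q
  proof -
    have yu: "y q \<bullet> u (?T q) (s q) \<in> lin_hom C (?T q + of_bool (s q)) k" using lin_hom_comp xy(2)[OF q] u_hom by blast
    have "e \<bullet> ?b q = ?b q" using comp_assoc[OF yu eH(1) eH(1)] eH(2) by simp
    moreover have "?b q \<bullet> u (?T q) (s q) = ?b q"
      using comp_assoc[OF u_hom yu eH(1), of "?T q" "s q"]
        comp_assoc[OF u_hom u_hom xy(2)[OF q], of "?T q" "s q" "?T q" "s q"] u_idem by simp
    ultimately show ?thesis unfolding image_obj_Hom using bH[OF q] by blast
  qed
  have ba: "?b q \<bullet> ?a q = e \<bullet> (single q (lookup e q) \<bullet> e)" if q: "q \<in> keys e" for q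
  proof -
    let ?u = "u (?T q) (s q)" and ?m = "?T q + of_bool (s q)"
    have u: "?u \<in> lin_hom C ?m ?m" by (rule u_hom)
    note H = xy(1)[OF q] xy(2)[OF q] eH(1) u
    have yu: "y q \<bullet> ?u \<in> lin_hom C ?m k" and xe: "x q \<bullet> e \<in> lin_hom C k ?m"
      and ux: "?u \<bullet> x q \<in> lin_hom C k ?m" using lin_hom_comp H by blast+
    have "?b q \<bullet> ?a q = e \<bullet> ((y q \<bullet> ?u) \<bullet> ?a q)" by (rule comp_assoc[OF aH[OF q] yu eH(1)])
    moreover have "(y q \<bullet> ?u) \<bullet> ?a q = y q \<bullet> (?u \<bullet> ?a q)" by (rule comp_assoc[OF aH[OF q] u H(2)])
    moreover have "?u \<bullet> ?a q = ?a q" using comp_assoc[OF xe u u] u_idem by simp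
    moreover have "y q \<bullet> ?a q = (y q \<bullet> (?u \<bullet> x q)) \<bullet> e"
      using comp_assoc[OF eH(1) H(1) u] comp_assoc[OF eH(1) ux H(2)] by simp
    ultimately show ?thesis by (simp only: xy(3)[OF q])
  qed
  have "(\<Sum>q\<in>keys e. Comp (Rep C t) ?X (?Y q) ?X (unit_mat (?b q)) (unit_mat (?a q)))
      = (\<Sum>q\<in>keys e. unit_mat (e \<bullet> (single q (lookup e q) \<bullet> e)))"
    unfolding image_obj_Comp by (intro sum.cong refl) (simp add: ba)
  also have "\<dots> = unit_mat (\<Sum>q\<in>keys e. e \<bullet> (single q (lookup e q) \<bullet> e))"
    by (rule unit_mat_sum[symmetric])
  also have "(\<Sum>q\<in>keys e. e \<bullet> (single q (lookup e q) \<bullet> e)) = e \<bullet> ((\<Sum>q\<in>keys e. single q (lookup e q)) \<bullet> e)"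
    unfolding lin_comp_sum_left lin_comp_sum_right ..
  also have "\<dots> = e" unfolding sum_single by (simp add: eH)
  finally have sum: "(\<Sum>q\<in>keys e. Comp (Rep C t) ?X (?Y q) ?X (unit_mat (?b q)) (unit_mat (?a q)))
      = Ident (Rep C t) ?X" unfolding image_obj_Ident .
  have "?Y q \<in> Obj (Rep C t) \<and> unit_mat (?a q) \<in> Hom (Rep C t) ?X (?Y q) \<and>
      unit_mat (?b q) \<in> Hom (Rep C t) (?Y q) ?X" if "q \<in> keys e" for q
    using a b im_u_Obj that by blast
  from K.retract_of_summand[OF e finite_keys this sum] obtain q where "q \<in> keys e" "K.retract ?X (?Y q)"
    by blast
  then show ?thesis using low unfolding low_def by blast
qed

lemma indecomposable_L_triv:
  assumes "indecomposable (Rep C t) X"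
  shows "\<exists>T s. iso_class (Rep C t) X = L_triv C t (T + of_bool s) (proj T s)"
proof -
  have X: "K.connected_end X"
    using Add.indecomposable_connected[of X] assms unfolding Rep_unfold .
  then have XO: "X \<in> Obj (Rep C t)" by (simp add: K.connected_end_def)
  define T where "T = (LEAST T. \<exists>s. K.retract X (im T s (u T s)))"
  obtain k where "K.retract X (im k False (u k False))" using retract_of_generator[OF X] by blast
  then have "\<exists>s. K.retract X (im T s (u T s))"
    unfolding T_def by (intro LeastI[of "\<lambda>T. \<exists>s. K.retract X (im T s (u T s))" k]) blast
  then obtain s where s: "K.retract X (im T s (u T s))" by blast
  let ?K = "T + of_bool s"
  obtain M where M: "M \<in> Hom (additive_completion (Rep0 C t)) [?K] [?K]"
    "Comp (additive_completion (Rep0 C t)) [?K] [?K] [?K] M M = M"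
    "Comp (additive_completion (Rep0 C t)) [?K] [?K] [?K] M (unit_mat (u T s)) = M"
    "Comp (additive_completion (Rep0 C t)) [?K] [?K] [?K] (unit_mat (u T s)) M = M"
    "isomorphic (Rep C t) X ([?K], M)"
    using Add.retract_image[of X "[?K]" "unit_mat (u T s)"] XO im_u_Obj[of T s] s
    unfolding Rep_unfold image_obj_unit_mat by blast
  then obtain e where e: "e \<in> lin_hom C ?K ?K" "M = unit_mat e" unfolding unit_mat_Hom by blast
  have ee: "e \<bullet> e = e" "e \<bullet> u T s = e" "u T s \<bullet> e = e"
    using M(2-4) unfolding e(2) unit_mat_Comp by simp_all
  have iso: "isomorphic (Rep C t) X (im T s e)" using M(5) by (simp add: e(2) image_obj_unit_mat)
  have eO: "im T s e \<in> Obj (Rep C t)" using e ee by (simp add: image_obj_Obj)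
  have conn: "K.connected_end (im T s e)" by (rule K.connected_isomorphic[OF X eO iso])
  have ec: "e \<in> corner_of T s" using e ee by (simp add: corner_iff)
  have "e \<notin> low T"
  proof
    assume "e \<in> low T"
    then obtain T' s' where T': "T' < T" "K.retract (im T s e) (im T' s' (u T' s'))"
      using low_summand_retract[OF conn] by blast
    then have "K.retract X (im T' s' (u T' s'))"
      using K.retract_trans[OF XO eO im_u_Obj K.isomorphic_retract[OF iso]] by blast
    then show False using T'(1) not_less_Least[of T' "\<lambda>T. \<exists>s. K.retract X (im T s (u T s))"]
      unfolding T_def by blast
  qed
  then have eu: "e - u T s \<in> low T" using corner_idempotent[OF ec ee(1)] by blast
  \<comment> \<open>Primitivity follows from \<open>conn\<close>: a splitting of \<open>e\<close> in
    the corner gives an idempotent endomorphism \<open>f\<close> of the image, which must be 0 or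
    \<open>e\<close>.\<close>
  have "primitive_lift C t ?K (proj T s) e"
    unfolding primitive_lift_iff primitive_idempotent_def
  proof (intro conjI ballI impI ec ee(1) eu)
    show "e \<noteq> 0" using \<open>e \<notin> low T\<close> by (auto simp: low_def)
    fix f g assume f: "f \<in> corner_of T s" and "g \<in> corner_of T s"
      and fg: "f \<bullet> f = f \<and> g \<bullet> g = g \<and> f \<bullet> g = 0 \<and> g \<bullet> f = 0 \<and> e = f + g"
    then have "f \<bullet> e = f" "e \<bullet> f = f" by (simp_all add: lin_comp_add_left lin_comp_add_right)
    then have "unit_mat f \<in> Hom (Rep C t) (im T s e) (im T s e)"
      unfolding image_obj_Hom using f by (auto simp: corner_iff)
    moreover have "Comp (Rep C t) (im T s e) (im T s e) (im T s e) (unit_mat f) (unit_mat f) = unit_mat f"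
      unfolding image_obj_Comp using fg by simp
    ultimately have "unit_mat f = 0 \<or> unit_mat f = Ident (Rep C t) (im T s e)"
      using conn unfolding K.connected_end_def by blast
    then show "f = 0 \<or> g = 0" using fg by (auto simp: image_obj_Ident)
  qed
  then have "iso_class (Rep C t) X = L_triv C t ?K (proj T s)"
    using iso K.iso_class_eq_iff[OF XO eO] L_triv_eq by simp
  then show ?thesis by blast
qed

end

theorem lemma5p5:
  fixes C :: "nat \<Rightarrow> nat \<Rightarrow> ptn set"
    and t :: complex
    and \<phi> :: "nat \<times> int \<Rightarrow> rep_obj set"
  assumes "C \<in> {NC', NC'_b}"
    and "t \<noteq> 0"
    and "\<And>k. \<phi> (k, 1) = L_triv C t k (id_ptn k)"
    and "\<And>k. \<phi> (k, -1) = L_triv C t (k + 1) (tensor k k (id_ptn k) beta)"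
  shows "bij_betw \<phi> (UNIV \<times> {1, -1}) (indecomposable_classes (Rep C t))"
proof -
  interpret planar_rep C t by unfold_locales (use assms in auto)
  \<comment> \<open>The sign becomes the flag \<open>s\<close> of \<open>proj\<close>, which merges
    the two defining equations into one.\<close>
  have \<phi>: "\<phi> (k, \<epsilon>) = L_triv C t (k + of_bool (\<epsilon> = -1)) (proj k (\<epsilon> = -1))" if "\<epsilon> \<in> {1, -1}" for k \<epsilon>
    using that assms(3,4) by (auto simp: proj_id proj_beta)
  show ?thesis
  proof (rule bij_betw_imageI)
    show "inj_on \<phi> (UNIV \<times> {1, -1})"
    proof (rule inj_onI, clarify)
      fix k l :: nat and \<epsilon> \<delta> :: int
      assume *: "\<epsilon> \<in> {1, -1}" "\<delta> \<in> {1, -1}" "\<phi> (k, \<epsilon>) = \<phi> (l, \<delta>)"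
      then have "k = l \<and> (\<epsilon> = -1) = (\<delta> = -1)" using L_triv_inject unfolding \<phi>[OF *(1)] \<phi>[OF *(2)] by blast
      then show "k = l \<and> \<epsilon> = \<delta>" using * by auto
    qed
    show "\<phi> ` (UNIV \<times> {1, -1}) = indecomposable_classes (Rep C t)"
    proof (intro equalityI subsetI)
      fix Y assume "Y \<in> \<phi> ` (UNIV \<times> {1, -1})"
      then obtain k \<epsilon> where "\<epsilon> \<in> {1, -1}" "Y = \<phi> (k, \<epsilon>)" by blast
      then show "Y \<in> indecomposable_classes (Rep C t)" by (simp only: \<phi> L_triv_indecomposable)
    next
      fix Y assume "Y \<in> indecomposable_classes (Rep C t)"
      then obtain T s where Y: "Y = L_triv C t (T + of_bool s) (proj T s)"
        using indecomposable_L_triv unfolding indecomposable_classes_def by blast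
      let ?\<epsilon> = "if s then -1 else 1 :: int"
      have "Y = \<phi> (T, ?\<epsilon>)" using \<phi>[of ?\<epsilon> T] by (simp add: Y)
      then show "Y \<in> \<phi> ` (UNIV \<times> {1, -1})" by (rule image_eqI) simp
    qed
  qed
qed

end
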